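(* Let $0<\varepsilon<1$ be fixed. There exists $R_0>0$ (universal, depending on $\varepsilon$) such that the following holds. For every $a\in(0,1)$ there exist constants $C,C_1>0$ depending on $m,k,a,\varepsilon$ such that for every $0<R\le R_0$, every $K\ge0$, every $u\in S^{2,2}_0(B_R\setminus B_{aR})$, every measurable function $V$ satisfying $|V(z,t)|\le K\,\psi(z,t)$, and every $\alpha>\frac{Q-4}{2}$ with also $\alpha\ge C_1(K^{2/3}+1)$, one has $$\alpha^3\int\rho^{-2\alpha-4+\varepsilon}\,u^2\,e^{2\alpha\rho^\varepsilon}\,\psi+\alpha^2\int\rho^{-2\alpha-4}\,u^2\,e^{2\alpha\rho^\varepsilon}\,\psi\;\le\; C\int\rho^{-2\alpha}\,e^{2\alpha\rho^\varepsilon}\,(\mathscr{B}_\gamma u+Vu)^2\,\psi^{-1}.$$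
   Context: Let $m,k\ge 1$ be integers, $\gamma>0$, $N=m+k$, and write points of $\mathbb{R}^N$ as $(z,t)$ with $z\in\mathbb{R}^m$, $t\in\mathbb{R}^k$. Integrals are with respect to Lebesgue measure $dz\,dt$, over $B_R$ (the integrands vanish off the support of $u$). "Universal" constants may depend on $m,k,\gamma$. Vector fields: $X_i=\partial_{z_i}$ for $i=1,\dots,m$, and $X_{m+j}=|z|^\gamma\partial_{t_j}$ for $j=1,\dots,k$. The Baouendi-Grushin operator is $\mathscr{B}_\gamma u=\sum_{i=1}^N X_i^2u=\Delta_z u+|z|^{2\gamma}\Delta_t u$. Also $Xu=(X_1u,\dots,X_Nu)$ and $|Xu|^2=\sum_{i=1}^N (X_iu)^2$. Homogeneous dimension: $Q=m+(\gamma+1)k$. Pseudo-gauge: $\rho(z,t)=\left(|z|^{2(\gamma+1)}+(\gamma+1)^2|t|^2\right)^{\frac{1}{2(\gamma+1)}}$; $B_r=\{(z,t)\in\mathbb{R}^N:\rho(z,t)<r\}$. Angle function: $\psi=|X\rho|^2=|z|^{2\gamma}/\rho^{2\gamma}$, so $0\le\psi\le1$. $S^{2,2}_0(\Omega)$ is the completion of $C_0^\infty(\Omega)$ (smooth functions with compact support contained in $\Omega$) with respect to the norm $\left(\int_\Omega f^2+|Xf|^2+\sum_{i,j=1}^N|X_iX_jf|^2\right)^{1/2}$. The right-hand side of the inequality is allowed to be $+\infty$. *)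

theory Defs
  imports "HOL-Analysis.Analysis"
begin

type_synonym ('m, 'k) point = "(real ^ 'm) \<times> (real ^ 'k)"

section \<open>The Grushin geometry on \<open>\<real>\<^sup>m \<times> \<real>\<^sup>k\<close>\<close>

definition partial_deriv :: "'a::real_normed_vector \<Rightarrow> ('a \<Rightarrow> real) \<Rightarrow> 'a \<Rightarrow> real" where
  "partial_deriv v f p = deriv (\<lambda>s. f (p + s *\<^sub>R v)) 0"

text \<open>
  The index set \<open>{1,\<dots>,N}\<close> is the sum type: \<open>Inl i\<close> stands for \<open>i \<le> m\<close> and \<open>Inr j\<close> for \<open>m + j\<close>.
  An iterated field \<open>X\<^sub>i X\<^sub>j f\<close> of a smooth \<open>f\<close> may fail to exist classically where \<open>z = 0\<close>;
  this is a null set, since \<open>m \<ge> 1\<close>, and only integrals are taken below.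
\<close>

definition X_field ::
  "real \<Rightarrow> 'm + 'k \<Rightarrow> (('m::finite, 'k::finite) point \<Rightarrow> real) \<Rightarrow> ('m, 'k) point \<Rightarrow> real" where
  "X_field \<gamma> l f p =
    (case l of
       Inl i \<Rightarrow> partial_deriv (axis i 1, 0) f p
     | Inr j \<Rightarrow> norm (fst p) powr \<gamma> * partial_deriv (0, axis j 1) f p)"

definition grushin :: "real \<Rightarrow> (('m::finite, 'k::finite) point \<Rightarrow> real) \<Rightarrow> ('m, 'k) point \<Rightarrow> real" where
  "grushin \<gamma> f p = (\<Sum>l\<in>UNIV. X_field \<gamma> l (X_field \<gamma> l f) p)"

definition hom_dim :: "real \<Rightarrow> ('m::finite, 'k::finite) point itself \<Rightarrow> real" where
  "hom_dim \<gamma> _ = real CARD('m) + (\<gamma> + 1) * real CARD('k)"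

definition pgauge :: "real \<Rightarrow> ('m::finite, 'k::finite) point \<Rightarrow> real" where
  "pgauge \<gamma> p =
    (norm (fst p) powr (2 * (\<gamma> + 1)) + (\<gamma> + 1)\<^sup>2 * (norm (snd p))\<^sup>2) powr (1 / (2 * (\<gamma> + 1)))"

definition pball :: "real \<Rightarrow> real \<Rightarrow> ('m::finite, 'k::finite) point set" where
  "pball \<gamma> r = {p. pgauge \<gamma> p < r}"

definition angle_fn :: "real \<Rightarrow> ('m::finite, 'k::finite) point \<Rightarrow> real" where
  "angle_fn \<gamma> p = norm (fst p) powr (2 * \<gamma>) / pgauge \<gamma> p powr (2 * \<gamma>)"

section \<open>The space \<open>S\<^sup>2\<^sup>,\<^sup>2\<^sub>0(\<Omega>)\<close>\<close>

primrec C_k :: "nat \<Rightarrow> ('a::real_normed_vector \<Rightarrow> real) \<Rightarrow> bool" where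
  "C_k 0 f \<longleftrightarrow> continuous_on UNIV f"
| "C_k (Suc n) f \<longleftrightarrow>
     (\<forall>p. f differentiable (at p)) \<and> (\<forall>v. C_k n (\<lambda>p. frechet_derivative f (at p) v))"

definition C0_infinity :: "'a::real_normed_vector set \<Rightarrow> ('a \<Rightarrow> real) set" where
  "C0_infinity \<Omega> =
    {f. (\<forall>n. C_k n f) \<and> compact (closure {p. f p \<noteq> 0}) \<and> closure {p. f p \<noteq> 0} \<subseteq> \<Omega>}"

definition S22_density ::
  "real \<Rightarrow> (('m::finite, 'k::finite) point \<Rightarrow> real) \<Rightarrow> ('m, 'k) point \<Rightarrow> real" where
  "S22_density \<gamma> f p =
    (f p)\<^sup>2 + (\<Sum>i\<in>UNIV. (X_field \<gamma> i f p)\<^sup>2)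
    + (\<Sum>i\<in>UNIV. \<Sum>j\<in>UNIV. (X_field \<gamma> i (X_field \<gamma> j f) p)\<^sup>2)"

definition S22_norm ::
  "real \<Rightarrow> ('m::finite, 'k::finite) point set \<Rightarrow> (('m, 'k) point \<Rightarrow> real) \<Rightarrow> real" where
  "S22_norm \<gamma> \<Omega> f = sqrt (set_lebesgue_integral lebesgue \<Omega> (S22_density \<gamma> f))"

text \<open>
  For \<open>m = 1\<close> and \<open>\<gamma> \<le> 1/2\<close> some smooth functions have infinite norm,
  because \<open>\<partial>\<^bsub>z\<^esub> (|z|\<^sup>\<gamma> \<partial>\<^bsub>t\<^esub> f)\<close> need not be square integrable; the completion is
  that of the functions in \<open>C\<^sub>0\<^sup>\<infinity>(\<Omega>)\<close> with finite norm.
\<close>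

definition S22_test ::
  "real \<Rightarrow> ('m::finite, 'k::finite) point set \<Rightarrow> (('m, 'k) point \<Rightarrow> real) set" where
  "S22_test \<gamma> \<Omega> = {f \<in> C0_infinity \<Omega>. set_integrable lebesgue \<Omega> (S22_density \<gamma> f)}"

definition L2_lim :: "(nat \<Rightarrow> 'a::euclidean_space \<Rightarrow> real) \<Rightarrow> ('a \<Rightarrow> real) \<Rightarrow> bool" where
  "L2_lim f g \<longleftrightarrow> g \<in> borel_measurable lebesgue \<and>
    (\<lambda>n. \<integral>\<^sup>+ p. ennreal ((f n p - g p)\<^sup>2) \<partial>lebesgue) \<longlonglongrightarrow> 0"

text \<open>
  The fields are closable in \<open>L\<^sup>2\<close>, so the completion embeds in \<open>L\<^sup>2\<close>: an element is identified with
  the \<open>L\<^sup>2\<close> limit \<open>u\<close> of a Cauchy sequence of test functions.  The limit is taken on the whole of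
  \<open>\<real>\<^sup>N\<close>, so that \<open>u\<close> is extended by zero off \<open>\<Omega>\<close>.
\<close>

definition S22_approx ::
  "real \<Rightarrow> ('m::finite, 'k::finite) point set \<Rightarrow> (nat \<Rightarrow> ('m, 'k) point \<Rightarrow> real)
    \<Rightarrow> (('m, 'k) point \<Rightarrow> real) \<Rightarrow> bool" where
  "S22_approx \<gamma> \<Omega> \<phi> u \<longleftrightarrow>
    (\<forall>n. \<phi> n \<in> S22_test \<gamma> \<Omega>) \<and>
    (\<forall>e>0. \<exists>M. \<forall>i\<ge>M. \<forall>j\<ge>M. S22_norm \<gamma> \<Omega> (\<lambda>p. \<phi> i p - \<phi> j p) < e) \<and>
    L2_lim \<phi> u"

definition S22_0 ::
  "real \<Rightarrow> ('m::finite, 'k::finite) point set \<Rightarrow> (('m, 'k) point \<Rightarrow> real) set" where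
  "S22_0 \<gamma> \<Omega> = {u. \<exists>\<phi>. S22_approx \<gamma> \<Omega> \<phi> u}"

text \<open>
  The operator extends by continuity from test functions to the completion: \<open>w\<close> is a representative
  of \<open>\<B>\<^sub>\<gamma> u \<in> L\<^sup>2\<close>.  Such \<open>w\<close> exists for every \<open>u \<in> S22_0 \<gamma> \<Omega>\<close> and is unique almost everywhere.
\<close>

definition has_grushin ::
  "real \<Rightarrow> ('m::finite, 'k::finite) point set \<Rightarrow> (('m, 'k) point \<Rightarrow> real)
    \<Rightarrow> (('m, 'k) point \<Rightarrow> real) \<Rightarrow> bool" where
  "has_grushin \<gamma> \<Omega> u w \<longleftrightarrow>
    (\<exists>\<phi>. S22_approx \<gamma> \<Omega> \<phi> u \<and> L2_lim (\<lambda>n. grushin \<gamma> (\<phi> n)) w)"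

end

theory Submission
  imports Defs
begin

text \<open>
  Let \<open>Z\<close> be the generator of the anisotropic dilations, \<open>\<Omega> = \<rho>\<^bsup>-2\<alpha>-4\<^esup> e\<^bsup>2\<alpha>\<rho>\<^sup>\<epsilon>\<^esup>\<close>,
  \<open>b = 2\<alpha> + 2 - 2\<alpha>\<epsilon>\<rho>\<^sup>\<epsilon>\<close> and \<open>\<theta> = \<alpha>\<epsilon>\<^sup>2\<rho>\<^sup>\<epsilon>\<close>, so that \<open>Z \<Omega> = -(b + 2) \<Omega>\<close> and \<open>Z b = -2 \<theta>\<close>.
  For a radial \<open>G\<close> and \<open>H = ZG/2 + (Q/2 - 1) G\<close>, the Rellich identity expresses the integral of
  \<open>\<B>\<^sub>\<gamma> f (G Zf + H f)\<close> by \<open>f\<close> and \<open>Zf\<close> alone, without \<open>|Xf|\<^sup>2\<close>.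
  With \<open>G = b \<rho>\<^sup>2 \<Omega>\<close> the multiplier is \<open>\<rho>\<^sup>2 \<Omega> y\<close>, where \<open>y = b Zf + h f\<close>, and completing squares gives
  exactly
  \<open>\<integral> \<Omega> \<psi> (y\<^sup>2 + \<theta> (b\<^sup>2 - \<epsilon>\<^sup>2) f\<^sup>2 / 2 + 2 \<theta> (Zf - (b/2 - (Q - 2)/2) f)\<^sup>2)\<close>.
  The second term is the one with \<open>\<alpha>\<^sup>3\<close>.  The first order equation \<open>b Zf + h f = y\<close> on an annulus of bounded
  logarithmic width bounds \<open>\<alpha>\<^sup>2 \<integral> \<Omega> \<psi> f\<^sup>2\<close> by \<open>\<integral> \<Omega> \<psi> y\<^sup>2\<close>, which gives the term with \<open>\<alpha>\<^sup>2\<close>.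
  The potential is absorbed by the \<open>\<alpha>\<^sup>3\<close> term.

  The weight \<open>1/\<psi>\<close> on the right-hand side is singular on \<open>z = 0\<close>, so the inequality for test functions does not
  pass to the limit as it stands.  The limit is taken in the identity instead, applied to averages of the test
  functions along the dilations, for which \<open>Zf\<close> is bounded in \<open>L\<^sup>2\<close>; Young's inequality is used with
  \<open>\<B>\<^sub>\<gamma> u\<close> itself.
\<close>


text \<open>The gradient drops out because of the commutator \<open>[X_l, Z] = X_l\<close>:
  integration by parts leaves |Xf|^2 with the coefficient \<open>ZG/2 + (Q/2 - 1) G - H\<close>, and
  H makes it zero. A radial G is used because the horizontal gradients of \<rho> and f have the
  product (\<psi>/\<rho>) Zf; this is how \<psi> enters. The choice of G is
  \<open>- Z (\<rho>^2 \<Omega>)\<close>. The factor with \<rho> to the power \<epsilon> in the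
  exponent makes b strictly decreasing in \<rho>: for a pure power, \<theta> = -Zb/2 would vanish
  and only y^2 would remain. For \<rho> at most 1, b is at least 2(1 - \<epsilon>)\<alpha>, which
  explains \<open>R0 = 1\<close>. Averages along dilations serve better than a mollification because
  \<psi> is invariant under dilations: the norm of the operator applied to u with weight 1/\<psi>
  changes by a factor close to 1 only. The difference between the operator on a test function and on
  u is measured in L^2 without the singular weight.\<close>

abbreviation lebesgue_int :: "('a::euclidean_space \<Rightarrow> real) \<Rightarrow> real" (binder "\<integral>" 10) where
  "lebesgue_int \<equiv> integral\<^sup>L lebesgue"

lemmas lint_add = Bochner_Integration.integral_add
lemmas lint_integrable_add = Bochner_Integration.integrable_add
lemmas lint_cong = Bochner_Integration.integral_cong
lemmas lint_diff = Bochner_Integration.integral_diff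
lemmas lint_integrable_bound = Bochner_Integration.integrable_bound
lemmas lint_nonneg = Bochner_Integration.integral_nonneg

section \<open>Continuous functions supported in a compact set\<close>

text \<open>Once \<open>K\<close> is compact, membership settles integrability and all boundary
  terms. \<open>K\<close> stays fixed through sums and products, and no smoothness is asked.\<close>

definition cont_supp :: "'a::euclidean_space set \<Rightarrow> ('a \<Rightarrow> real) \<Rightarrow> bool" where
  "cont_supp K f \<longleftrightarrow> continuous_on UNIV f \<and> (\<forall>p. p \<notin> K \<longrightarrow> f p = 0)"

lemma cont_suppD: "cont_supp K f \<Longrightarrow> p \<notin> K \<Longrightarrow> f p = 0"
  by (simp add: cont_supp_def)

lemma cont_supp_continuous: "cont_supp K f \<Longrightarrow> continuous_on S f"
  using continuous_on_subset by (auto simp: cont_supp_def)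

lemma cont_supp_add: "cont_supp K f \<Longrightarrow> cont_supp K g \<Longrightarrow> cont_supp K (\<lambda>p. f p + g p)"
  by (auto simp: cont_supp_def intro!: continuous_intros)

lemma cont_supp_diff: "cont_supp K f \<Longrightarrow> cont_supp K g \<Longrightarrow> cont_supp K (\<lambda>p. f p - g p)"
  by (auto simp: cont_supp_def intro!: continuous_intros)

lemma cont_supp_cmult: "cont_supp K f \<Longrightarrow> cont_supp K (\<lambda>p. c * f p)"
  by (auto simp: cont_supp_def intro!: continuous_intros)

lemma cont_supp_sum: "(\<And>i. i \<in> I \<Longrightarrow> cont_supp K (f i)) \<Longrightarrow> cont_supp K (\<lambda>p. \<Sum>i\<in>I. f i p)"
  by (auto simp: cont_supp_def intro!: continuous_intros)

lemma cont_supp_mono: "cont_supp K f \<Longrightarrow> K \<subseteq> K' \<Longrightarrow> cont_supp K' f"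
  by (auto simp: cont_supp_def)

text \<open>\<open>w\<close> may be singular off \<open>U\<close>: the product is continuous on
  \<open>U\<close> and zero on the complement of \<open>K\<close>, and these open sets cover the
  space. Typically \<open>U\<close> is the complement of the origin, where powers of the gauge are
  continuous.\<close>

lemma cont_supp_mult:
  assumes "cont_supp K f" and "compact K" and "open U" and "K \<subseteq> U" and "continuous_on U w"
  shows "cont_supp K (\<lambda>p. w p * f p)"
proof -
  have c: "continuous_on UNIV f" and z: "\<And>p. p \<notin> K \<Longrightarrow> f p = 0"
    using assms(1) by (auto simp: cont_supp_def)
  have 1: "continuous_on U (\<lambda>p. w p * f p)"
    by (intro continuous_intros assms continuous_on_subset[OF c]) auto
  have 2: "continuous_on (- K) (\<lambda>p. w p * f p)"
    by (rule continuous_on_eq[of _ "\<lambda>_. 0"]) (auto simp: z)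
  have "open (- K)"
    using assms(2) by (simp add: compact_imp_closed open_Compl)
  then have "continuous_on (U \<union> - K) (\<lambda>p. w p * f p)"
    by (intro continuous_on_open_Un 1 2 assms(3))
  moreover have "U \<union> - K = UNIV"
    using assms(4) by auto
  ultimately show ?thesis
    by (simp add: cont_supp_def z)
qed

lemma cont_supp_mult2:
  assumes "cont_supp K f" and "cont_supp K g"
  shows "cont_supp K (\<lambda>p. f p * g p)"
  using assms by (auto simp: cont_supp_def intro!: continuous_intros)

lemma cont_supp_integrable:
  fixes f :: "'a::euclidean_space \<Rightarrow> real"
  assumes "compact K" and "cont_supp K f"
  shows "integrable lebesgue f"
proof -
  have c: "continuous_on UNIV f" and z: "\<And>p. p \<notin> K \<Longrightarrow> f p = 0"
    using assms(2) by (auto simp: cont_supp_def)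
  have "integrable lborel (\<lambda>x. indicator K x *\<^sub>R f x)"
    by (rule borel_integrable_compact[OF assms(1) continuous_on_subset[OF c]]) auto
  moreover have "(\<lambda>x. indicator K x *\<^sub>R f x) = f"
    using z by (auto simp: fun_eq_iff indicator_def)
  ultimately have "integrable lborel f"
    by simp
  then show ?thesis
    by (subst integrable_completion) auto
qed

text \<open>Passes from the Lebesgue integral to the integral over a box, the form in which
  differentiation under the integral and the exchange of integrals are applied.\<close>

lemma cont_supp_integral_cbox:
  fixes f :: "'a::euclidean_space \<Rightarrow> real"
  assumes "cont_supp K f" and "compact K" and "K \<subseteq> cbox a b"
  shows "integral (cbox a b) f = integral\<^sup>L lebesgue f"
proof -
  have "integral UNIV f = integral\<^sup>L lebesgue f"
    by (rule integral_lebesgue[OF cont_supp_integrable[OF assms(2,1)]])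
  moreover have "integral (cbox a b) f = integral UNIV f"
  proof -
    have "(\<lambda>x. if x \<in> cbox a b then f x else 0) = f"
      using assms by (auto simp: cont_supp_def fun_eq_iff)
    then show ?thesis
      using integral_restrict_UNIV[of "cbox a b" f] by simp
  qed
  ultimately show ?thesis
    by simp
qed

section \<open>Divergence theorem for the generator of a flow\<close>

lemma DERIV_flow:
  assumes group: "\<And>s t p. T s (T t p) = T (s + t) p"
    and deriv: "\<And>p. ((\<lambda>s. F (T s p)) has_real_derivative F' p) (at 0)"
  shows "((\<lambda>s. F (T s p)) has_real_derivative F' (T s p)) (at s)"
proof -
  have "((\<lambda>t. F (T (t - s) (T s p))) has_real_derivative F' (T s p) * 1) (at s)"
    by (rule DERIV_chain2[where f="\<lambda>t. F (T t (T s p))"]) (auto intro!: derivative_eq_intros deriv)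
  then show ?thesis
    by (simp add: group)
qed

text \<open>
  Differentiating \<open>\<integral> F \<circ> T s = J s \<integral> F\<close> at \<open>s = 0\<close> is the divergence theorem for the generator of \<open>T\<close>.
  Nothing is asked of \<open>F\<close> in other directions: below, \<open>F\<close> contains powers of \<open>|z|\<close> that are
  differentiable along the dilations only.
\<close>

lemma flow_integral_derivative:
  fixes T :: "real \<Rightarrow> 'a::euclidean_space \<Rightarrow> 'a" and F F' :: "'a \<Rightarrow> real"
  assumes K: "compact K" and F: "cont_supp K F" and F': "cont_supp K F'"
    and T: "continuous_on UNIV (\<lambda>(s, p). T s p)"
    and T0: "\<And>p. T 0 p = p" and group: "\<And>s t p. T s (T t p) = T (s + t) p"
    and deriv0: "\<And>p. ((\<lambda>s. F (T s p)) has_real_derivative F' p) (at 0)"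
    and J: "\<And>s. (\<integral>p. F (T s p)) = J s * (\<integral>p. F p)"
    and J': "(J has_real_derivative J') (at 0)"
  shows "(\<integral>p. F' p) = J' * (\<integral>p. F p)"
proof -
  have inv: "T (- s) (T s p) = p" for s p
    by (simp add: group T0)
  note deriv = DERIV_flow[of T F F', OF group deriv0]
  let ?U = "{-1..1::real}"
  \<comment> \<open>The interval is symmetric, so \<open>K'\<close> also contains the image of
    \<open>K\<close> under \<open>T (- s)\<close>, which carries the function \<open>F\<close>
    composed with \<open>T s\<close>.\<close>
  define K' where "K' = (\<lambda>(s, p). T s p) ` (?U \<times> K)"
  have cK': "compact K'"
    unfolding K'_def
    by (intro compact_continuous_image continuous_on_subset[OF T] compact_Times K) auto
  then obtain a where a: "K' \<subseteq> cbox (- a) a"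
    using bounded_subset_cbox_symmetric[OF compact_imp_bounded] by metis
  have T_cont: "continuous_on UNIV (T s)" for s
  proof -
    have "continuous_on UNIV (\<lambda>p. (\<lambda>(s, p). T s p) (s, p))"
      by (rule continuous_on_compose2[OF T]) (intro continuous_intros, rule subset_UNIV)
    then show ?thesis by simp
  qed
  have supp: "cont_supp K' (\<lambda>p. G (T s p))" if "s \<in> ?U" "cont_supp K G" for s G
    unfolding cont_supp_def
  proof (intro conjI allI impI)
    show "continuous_on UNIV (\<lambda>p. G (T s p))"
      using that(2) by (intro continuous_on_compose2[OF _ T_cont, of UNIV]) (auto simp: cont_supp_def)
    fix p assume "p \<notin> K'"
    have "T s p \<notin> K"
    proof
      assume "T s p \<in> K"
      then have "T (- s) (T s p) \<in> K'"
        using that(1) by (force simp: K'_def)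
      with \<open>p \<notin> K'\<close> show False by (simp add: inv)
    qed
    then show "G (T s p) = 0"
      using that(2) by (simp add: cont_supp_def)
  qed
  have D: "((\<lambda>s. integral (cbox (- a) a) (\<lambda>p. F (T s p))) has_field_derivative
      integral (cbox (- a) a) (\<lambda>p. F' (T 0 p))) (at 0 within ?U)"
  proof (rule leibniz_rule_field_derivative[where fx="\<lambda>s p. F' (T s p)"])
    show "((\<lambda>s. F (T s p)) has_field_derivative F' (T s p)) (at s within ?U)" for s p
      using deriv by (rule has_field_derivative_at_within)
    show "(\<lambda>p. F (T s p)) integrable_on cbox (- a) a" if "s \<in> ?U" for s
    proof (rule integrable_continuous, rule continuous_on_subset[OF _ subset_UNIV])
      show "continuous_on UNIV (\<lambda>p. F (T s p))"
        using supp[OF that F] by (simp add: cont_supp_def)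
    qed
    have "continuous_on UNIV (\<lambda>z. F' ((\<lambda>(s, p). T s p) z))"
      using F' by (intro continuous_on_compose2[OF _ T, of UNIV]) (auto simp: cont_supp_def)
    then show "continuous_on (?U \<times> cbox (- a) a) (\<lambda>(s, p). F' (T s p))"
      by (auto simp: case_prod_beta intro: continuous_on_subset)
  qed auto
  have E: "integral (cbox (- a) a) (\<lambda>p. F (T s p)) = J s * (\<integral>p. F p)" if "s \<in> ?U" for s
    using cont_supp_integral_cbox[OF supp[OF that F] cK' a] J by simp
  have E': "integral (cbox (- a) a) (\<lambda>p. F' (T 0 p)) = (\<integral>p. F' p)"
    using cont_supp_integral_cbox[OF supp[OF _ F'] cK' a, of 0] by (simp add: T0)
  have "((\<lambda>s. J s * (\<integral>p. F p)) has_real_derivative (\<integral>p. F' p)) (at 0 within ?U)"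
    unfolding has_field_derivative_def
    by (rule has_derivative_transform[OF _ _ D[unfolded has_field_derivative_def E']])
       (simp_all add: E)
  moreover have "at 0 within ?U = at (0::real)"
    by (rule at_within_interior) auto
  ultimately have "((\<lambda>s. J s * (\<integral>p. F p)) has_real_derivative (\<integral>p. F' p)) (at 0)"
    by simp
  moreover have "((\<lambda>s. J s * (\<integral>p. F p)) has_real_derivative J' * (\<integral>p. F p)) (at 0)"
    by (rule DERIV_cmult_right[OF J'])
  ultimately show ?thesis
    by (rule DERIV_unique)
qed

lemma DERIV_outside_support:
  fixes c :: "real \<Rightarrow> 'a::euclidean_space"
  assumes "compact K" and F: "cont_supp K F" and "c 0 \<notin> K" and c: "continuous_on UNIV c"
  shows "((\<lambda>s. F (c s)) has_real_derivative 0) (at 0)"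
proof -
  have "open (c -` (- K))"
    using assms(1) by (intro open_vimage c) (simp add: compact_imp_closed open_Compl)
  then have "\<forall>\<^sub>F s in nhds 0. s \<in> c -` (- K)"
    using assms(3) by (intro eventually_nhds_in_open) auto
  then have "\<forall>\<^sub>F s in nhds 0. F (c s) = 0"
    by eventually_elim (use F in \<open>auto simp: cont_supp_def\<close>)
  then show ?thesis
    by (subst DERIV_cong_ev[OF refl _ refl]) auto
qed

text \<open>Translations preserve Lebesgue measure, so \<open>J = 1\<close>. This is integration by
  parts in one direction, with differentiability asked along \<open>v\<close> only.\<close>

lemma integral_directional_derivative:
  fixes F F' :: "'a::euclidean_space \<Rightarrow> real"
  assumes K: "compact K" and F: "cont_supp K F" and F': "cont_supp K F'"
    and "\<And>p. p \<in> K \<Longrightarrow> ((\<lambda>s. F (p + s *\<^sub>R v)) has_real_derivative F' p) (at 0)"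
  shows "(\<integral>p. F' p) = 0"
proof -
  have deriv: "((\<lambda>s. F (p + s *\<^sub>R v)) has_real_derivative F' p) (at 0)" for p
  proof (cases "p \<in> K")
    case False
    then show ?thesis
      using DERIV_outside_support[OF K F, of "\<lambda>s. p + s *\<^sub>R v"] F'
      by (simp add: cont_supp_def continuous_intros)
  qed (rule assms)
  have "(\<integral>p. F' p) = 0 * (\<integral>p. F p)"
  proof (rule flow_integral_derivative[OF K F F', where T="\<lambda>s p. p + s *\<^sub>R v" and J="\<lambda>_. 1"])
    show "((\<lambda>s. F (p + s *\<^sub>R v)) has_real_derivative F' p) (at 0)" for p
      by (rule deriv)
    show "(\<integral>p. F (p + s *\<^sub>R v)) = 1 * (\<integral>p. F p)" for s
    proof -
      have c: "continuous_on UNIV F"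
        using F by (simp add: cont_supp_def)
      then have [measurable]: "F \<in> borel_measurable borel"
        by (rule borel_measurable_continuous_onI)
      have "(\<integral>p. F (p + s *\<^sub>R v)) = (\<integral>p. F (s *\<^sub>R v + p) \<partial>lborel)"
        by (subst integral_completion) (simp_all add: add.commute)
      also have "\<dots> = (\<integral>p. F p \<partial>(distr lborel borel ((+) (s *\<^sub>R v))))"
        by (subst integral_distr) auto
      also have "\<dots> = (\<integral>p. F p)"
        by (simp add: lborel_distr_plus integral_completion)
      finally show ?thesis by simp
    qed
  qed (auto intro!: continuous_intros derivative_eq_intros simp: case_prod_beta algebra_simps)
  then show ?thesis by simp
qed

section \<open>Dilations\<close>

definition dil :: "real \<Rightarrow> real \<Rightarrow> ('m::finite, 'k::finite) point \<Rightarrow> ('m, 'k) point" where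
  "dil \<gamma> s p = (exp s *\<^sub>R fst p, exp ((\<gamma> + 1) * s) *\<^sub>R snd p)"

lemma dil_0 [simp]: "dil \<gamma> 0 p = p"
  by (simp add: dil_def)

lemma dil_dil: "dil \<gamma> s (dil \<gamma> t p) = dil \<gamma> (s + t) p"
  by (simp add: dil_def exp_add[symmetric] algebra_simps)

lemma continuous_dil: "continuous_on UNIV (\<lambda>(s, p). dil \<gamma> s p)"
  by (auto simp: dil_def case_prod_beta intro!: continuous_intros)

text \<open>The dilation as a diagonal map on the standard basis, as the affine change of variables
  wants it; \<open>snd j = 0\<close> recognises the basis vectors of the first factor.\<close>

definition dil_coeff :: "real \<Rightarrow> real \<Rightarrow> ('m::finite, 'k::finite) point \<Rightarrow> real" where
  "dil_coeff \<gamma> s j = (if snd j = 0 then exp s else exp ((\<gamma> + 1) * s))"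

lemma dil_coeff_pos: "dil_coeff \<gamma> s j > 0"
  by (simp add: dil_coeff_def)

lemma dil_eq_sum: "dil \<gamma> s p = 0 + (\<Sum>j\<in>Basis. (dil_coeff \<gamma> s j * (p \<bullet> j)) *\<^sub>R j)"
proof (rule prod_eqI)
  have "fst (\<Sum>j\<in>Basis. (dil_coeff \<gamma> s j * (p \<bullet> j)) *\<^sub>R j)
      = (\<Sum>b\<in>Basis. (exp s * (fst p \<bullet> b)) *\<^sub>R b)"
    by (simp add: fst_sum sum_Basis_prod_eq dil_coeff_def inner_prod_def)
  also have "\<dots> = (\<Sum>b\<in>Basis. (exp s *\<^sub>R fst p \<bullet> b) *\<^sub>R b)"
    by simp
  also have "\<dots> = exp s *\<^sub>R fst p"
    by (rule euclidean_representation)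
  finally show "fst (dil \<gamma> s p) = fst (0 + (\<Sum>j\<in>Basis. (dil_coeff \<gamma> s j * (p \<bullet> j)) *\<^sub>R j))"
    by (simp add: dil_def)
  have "snd (\<Sum>j\<in>Basis. (dil_coeff \<gamma> s j * (p \<bullet> j)) *\<^sub>R j)
      = (\<Sum>b\<in>Basis. (exp ((\<gamma> + 1) * s) * (snd p \<bullet> b)) *\<^sub>R b)"
    by (auto simp: snd_sum sum_Basis_prod_eq dil_coeff_def inner_prod_def intro!: sum.cong)
  also have "\<dots> = (\<Sum>b\<in>Basis. (exp ((\<gamma> + 1) * s) *\<^sub>R snd p \<bullet> b) *\<^sub>R b)"
    by simp
  also have "\<dots> = exp ((\<gamma> + 1) * s) *\<^sub>R snd p"
    by (rule euclidean_representation)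
  finally show "snd (dil \<gamma> s p) = snd (0 + (\<Sum>j\<in>Basis. (dil_coeff \<gamma> s j * (p \<bullet> j)) *\<^sub>R j))"
    by (simp add: dil_def)
qed

text \<open>The Jacobian of the dilation. Here the homogeneous dimension enters: m factors
  \<open>exp s\<close> and k factors \<open>exp ((\<gamma> + 1) * s)\<close>.\<close>

lemma prod_dil_coeff:
  "(\<Prod>j\<in>(Basis :: ('m::finite, 'k::finite) point set). \<bar>dil_coeff \<gamma> s j\<bar>)
    = exp (s * hom_dim \<gamma> TYPE(('m, 'k) point))"
proof -
  let ?A = "(\<lambda>u. (u, 0 :: real^'k)) ` (Basis :: (real^'m) set)" and ?B = "(\<lambda>u. (0 :: real^'m, u)) ` (Basis :: (real^'k) set)"
  have "(\<Prod>j\<in>(Basis :: ('m, 'k) point set). \<bar>dil_coeff \<gamma> s j\<bar>) = (\<Prod>j\<in>?A. \<bar>dil_coeff \<gamma> s j\<bar>) * (\<Prod>j\<in>?B. \<bar>dil_coeff \<gamma> s j\<bar>)"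
    unfolding Basis_prod_def by (rule prod.union_disjoint) auto
  also have "(\<Prod>j\<in>?A. \<bar>dil_coeff \<gamma> s j\<bar>) = exp s ^ CARD('m)"
    by (subst prod.reindex) (auto simp: inj_on_def dil_coeff_def)
  also have "(\<Prod>j\<in>?B. \<bar>dil_coeff \<gamma> s j\<bar>) = (\<Prod>j\<in>(Basis :: (real^'k) set). exp ((\<gamma> + 1) * s))"
    by (rule prod.reindex_cong[of "\<lambda>u. (0, u)"]) (auto simp: inj_on_def dil_coeff_def)
  also have "\<dots> = exp ((\<gamma> + 1) * s) ^ CARD('k)"
    by simp
  finally show ?thesis
    by (simp add: hom_dim_def exp_of_nat_mult[symmetric] exp_add[symmetric] algebra_simps)
qed

lemma lebesgue_dil:
  shows "(lebesgue :: ('m::finite, 'k::finite) point measure) =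
      density (distr lebesgue lebesgue (dil \<gamma> s)) (\<lambda>_. exp (s * hom_dim \<gamma> TYPE(('m, 'k) point)))"
    and "(dil \<gamma> s :: ('m::finite, 'k::finite) point \<Rightarrow> _) \<in> lebesgue \<rightarrow>\<^sub>M lebesgue"
proof -
  have c: "dil_coeff \<gamma> s j \<noteq> 0" for j :: "('m, 'k) point"
    using dil_coeff_pos[of \<gamma> s j] by simp
  have T: "(\<lambda>x. 0 + (\<Sum>j\<in>Basis. (dil_coeff \<gamma> s j * (x \<bullet> j)) *\<^sub>R j))
      = (dil \<gamma> s :: ('m, 'k) point \<Rightarrow> _)"
    by (rule ext) (rule dil_eq_sum[symmetric])
  show "(lebesgue :: ('m::finite, 'k::finite) point measure) =
      density (distr lebesgue lebesgue (dil \<gamma> s)) (\<lambda>_. exp (s * hom_dim \<gamma> TYPE(('m, 'k) point)))"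
    using lebesgue_affine_euclidean[of "dil_coeff \<gamma> s :: ('m, 'k) point \<Rightarrow> real" 0, OF c]
    unfolding T prod_dil_coeff .
  show "(dil \<gamma> s :: ('m::finite, 'k::finite) point \<Rightarrow> _) \<in> lebesgue \<rightarrow>\<^sub>M lebesgue"
    using lebesgue_affine_measurable[of "dil_coeff \<gamma> s :: ('m, 'k) point \<Rightarrow> real" 0, OF c]
    unfolding T .
qed

lemma nn_integral_dil:
  fixes F :: "('m::finite, 'k::finite) point \<Rightarrow> ennreal"
  assumes [measurable]: "F \<in> borel_measurable lebesgue"
  shows "(\<integral>\<^sup>+p. F (dil \<gamma> s p) \<partial>lebesgue)
    = ennreal (exp (- s * hom_dim \<gamma> TYPE(('m, 'k) point))) * (\<integral>\<^sup>+p. F p \<partial>lebesgue)"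
proof -
  note [measurable] = lebesgue_dil(2)
  let ?e = "exp (s * hom_dim \<gamma> TYPE(('m, 'k) point))"
  have "(\<integral>\<^sup>+p. F p \<partial>lebesgue) = (\<integral>\<^sup>+p. F p \<partial>(density (distr lebesgue lebesgue (dil \<gamma> s)) (\<lambda>_. ennreal ?e)))"
    using lebesgue_dil(1) by metis
  also have "\<dots> = ennreal ?e * (\<integral>\<^sup>+p. F (dil \<gamma> s p) \<partial>lebesgue)"
    by (subst nn_integral_density) (auto simp: nn_integral_cmult nn_integral_distr)
  finally have "(\<integral>\<^sup>+p. F p \<partial>lebesgue) = ennreal ?e * (\<integral>\<^sup>+p. F (dil \<gamma> s p) \<partial>lebesgue)" .
  then have "ennreal (exp (- s * hom_dim \<gamma> TYPE(('m, 'k) point))) * (\<integral>\<^sup>+p. F p \<partial>lebesgue)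
    = ennreal (exp (- s * hom_dim \<gamma> TYPE(('m, 'k) point)) * ?e) * (\<integral>\<^sup>+p. F (dil \<gamma> s p) \<partial>lebesgue)"
    by (simp add: ennreal_mult mult.assoc)
  then show ?thesis
    by (simp add: exp_add[symmetric])
qed

lemma integral_dil:
  fixes F :: "('m::finite, 'k::finite) point \<Rightarrow> real"
  assumes [measurable]: "F \<in> borel_measurable lebesgue"
  shows "(\<integral>p. F (dil \<gamma> s p))
    = exp (- s * hom_dim \<gamma> TYPE(('m, 'k) point)) * (\<integral>p. F p)"
proof -
  note [measurable] = lebesgue_dil(2)
  let ?e = "exp (s * hom_dim \<gamma> TYPE(('m, 'k) point))"
  have "(\<integral>p. F p) = (\<integral>p. F p \<partial>(density (distr lebesgue lebesgue (dil \<gamma> s)) (\<lambda>_. ennreal ?e)))"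
    using lebesgue_dil(1) by metis
  also have "\<dots> = ?e * (\<integral>p. F (dil \<gamma> s p))"
    by (subst integral_density) (auto simp: integral_distr)
  finally show ?thesis
    by (simp add: exp_minus)
qed

text \<open>The factor \<open>exp (- s * Q)\<close> has derivative -Q at 0; in other words, Z has
  divergence Q.\<close>

lemma integral_dilation_derivative:
  fixes F F' :: "('m::finite, 'k::finite) point \<Rightarrow> real"
  assumes K: "compact K" and F: "cont_supp K F" and F': "cont_supp K F'"
    and "\<And>p. p \<in> K \<Longrightarrow> ((\<lambda>s. F (dil \<gamma> s p)) has_real_derivative F' p) (at 0)"
  shows "(\<integral>p. F' p) = - hom_dim \<gamma> TYPE(('m, 'k) point) * (\<integral>p. F p)"
proof -
  have deriv: "((\<lambda>s. F (dil \<gamma> s p)) has_real_derivative F' p) (at 0)" for p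
  proof (cases "p \<in> K")
    case False
    moreover have "continuous_on UNIV (\<lambda>s. dil \<gamma> s p)"
      by (simp add: dil_def continuous_intros)
    ultimately show ?thesis
      using DERIV_outside_support[OF K F, of "\<lambda>s. dil \<gamma> s p"] cont_suppD[OF F' False] by simp
  qed (rule assms)
  show ?thesis
  proof (rule flow_integral_derivative[OF K F F', where T="dil \<gamma>" and
      J="\<lambda>s. exp (- s * hom_dim \<gamma> TYPE(('m, 'k) point))"])
    show "((\<lambda>s. F (dil \<gamma> s p)) has_real_derivative F' p) (at 0)" for p
      by (rule deriv)
  show "(\<integral>p. F (dil \<gamma> s p))
    = exp (- s * hom_dim \<gamma> TYPE(('m, 'k) point)) * (\<integral>p. F p)" for s
    by (rule integral_dil, rule borel_measurable_integrable[OF cont_supp_integrable[OF K F]])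
qed (auto intro!: derivative_eq_intros continuous_dil simp: dil_dil)
qed


section \<open>The gauge\<close>

definition cdir :: "'m + 'k \<Rightarrow> ('m::finite, 'k::finite) point" where
  "cdir l = (case l of Inl i \<Rightarrow> (axis i 1, 0) | Inr j \<Rightarrow> (0, axis j 1))"

text \<open>The homogeneity of the coordinate: Z is the sum over l of
  \<open>wt \<gamma> l * (p \<bullet> cdir l)\<close> times the derivative along
  \<open>cdir l\<close>.\<close>

definition wt :: "real \<Rightarrow> 'm + 'k \<Rightarrow> real" where
  "wt \<gamma> l = (case l of Inl i \<Rightarrow> 1 | Inr j \<Rightarrow> \<gamma> + 1)"

definition xcoeff :: "real \<Rightarrow> 'm + 'k \<Rightarrow> ('m::finite, 'k::finite) point \<Rightarrow> real" where
  "xcoeff \<gamma> l p = (case l of Inl i \<Rightarrow> 1 | Inr j \<Rightarrow> norm (fst p) powr \<gamma>)"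

definition gauge_pow :: "real \<Rightarrow> ('m::finite, 'k::finite) point \<Rightarrow> real" where
  "gauge_pow \<gamma> p = norm (fst p) powr (2 * (\<gamma> + 1)) + (\<gamma> + 1)\<^sup>2 * (norm (snd p))\<^sup>2"

lemma pgauge_eq: "pgauge \<gamma> p = gauge_pow \<gamma> p powr (1 / (2 * (\<gamma> + 1)))"
  by (simp add: pgauge_def gauge_pow_def)

lemma gauge_pow_nonneg: "gauge_pow \<gamma> p \<ge> 0"
  by (simp add: gauge_pow_def)

lemma gauge_pow_pos_iff:
  assumes "\<gamma> > 0"
  shows "gauge_pow \<gamma> p > 0 \<longleftrightarrow> p \<noteq> 0"
proof
  assume "gauge_pow \<gamma> p > 0"
  then show "p \<noteq> 0"
    by (auto simp: gauge_pow_def)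
next
  assume "p \<noteq> 0"
  then have "fst p \<noteq> 0 \<or> snd p \<noteq> 0"
    by (simp add: prod_eq_iff)
  then show "gauge_pow \<gamma> p > 0"
  proof
    assume "fst p \<noteq> 0"
    then show ?thesis
      unfolding gauge_pow_def by (intro add_pos_nonneg) auto
  next
    assume "snd p \<noteq> 0"
    then show ?thesis
      unfolding gauge_pow_def using assms by (intro add_nonneg_pos) auto
  qed
qed

lemma pgauge_nonneg: "pgauge \<gamma> p \<ge> 0"
  by (simp add: pgauge_eq)

lemma pgauge_pos_iff: "\<gamma> > 0 \<Longrightarrow> pgauge \<gamma> p > 0 \<longleftrightarrow> p \<noteq> 0"
  using gauge_pow_pos_iff[of \<gamma> p] gauge_pow_nonneg[of \<gamma> p] by (auto simp: pgauge_eq)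

lemma pgauge_powr:
  assumes "\<gamma> > 0"
  shows "pgauge \<gamma> p powr (2 * (\<gamma> + 1)) = gauge_pow \<gamma> p"
  using assms gauge_pow_nonneg[of \<gamma> p] by (simp add: pgauge_eq powr_powr)

lemma gauge_pow_dil: "gauge_pow \<gamma> (dil \<gamma> s p) = exp (2 * (\<gamma> + 1) * s) * gauge_pow \<gamma> p"
  by (simp add: gauge_pow_def dil_def powr_mult power_mult_distrib algebra_simps
      exp_powr_real exp_double[symmetric])

lemma pgauge_dil: "\<gamma> > 0 \<Longrightarrow> pgauge \<gamma> (dil \<gamma> s p) = exp s * pgauge \<gamma> p"
  by (simp add: pgauge_eq gauge_pow_dil powr_mult gauge_pow_nonneg exp_powr_real)

lemma continuous_norm_powr:
  "c > 0 \<Longrightarrow> continuous_on S (\<lambda>p::('m::finite, 'k::finite) point. norm (fst p) powr c)"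
  by (rule continuous_on_powr') (auto intro!: continuous_intros)

lemma continuous_gauge_pow: "\<gamma> > 0 \<Longrightarrow> continuous_on S (gauge_pow \<gamma>)"
  unfolding gauge_pow_def[abs_def] by (intro continuous_intros continuous_norm_powr) auto

lemma continuous_pgauge: "\<gamma> > 0 \<Longrightarrow> continuous_on S (pgauge \<gamma>)"
  unfolding pgauge_eq[abs_def]
  by (rule continuous_on_powr') (auto intro!: continuous_intros continuous_gauge_pow simp: gauge_pow_nonneg)

lemma continuous_radial:
  "\<gamma> > 0 \<Longrightarrow> continuous_on {0<..} g \<Longrightarrow> continuous_on (- {0}) (\<lambda>p. g (pgauge \<gamma> p))"
  by (rule continuous_on_compose2[OF _ continuous_pgauge]) (auto simp: pgauge_pos_iff)

lemma continuous_xcoeff: "\<gamma> > 0 \<Longrightarrow> continuous_on S (xcoeff \<gamma> l)"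
  by (cases l) (auto simp: xcoeff_def[abs_def] intro!: continuous_norm_powr continuous_intros)

text \<open>A derivative along \<open>cdir l\<close> of a function composed with the dilation gains
  \<open>exp (wt \<gamma> l * s)\<close>, so every field X_l is homogeneous of degree one.\<close>

lemma xcoeff_dil: "xcoeff \<gamma> l (dil \<gamma> s p) = exp ((wt \<gamma> l - 1) * s) * xcoeff \<gamma> l p"
  by (cases l) (auto simp: xcoeff_def wt_def dil_def powr_mult exp_powr_real mult.commute)

text \<open>Hence the square of X_l is \<open>xcoeff\<close> squared times the pure second
  derivative along \<open>cdir l\<close>.\<close>

lemma xcoeff_cdir: "xcoeff \<gamma> l (p + s *\<^sub>R cdir l) = xcoeff \<gamma> l p"
  by (cases l) (auto simp: xcoeff_def cdir_def)

text \<open>This is \<psi>/\<rho>^2. Written with \<open>gauge_pow\<close> it comes directly out of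
  differentiating the gauge.\<close>

definition gchi :: "real \<Rightarrow> ('m::finite, 'k::finite) point \<Rightarrow> real" where
  "gchi \<gamma> p = norm (fst p) powr (2 * \<gamma>) / gauge_pow \<gamma> p"

lemma continuous_gchi: "\<gamma> > 0 \<Longrightarrow> continuous_on (- {0}) (gchi \<gamma>)"
  unfolding gchi_def[abs_def]
  by (intro continuous_intros continuous_norm_powr continuous_gauge_pow)
     (auto dest: gauge_pow_pos_iff[THEN iffD2, THEN less_imp_neq])

lemma angle_fn_eq:
  assumes "\<gamma> > 0"
  shows "angle_fn \<gamma> p = (pgauge \<gamma> p)\<^sup>2 * gchi \<gamma> p"
proof (cases "p = 0")
  case True
  then show ?thesis by (simp add: angle_fn_def gchi_def)
next
  case False
  then have r: "pgauge \<gamma> p > 0"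
    using assms by (simp add: pgauge_pos_iff)
  have "gauge_pow \<gamma> p = (pgauge \<gamma> p)\<^sup>2 * pgauge \<gamma> p powr (2 * \<gamma>)"
    unfolding pgauge_powr[OF assms, symmetric]
    using r by (simp add: powr_add[symmetric] powr_numeral[symmetric] algebra_simps del: powr_numeral)
  then show ?thesis
    using r by (simp add: angle_fn_def gchi_def)
qed

lemma continuous_angle: "\<gamma> > 0 \<Longrightarrow> continuous_on (- {0}) (angle_fn \<gamma>)"
  by (rule continuous_on_eq[OF _ angle_fn_eq[symmetric]]) (intro continuous_intros continuous_gchi continuous_pgauge)

text \<open>Because of this invariance \<psi> is never differentiated along the flow, and 1/\<psi>
  passes through averages along dilations.\<close>

lemma angle_dil: "\<gamma> > 0 \<Longrightarrow> angle_fn \<gamma> (dil \<gamma> s p) = angle_fn \<gamma> p"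
  by (simp add: angle_fn_def pgauge_dil pgauge_nonneg powr_mult exp_powr_real)
     (simp add: dil_def powr_mult exp_powr_real)

lemma angle_nonneg: "angle_fn \<gamma> p \<ge> 0"
  by (simp add: angle_fn_def)

lemma norm_fst_le_pgauge:
  assumes "\<gamma> > 0"
  shows "norm (fst p) \<le> pgauge \<gamma> p"
proof -
  have "norm (fst p) = (norm (fst p) powr (2 * (\<gamma> + 1))) powr (1 / (2 * (\<gamma> + 1)))"
    using assms by (simp add: powr_powr)
  also have "\<dots> \<le> pgauge \<gamma> p"
    unfolding pgauge_eq using assms by (intro powr_mono2) (auto simp: gauge_pow_def)
  finally show ?thesis .
qed

lemma angle_le_1:
  assumes "\<gamma> > 0"
  shows "angle_fn \<gamma> p \<le> 1"
proof -
  have "norm (fst p) powr (2 * \<gamma>) \<le> pgauge \<gamma> p powr (2 * \<gamma>)"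
    using assms by (intro powr_mono2 norm_fst_le_pgauge) auto
  then show ?thesis
    unfolding angle_fn_def by (auto intro: divide_le_eq_1[THEN iffD2])
qed

lemma angle_pos: 
  assumes "\<gamma> > 0" and "fst p \<noteq> 0"
  shows "angle_fn \<gamma> p > 0"
proof -
  have "p \<noteq> 0" using assms(2) by auto
  then show ?thesis
    using assms pgauge_pos_iff[of \<gamma> p] by (simp add: angle_fn_def)
qed

text \<open>The angle function is positive off z = 0, so 1/\<psi> makes sense almost everywhere. An
  index type is nonempty, so z = 0 lies in a coordinate hyperplane.\<close>

lemma AE_fst_nonzero: "AE p in (lebesgue :: ('m::finite, 'k::finite) point measure). fst p \<noteq> 0"
proof -
  obtain i :: 'm where True by simp
  let ?b = "(axis i 1, 0) :: ('m, 'k) point"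
  have "negligible {p :: ('m, 'k) point. ?b \<bullet> p = 0}"
    by (rule negligible_hyperplane) (auto simp: zero_prod_def axis_eq_0_iff)
  moreover have "{p :: ('m, 'k) point. fst p = 0} \<subseteq> {p. ?b \<bullet> p = 0}"
    by (auto simp: inner_prod_def)
  ultimately have "negligible {p :: ('m, 'k) point. fst p = 0}"
    by (rule negligible_subset)
  then show ?thesis
    by (intro AE_I'[of "{p. fst p = 0}"]) (auto simp: negligible_iff_null_sets)
qed

lemma DERIV_dil_pgauge:
  "\<gamma> > 0 \<Longrightarrow> ((\<lambda>s. pgauge \<gamma> (dil \<gamma> s p)) has_real_derivative pgauge \<gamma> p) (at 0)"
  by (auto simp: pgauge_dil intro!: derivative_eq_intros)

lemma DERIV_dil_xcoeff:
  "((\<lambda>s. xcoeff \<gamma> l (dil \<gamma> s p)) has_real_derivative (wt \<gamma> l - 1) * xcoeff \<gamma> l p) (at 0)"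
  unfolding xcoeff_dil by (auto intro!: derivative_eq_intros)

text \<open>The norm is not differentiable at 0, but its power with an exponent above 2 is; the
  stated derivative is 0 there.\<close>

lemma DERIV_norm_powr:
  fixes z v :: "'a::real_inner"
  assumes "\<gamma> > 0"
  shows "((\<lambda>s. norm (z + s *\<^sub>R v) powr (2 * (\<gamma> + 1))) has_real_derivative
    2 * (\<gamma> + 1) * norm z powr (2 * \<gamma>) * (z \<bullet> v)) (at 0)"
proof (cases "z = 0")
  case False
  have n: "((\<lambda>s. norm (z + s *\<^sub>R v)) has_real_derivative (z \<bullet> v) / norm z) (at 0)"
    unfolding norm_eq_sqrt_inner using False
    by (auto intro!: derivative_eq_intros simp: inner_add inner_commute field_simps has_field_derivative_def
          simp flip: norm_eq_sqrt_inner)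
  have e: "norm z powr (2 * (\<gamma> + 1)) = norm z powr (2 * \<gamma>) * (norm z * norm z)"
    using False by (simp add: powr_add[symmetric] powr_numeral[symmetric] power2_eq_square[symmetric]
        algebra_simps del: powr_numeral)
  show ?thesis
    by (rule DERIV_cong[OF DERIV_powr[OF n _ DERIV_const]]) (use False in \<open>simp_all add: e del: distrib_left_numeral mult_1_right\<close>)
next
  case True
  let ?F = "\<lambda>s::real. norm (s *\<^sub>R v) powr (2 * (\<gamma> + 1))"
  let ?k = "norm v powr (2 * (\<gamma> + 1))"
  \<comment> \<open>For |s| < 1 the power is at most s^2, so the difference quotient is at most a
    constant times |s|.\<close>
  have "((\<lambda>s. (?F s - ?F 0) / (s - 0)) \<longlongrightarrow> 0) (at 0)"
  proof (rule Lim_null_comparison)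
    show "((\<lambda>s. ?k * \<bar>s\<bar>) \<longlongrightarrow> 0) (at 0)"
      by (auto intro!: tendsto_eq_intros)
    have "\<forall>\<^sub>F s in at 0. s \<in> {-1<..<1::real}"
      by (rule eventually_at_in_open') auto
    then show "\<forall>\<^sub>F s in at 0. norm ((?F s - ?F 0) / (s - 0)) \<le> ?k * \<bar>s\<bar>"
    proof eventually_elim
      case (elim s)
      then have "\<bar>s\<bar> powr (2 * (\<gamma> + 1)) \<le> \<bar>s\<bar> powr 2"
        using assms by (intro powr_mono') auto
      also have "\<dots> = \<bar>s\<bar> * \<bar>s\<bar>"
        by (simp add: powr_numeral power2_eq_square)
      finally have "\<bar>s\<bar> powr (2 * (\<gamma> + 1)) * ?k \<le> (\<bar>s\<bar> * \<bar>s\<bar>) * ?k"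
        by (rule mult_right_mono) simp
      then show ?case
        by (cases "s = 0") (auto simp: powr_mult abs_mult divide_simps mult_ac)
    qed
  qed
  then show ?thesis
    by (simp add: True has_field_derivative_iff)
qed

text \<open>The derivative of the gauge along \<open>cdir l\<close>, arranged so that the component
  \<open>wt \<gamma> l * (p \<bullet> cdir l)\<close> of Z is visible.\<close>

definition pgauge_d :: "real \<Rightarrow> 'm + 'k \<Rightarrow> ('m::finite, 'k::finite) point \<Rightarrow> real" where
  "pgauge_d \<gamma> l p = pgauge \<gamma> p / gauge_pow \<gamma> p *
     (case l of Inl i \<Rightarrow> norm (fst p) powr (2 * \<gamma>) | Inr j \<Rightarrow> 1) * wt \<gamma> l * (p \<bullet> cdir l)"

lemma continuous_pgauge_d: "\<gamma> > 0 \<Longrightarrow> continuous_on (- {0}) (pgauge_d \<gamma> l)"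
  unfolding pgauge_d_def[abs_def]
  by (cases l) (auto intro!: continuous_intros continuous_norm_powr continuous_gauge_pow continuous_pgauge
     dest: gauge_pow_pos_iff[THEN iffD2, THEN less_imp_neq])

text \<open>The factor norm(z) to the power 2\<gamma> comes from the gauge in the z directions and
  from the squared coefficient in the t directions. It is thus common to all l, and the gradient of
  a radial function meets Xf only through Zf.\<close>

lemma xcoeff_pgauge_d:
  assumes "\<gamma> > 0"
  shows "(xcoeff \<gamma> l p)\<^sup>2 * pgauge_d \<gamma> l p = pgauge \<gamma> p * gchi \<gamma> p * (wt \<gamma> l * (p \<bullet> cdir l))"
proof -
  have "(norm (fst p) powr \<gamma>)\<^sup>2 = norm (fst p) powr (2 * \<gamma>)"
    by (simp add: power2_eq_square powr_add[symmetric])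
  then show ?thesis
    by (cases l) (auto simp: xcoeff_def pgauge_d_def gchi_def)
qed

lemma DERIV_gauge_pow:
  assumes "\<gamma> > 0"
  shows "((\<lambda>s. gauge_pow \<gamma> (p + s *\<^sub>R cdir l)) has_real_derivative
    2 * (\<gamma> + 1) * (case l of Inl i \<Rightarrow> norm (fst p) powr (2 * \<gamma>) | Inr j \<Rightarrow> 1) * wt \<gamma> l * (p \<bullet> cdir l)) (at 0)"
proof (cases l)
  case (Inl i)
  then show ?thesis
    using DERIV_add[OF DERIV_norm_powr[OF assms, of "fst p" "axis i 1"] DERIV_const]
    by (simp add: gauge_pow_def cdir_def wt_def inner_prod_def)
next
  case (Inr j)
  have "((\<lambda>s. (norm (snd p + s *\<^sub>R axis j 1))\<^sup>2) has_real_derivative 2 * (snd p \<bullet> axis j 1)) (at 0)"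
    unfolding power2_norm_eq_inner
    by (auto intro!: derivative_eq_intros simp: inner_add inner_commute has_field_derivative_def)
  from DERIV_add[OF DERIV_const DERIV_cmult[OF this, of "(\<gamma> + 1)\<^sup>2"]]
  have "((\<lambda>s. norm (fst p) powr (2 * (\<gamma> + 1)) + (\<gamma> + 1)\<^sup>2 * (norm (snd p + s *\<^sub>R axis j 1))\<^sup>2)
    has_real_derivative 0 + (\<gamma> + 1)\<^sup>2 * (2 * (snd p \<bullet> axis j 1))) (at 0)" .
  moreover have "0 + (\<gamma> + 1)\<^sup>2 * (2 * (snd p \<bullet> axis j 1)) = 2 * (\<gamma> + 1) * 1 * (\<gamma> + 1) * (snd p \<bullet> axis j 1)"
    by (simp add: power2_eq_square)
  ultimately show ?thesis
    using Inr by (simp only: gauge_pow_def cdir_def wt_def inner_prod_def) simp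
qed

lemma DERIV_pgauge:
  assumes "\<gamma> > 0" and "p \<noteq> 0"
  shows "((\<lambda>s. pgauge \<gamma> (p + s *\<^sub>R cdir l)) has_real_derivative pgauge_d \<gamma> l p) (at 0)"
proof -
  have P: "gauge_pow \<gamma> p > 0"
    using assms by (simp add: gauge_pow_pos_iff)
  show ?thesis
    unfolding pgauge_eq
    by (rule DERIV_cong[OF DERIV_powr[OF DERIV_gauge_pow[OF assms(1)] _ DERIV_const]])
       (use P assms(1) in \<open>simp_all add: pgauge_d_def pgauge_eq divide_simps\<close>)
qed

section \<open>Annuli of the gauge\<close>

definition annulus :: "real \<Rightarrow> real \<Rightarrow> real \<Rightarrow> ('m::finite, 'k::finite) point set" where
  "annulus \<gamma> r1 r2 = {p. r1 \<le> pgauge \<gamma> p \<and> pgauge \<gamma> p \<le> r2}"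

lemma compact_annulus:
  assumes "\<gamma> > 0"
  shows "compact (annulus \<gamma> r1 r2)"
proof -
  have "closed {p :: ('a::finite, 'b::finite) point. r1 \<le> pgauge \<gamma> p \<and> pgauge \<gamma> p \<le> r2}"
    using assms by (intro closed_Collect_conj closed_Collect_le continuous_pgauge continuous_intros)
  moreover have "norm p \<le> r2 + r2 powr (\<gamma> + 1)" if "p \<in> annulus \<gamma> r1 r2" for p :: "('a, 'b) point"
  proof -
    have r: "pgauge \<gamma> p \<le> r2" and r0: "0 \<le> pgauge \<gamma> p"
      using that by (auto simp: annulus_def pgauge_nonneg)
    have 1: "norm (fst p) \<le> r2"
      using norm_fst_le_pgauge[OF assms, of p] r by simp
    have "(norm (snd p))\<^sup>2 \<le> (\<gamma> + 1)\<^sup>2 * (norm (snd p))\<^sup>2"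
      using assms by (simp add: mult_le_cancel_right1 power2_eq_square) (simp add: algebra_simps)
    also have "\<dots> \<le> gauge_pow \<gamma> p"
      by (simp add: gauge_pow_def)
    also have "\<dots> \<le> r2 powr (2 * (\<gamma> + 1))"
      unfolding pgauge_powr[OF assms, symmetric] using assms r r0 by (intro powr_mono2) auto
    also have "\<dots> = (r2 powr (\<gamma> + 1))\<^sup>2"
      by (simp add: power2_eq_square powr_add[symmetric])
    finally have 2: "norm (snd p) \<le> r2 powr (\<gamma> + 1)"
      by (rule power2_le_imp_le) simp
    show ?thesis
      using norm_Pair_le[of "fst p" "snd p"] 1 2 by simp
  qed
  then have "bounded (annulus \<gamma> r1 r2 :: ('a, 'b) point set)"
    unfolding bounded_iff by blast
  ultimately show ?thesis
    by (simp add: annulus_def compact_eq_bounded_closed)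
qed


section \<open>A Rellich identity\<close>

text \<open>Exactly the derivatives that the identities use: \<open>fd\<close> and
  \<open>fdd\<close> along the coordinates, \<open>q\<close> for Zf, and \<open>qd\<close> for the
  coordinate derivatives of Zf. \<open>fd_flow\<close> is the commutator of Z with a coordinate
  derivative. The data are abstract because averages of test functions will be inserted.\<close>

locale grushin_data =
  fixes \<gamma> Q :: real and K :: "('m::finite, 'k::finite) point set"
    and f q :: "('m, 'k) point \<Rightarrow> real" and fd fdd qd :: "'m + 'k \<Rightarrow> ('m, 'k) point \<Rightarrow> real"
  assumes \<gamma>: "\<gamma> > 0" and Q: "Q = hom_dim \<gamma> TYPE(('m, 'k) point)" and K: "compact K" and K0: "0 \<notin> K"
    and supp: "cont_supp K f" "cont_supp K q" "cont_supp K (fd l)" "cont_supp K (fdd l)" "cont_supp K (qd l)"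
    and f_deriv: "((\<lambda>s. f (p + s *\<^sub>R cdir l)) has_real_derivative fd l p) (at 0)"
    and fd_deriv: "((\<lambda>s. fd l (p + s *\<^sub>R cdir l)) has_real_derivative fdd l p) (at 0)"
    and q_deriv: "((\<lambda>s. q (p + s *\<^sub>R cdir l)) has_real_derivative qd l p) (at 0)"
    and f_flow: "((\<lambda>s. f (dil \<gamma> s p)) has_real_derivative q p) (at 0)"
    and fd_flow: "((\<lambda>s. fd l (dil \<gamma> s p)) has_real_derivative qd l p - wt \<gamma> l * fd l p) (at 0)"
    and q_eq: "q p = (\<Sum>l\<in>UNIV. wt \<gamma> l * (p \<bullet> cdir l) * fd l p)"
begin

abbreviation \<rho> :: "('m, 'k) point \<Rightarrow> real" where
  "\<rho> \<equiv> pgauge \<gamma>"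

abbreviation \<psi> :: "('m, 'k) point \<Rightarrow> real" where
  "\<psi> \<equiv> angle_fn \<gamma>"

definition Bf :: "('m, 'k) point \<Rightarrow> real" where
  "Bf p = (\<Sum>l\<in>UNIV. (xcoeff \<gamma> l p)\<^sup>2 * fdd l p)"

lemma cs_mult: "cont_supp K F \<Longrightarrow> continuous_on (- {0}) w \<Longrightarrow> cont_supp K (\<lambda>p. w p * F p)"
  by (rule cont_supp_mult[OF _ K, of _ "- {0}"]) (use K0 in auto)

lemma cs_integrable: "cont_supp K F \<Longrightarrow> integrable lebesgue F"
  by (rule cont_supp_integrable[OF K])

lemma pgauge_K: "p \<in> K \<Longrightarrow> \<rho> p > 0"
  using K0 \<gamma> by (auto simp: pgauge_pos_iff)

lemma supp_Bf: "cont_supp K Bf"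
  unfolding Bf_def[abs_def]
  by (intro cont_supp_sum cs_mult supp continuous_intros continuous_xcoeff \<gamma>)

text \<open>Integrate \<open>Bf\<close> against g Zf + h f by parts in each coordinate. With
  \<open>E\<close> = |Xf|^2 and \<open>S\<close> the product of Xf and X(Zf), one has ZE = 2S - 2E,
  so integrating Z(gE) along the dilations trades \<open>S\<close> for \<open>E\<close>. By
  \<open>gh\<close>, all multiples of \<open>E\<close> then cancel.\<close>

lemma rellich:
  assumes g: "\<And>r. r > 0 \<Longrightarrow> (g has_real_derivative g' r) (at r)" and g': "continuous_on {0<..} g'"
    and h: "\<And>r. r > 0 \<Longrightarrow> (h has_real_derivative h' r) (at r)" and h': "continuous_on {0<..} h'"
    and gh: "\<And>r. r > 0 \<Longrightarrow> h r = r * g' r / 2 + (Q / 2 - 1) * g r"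
  shows "(\<integral>p. Bf p * (g (\<rho> p) * q p + h (\<rho> p) * f p))
    = - (\<integral>p. gchi \<gamma> p * (\<rho> p * g' (\<rho> p) * (q p)\<^sup>2
          + \<rho> p * h' (\<rho> p) * (f p * q p)))"
proof -
  have gc: "continuous_on {0<..} g" and hc: "continuous_on {0<..} h"
    using g h by (auto intro!: DERIV_isCont continuous_at_imp_continuous_on)
  have rad: "continuous_on (- {0}) (\<lambda>p. u (\<rho> p))" if "continuous_on {0<..} u" for u
    by (rule continuous_radial[OF \<gamma> that])
  note cs = cs_mult cont_supp_add cont_supp_diff cont_supp_sum cont_supp_mult2 supp continuous_intros
    continuous_xcoeff[OF \<gamma>] continuous_pgauge_d[OF \<gamma>] continuous_pgauge[OF \<gamma>] continuous_gchi[OF \<gamma>]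
    rad[OF gc] rad[OF hc] rad[OF g'] rad[OF h']
  define \<phi> where "\<phi> p = g (\<rho> p) * q p + h (\<rho> p) * f p" for p
  define \<phi>d where "\<phi>d l p = (g' (\<rho> p) * pgauge_d \<gamma> l p) * q p + g (\<rho> p) * qd l p
    + ((h' (\<rho> p) * pgauge_d \<gamma> l p) * f p + h (\<rho> p) * fd l p)" for l p
  define S where "S p = (\<Sum>l\<in>UNIV. (xcoeff \<gamma> l p)\<^sup>2 * (fd l p * qd l p))" for p
  define E where "E p = (\<Sum>l\<in>UNIV. (xcoeff \<gamma> l p)\<^sup>2 * (fd l p * fd l p))" for p
  define R where "R p = gchi \<gamma> p * (\<rho> p * g' (\<rho> p) * (q p)\<^sup>2 + \<rho> p * h' (\<rho> p) * (f p * q p))" for p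
  have cs\<phi>: "cont_supp K \<phi>" and cs\<phi>d: "cont_supp K (\<phi>d l)" for l
    unfolding \<phi>_def[abs_def] \<phi>d_def[abs_def] by (intro cs)+
  have csS: "cont_supp K S" and csE: "cont_supp K E"
    unfolding S_def[abs_def] E_def[abs_def] by (intro cs)+
  have csgS: "cont_supp K (\<lambda>p. g (\<rho> p) * S p)" and csgE: "cont_supp K (\<lambda>p. g (\<rho> p) * E p)"
    and cshE: "cont_supp K (\<lambda>p. h (\<rho> p) * E p)"
    and csg'E: "cont_supp K (\<lambda>p. (\<rho> p * g' (\<rho> p)) * E p)"
    by (intro cs csS csE)+
  have csR: "cont_supp K R"
    unfolding R_def[abs_def] power2_eq_square by (intro cs)
  have ibp: "(\<integral>p. (xcoeff \<gamma> l p)\<^sup>2 * (fdd l p * \<phi> p + fd l p * \<phi>d l p)) = 0" for l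
  proof (rule integral_directional_derivative[OF K, where v="cdir l"])
    show "cont_supp K (\<lambda>p. (xcoeff \<gamma> l p)\<^sup>2 * (fd l p * \<phi> p))"
      by (intro cs cs\<phi>)
    show "cont_supp K (\<lambda>p. (xcoeff \<gamma> l p)\<^sup>2 * (fdd l p * \<phi> p + fd l p * \<phi>d l p))"
      by (intro cs cs\<phi> cs\<phi>d)
    fix p assume "p \<in> K"
    then have p: "p \<noteq> 0" and r: "\<rho> p > 0"
      using K0 pgauge_K by auto
    have rd: "((\<lambda>s. u (\<rho> (p + s *\<^sub>R cdir l))) has_real_derivative u' * pgauge_d \<gamma> l p) (at 0)"
      if "(u has_real_derivative u') (at (\<rho> p))" for u u'
      using DERIV_chain2[OF _ DERIV_pgauge[OF \<gamma> p], of u u' l] that by simp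
    show "((\<lambda>s. (xcoeff \<gamma> l (p + s *\<^sub>R cdir l))\<^sup>2 * (fd l (p + s *\<^sub>R cdir l) * \<phi> (p + s *\<^sub>R cdir l)))
      has_real_derivative (xcoeff \<gamma> l p)\<^sup>2 * (fdd l p * \<phi> p + fd l p * \<phi>d l p)) (at 0)"
      unfolding xcoeff_cdir \<phi>_def
      by (rule DERIV_cong, rule DERIV_cmult, rule DERIV_mult[OF fd_deriv],
          rule DERIV_add[OF DERIV_mult[OF rd[OF g[OF r]] q_deriv] DERIV_mult[OF rd[OF h[OF r]] f_deriv]])
         (simp add: \<phi>d_def algebra_simps)
  qed
  have "(\<integral>p. (\<Sum>l\<in>UNIV. (xcoeff \<gamma> l p)\<^sup>2 * (fdd l p * \<phi> p + fd l p * \<phi>d l p))) = 0"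
    by (subst Bochner_Integration.integral_sum) (intro cs_integrable cs cs\<phi> cs\<phi>d, simp add: ibp)
  moreover have "(\<Sum>l\<in>UNIV. (xcoeff \<gamma> l p)\<^sup>2 * (fdd l p * \<phi> p + fd l p * \<phi>d l p))
      = Bf p * \<phi> p + (R p + g (\<rho> p) * S p + h (\<rho> p) * E p)" for p
  proof -
    have "(\<Sum>l\<in>UNIV. (xcoeff \<gamma> l p)\<^sup>2 * pgauge_d \<gamma> l p * fd l p) = \<rho> p * gchi \<gamma> p * q p"
      unfolding xcoeff_pgauge_d[OF \<gamma>] q_eq sum_distrib_left by (simp add: mult_ac)
    then have "R p = (\<Sum>l\<in>UNIV. (xcoeff \<gamma> l p)\<^sup>2 * pgauge_d \<gamma> l p * fd l p) * (g' (\<rho> p) * q p + h' (\<rho> p) * f p)"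
      by (simp add: R_def power2_eq_square algebra_simps)
    then show ?thesis
      by (simp add: Bf_def S_def E_def \<phi>d_def sum_distrib_left sum_distrib_right sum.distrib[symmetric])
         (simp add: algebra_simps sum.distrib)
  qed
  ultimately have "(\<integral>p. Bf p * \<phi> p + (R p + g (\<rho> p) * S p + h (\<rho> p) * E p)) = 0"
    by simp
  then have 1: "(\<integral>p. Bf p * \<phi> p) + ((\<integral>p. R p) + (\<integral>p. g (\<rho> p) * S p)
      + (\<integral>p. h (\<rho> p) * E p)) = 0"
    by (simp add: cs_integrable csR csgS cshE cont_supp_mult2 supp_Bf cs\<phi> cont_supp_add)
  have "(\<integral>p. (\<rho> p * g' (\<rho> p)) * E p + g (\<rho> p) * (2 * S p - 2 * E p))
      = - Q * (\<integral>p. g (\<rho> p) * E p)"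
  proof (unfold Q, rule integral_dilation_derivative[OF K csgE])
    show "cont_supp K (\<lambda>p. (\<rho> p * g' (\<rho> p)) * E p + g (\<rho> p) * (2 * S p - 2 * E p))"
      by (intro cs csE csS)
    fix p assume "p \<in> K"
    then have p: "p \<noteq> 0" and r: "\<rho> p > 0"
      using K0 pgauge_K by auto
    have gd: "((\<lambda>s. g (\<rho> (dil \<gamma> s p))) has_real_derivative g' (\<rho> p) * \<rho> p) (at 0)"
      using DERIV_chain2[OF _ DERIV_dil_pgauge[OF \<gamma>, of p], of g] g[OF r] by simp
    have "((\<lambda>s. E (dil \<gamma> s p)) has_real_derivative (\<Sum>l\<in>UNIV.
        (2 * (wt \<gamma> l - 1) * (xcoeff \<gamma> l p)\<^sup>2) * (fd l p * fd l p)
        + (2 * fd l p * (qd l p - wt \<gamma> l * fd l p)) * (xcoeff \<gamma> l p)\<^sup>2)) (at 0)"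
      unfolding E_def power2_eq_square
      by (rule DERIV_sum, rule DERIV_cong, rule DERIV_mult[OF DERIV_mult[OF DERIV_dil_xcoeff DERIV_dil_xcoeff]
             DERIV_mult[OF fd_flow fd_flow]])
         (simp add: algebra_simps)
    \<comment> \<open>The coefficient contributes 2(wt - 1) and the commutator -2 wt; the sum is -2
      for every l.\<close>
    also have "(\<Sum>l\<in>UNIV.
        (2 * (wt \<gamma> l - 1) * (xcoeff \<gamma> l p)\<^sup>2) * (fd l p * fd l p)
        + (2 * fd l p * (qd l p - wt \<gamma> l * fd l p)) * (xcoeff \<gamma> l p)\<^sup>2) = 2 * S p - 2 * E p"
      unfolding S_def E_def sum_distrib_left sum_subtractf[symmetric]
      by (rule sum.cong) (simp_all add: algebra_simps)
    finally show "((\<lambda>s. g (\<rho> (dil \<gamma> s p)) * E (dil \<gamma> s p)) has_real_derivative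
        (\<rho> p * g' (\<rho> p)) * E p + g (\<rho> p) * (2 * S p - 2 * E p)) (at 0)"
      by (rule DERIV_cong[OF DERIV_mult[OF gd]]) (simp add: algebra_simps)
  qed
  moreover have "(\<lambda>p. (\<rho> p * g' (\<rho> p)) * E p + g (\<rho> p) * (2 * S p - 2 * E p))
      = (\<lambda>p. 2 * (h (\<rho> p) * E p) + 2 * (g (\<rho> p) * S p) - Q * (g (\<rho> p) * E p))"
  proof
    fix p
    show "(\<rho> p * g' (\<rho> p)) * E p + g (\<rho> p) * (2 * S p - 2 * E p)
      = 2 * (h (\<rho> p) * E p) + 2 * (g (\<rho> p) * S p) - Q * (g (\<rho> p) * E p)"
    proof (cases "p \<in> K")
      case True
      show ?thesis
        unfolding gh[OF pgauge_K[OF True]] by (simp add: algebra_simps)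
    qed (simp add: cont_suppD[OF csE] cont_suppD[OF csS])
  qed
  \<comment> \<open>This is where \<open>gh\<close> is spent: \<open>r * g' - 2 * g\<close> equals
    \<open>2 * h - Q * g\<close>.\<close>
  ultimately have "2 * (\<integral>p. h (\<rho> p) * E p) + 2 * (\<integral>p. g (\<rho> p) * S p) = 0"
    by (simp add: cs_integrable csgS csgE cshE)
  with 1 show ?thesis
    by (simp add: \<phi>_def R_def)
qed

text \<open>Integration by parts of k \<psi> f^2 along Z: the divergence contributes Q, and \<psi>
  is constant along the dilations.\<close>

lemma radial_flow:
  assumes k: "\<And>r. r > 0 \<Longrightarrow> (k has_real_derivative k' r) (at r)" and k': "continuous_on {0<..} k'"
  shows "(\<integral>p. k (\<rho> p) * \<psi> p * (2 * f p * q p))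
    = - (\<integral>p. (\<rho> p * k' (\<rho> p) + Q * k (\<rho> p)) * \<psi> p * (f p)\<^sup>2)"
proof -
  have kc: "continuous_on {0<..} k"
    using k by (auto intro!: DERIV_isCont continuous_at_imp_continuous_on)
  note cs = cs_mult cont_supp_add cont_supp_diff cont_supp_mult2 supp continuous_intros
    continuous_pgauge[OF \<gamma>] continuous_angle[OF \<gamma>] continuous_radial[OF \<gamma> kc] continuous_radial[OF \<gamma> k']
  have 0: "cont_supp K (\<lambda>p. (k (\<rho> p) * \<psi> p) * (f p * f p))"
    by (intro cs)
  have 1: "cont_supp K (\<lambda>p. (\<rho> p * k' (\<rho> p) * \<psi> p) * (f p * f p))"
    and 2: "cont_supp K (\<lambda>p. (k (\<rho> p) * \<psi> p * 2) * (f p * q p))"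
    by (intro cs)+
  have "(\<integral>p. (\<rho> p * k' (\<rho> p) * \<psi> p) * (f p * f p) + (k (\<rho> p) * \<psi> p * 2) * (f p * q p))
      = - Q * (\<integral>p. (k (\<rho> p) * \<psi> p) * (f p * f p))"
  proof (unfold Q, rule integral_dilation_derivative[OF K 0 cont_supp_add[OF 1 2]])
    fix p assume "p \<in> K"
    then have r: "\<rho> p > 0"
      by (rule pgauge_K)
    have kd: "((\<lambda>s. k (\<rho> (dil \<gamma> s p))) has_real_derivative k' (\<rho> p) * \<rho> p) (at 0)"
      using DERIV_chain2[OF _ DERIV_dil_pgauge[OF \<gamma>, of p], of k] k[OF r] by simp
    show "((\<lambda>s. k (\<rho> (dil \<gamma> s p)) * \<psi> (dil \<gamma> s p) * (f (dil \<gamma> s p) * f (dil \<gamma> s p)))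
       has_real_derivative (\<rho> p * k' (\<rho> p) * \<psi> p) * (f p * f p)
         + (k (\<rho> p) * \<psi> p * 2) * (f p * q p)) (at 0)"
      unfolding angle_dil[OF \<gamma>]
      by (rule DERIV_cong[OF DERIV_mult[OF DERIV_cmult_right[OF kd] DERIV_mult[OF f_flow f_flow]]])
         (simp add: algebra_simps)
  qed
  then have *: "(\<integral>p. (k (\<rho> p) * \<psi> p * 2) * (f p * q p))
      = - ((\<integral>p. (\<rho> p * k' (\<rho> p) * \<psi> p) * (f p * f p))
          + (\<integral>p. Q * ((k (\<rho> p) * \<psi> p) * (f p * f p))))"
    by (simp add: cs_integrable 0 1 2)
  also have "\<dots> = - (\<integral>p. (\<rho> p * k' (\<rho> p) * \<psi> p) * (f p * f p)
      + Q * ((k (\<rho> p) * \<psi> p) * (f p * f p)))"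
    using 0 1 by (subst lint_add) (auto intro!: cs_integrable cont_supp_cmult)
  finally show ?thesis
    by (simp add: power2_eq_square algebra_simps)
qed

end


section \<open>The weighted estimate for regular functions\<close>

locale carleman_weight =
  fixes \<alpha> \<epsilon> :: real
  assumes \<alpha>: "\<alpha> > 0" and \<epsilon>: "0 < \<epsilon>" "\<epsilon> < 1"
begin

definition Om :: "real \<Rightarrow> real" where
  "Om r = r powr (- 2 * \<alpha> - 4) * exp (2 * \<alpha> * r powr \<epsilon>)"

definition bb :: "real \<Rightarrow> real" where
  "bb r = 2 * \<alpha> + 2 - 2 * \<alpha> * \<epsilon> * r powr \<epsilon>"

definition th :: "real \<Rightarrow> real" where
  "th r = \<alpha> * \<epsilon>\<^sup>2 * r powr \<epsilon>"

lemma Om_nonneg: "Om r \<ge> 0"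
  by (simp add: Om_def)

lemma th_nonneg: "th r \<ge> 0"
  using \<alpha> by (simp add: th_def)

text \<open>Restricting to \<rho> at most 1 keeps the negative part of \<open>bb\<close> below
  2\<alpha>\<epsilon>, so that b remains of order \<alpha>.\<close>

lemma bb_lower:
  assumes "0 \<le> r" "r \<le> 1"
  shows "bb r \<ge> 2 * (1 - \<epsilon>) * \<alpha> + 2"
proof -
  have "r powr \<epsilon> \<le> 1"
    using assms \<epsilon> by (simp add: powr_le1)
  then have "\<alpha> * \<epsilon> * r powr \<epsilon> \<le> \<alpha> * \<epsilon> * 1"
    using \<alpha> \<epsilon> by (intro mult_left_mono) auto
  then show ?thesis
    by (simp add: bb_def algebra_simps)
qed

text \<open>The summand 2 in the bound for b pays for \<epsilon>^2 < 4. What is left is \<theta>/2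
  times the square of 2(1 - \<epsilon>)\<alpha>, which is cubic in \<alpha>.\<close>

lemma th_bb_lower:
  assumes "0 \<le> r" "r \<le> 1"
  shows "th r / 2 * ((bb r)\<^sup>2 - \<epsilon>\<^sup>2) \<ge> 2 * \<epsilon>\<^sup>2 * (1 - \<epsilon>)\<^sup>2 * \<alpha> ^ 3 * r powr \<epsilon>"
proof -
  let ?s = "2 * (1 - \<epsilon>) * \<alpha>"
  have s: "?s \<ge> 0"
    using \<alpha> \<epsilon> by simp
  have "?s\<^sup>2 + \<epsilon>\<^sup>2 \<le> ?s\<^sup>2 + 4"
    using \<epsilon> by (simp add: power_le_one order_trans[of _ 1])
  also have "\<dots> \<le> (?s + 2)\<^sup>2"
    using s by (simp add: power2_eq_square algebra_simps)
  also have "\<dots> \<le> (bb r)\<^sup>2"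
    using bb_lower[OF assms] s by (intro power_mono) auto
  finally have "th r / 2 * ?s\<^sup>2 \<le> th r / 2 * ((bb r)\<^sup>2 - \<epsilon>\<^sup>2)"
    using th_nonneg[of r] by (intro mult_left_mono) auto
  moreover have "th r / 2 * ?s\<^sup>2 = 2 * \<epsilon>\<^sup>2 * (1 - \<epsilon>)\<^sup>2 * \<alpha> ^ 3 * r powr \<epsilon>"
    by (simp add: th_def power2_eq_square power3_eq_cube field_simps)
  ultimately show ?thesis
    by simp
qed

lemma powr_DERIV: "r > 0 \<Longrightarrow> ((\<lambda>r. r powr \<epsilon>) has_real_derivative \<epsilon> * r powr \<epsilon> / r) (at r)"
  by (rule DERIV_cong[OF has_real_derivative_powr]) (auto simp: powr_diff)

lemma th_DERIV: "r > 0 \<Longrightarrow> (th has_real_derivative \<epsilon> * th r / r) (at r)"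
  unfolding th_def[abs_def] by (rule DERIV_cong[OF DERIV_cmult[OF powr_DERIV]]) auto

lemma bb_DERIV: "r > 0 \<Longrightarrow> (bb has_real_derivative - 2 * th r / r) (at r)"
  unfolding bb_def[abs_def] th_def
  by (rule DERIV_cong[OF DERIV_diff[OF DERIV_const DERIV_cmult[OF powr_DERIV]]])
     (auto simp: power2_eq_square)

lemma Om_DERIV:
  assumes "r > 0"
  shows "(Om has_real_derivative - (bb r + 2) * Om r / r) (at r)"
proof -
  have 1: "((\<lambda>r. r powr (- 2 * \<alpha> - 4)) has_real_derivative (- 2 * \<alpha> - 4) * r powr (- 2 * \<alpha> - 4) / r) (at r)"
  proof -
    have "r powr (x - 1) = r powr x / r" for x
      using assms by (simp add: powr_diff)
    from has_real_derivative_powr[OF assms, of "- 2 * \<alpha> - 4", unfolded this] show ?thesis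
      by simp
  qed
  have 2: "((\<lambda>r. exp (2 * \<alpha> * r powr \<epsilon>)) has_real_derivative
      exp (2 * \<alpha> * r powr \<epsilon>) * (2 * \<alpha> * (\<epsilon> * r powr \<epsilon> / r))) (at r)"
    by (rule DERIV_chain2[OF DERIV_exp DERIV_cmult[OF powr_DERIV[OF assms]]])
  show ?thesis
    unfolding Om_def[abs_def]
    by (rule DERIV_cong[OF DERIV_mult[OF 1 2]]) (use assms in \<open>simp add: bb_def field_simps\<close>)
qed

lemma weight_continuous:
  "continuous_on {0<..} Om" "continuous_on {0<..} bb" "continuous_on {0<..} th"
  by (auto intro!: continuous_at_imp_continuous_on DERIV_isCont[OF Om_DERIV]
      DERIV_isCont[OF bb_DERIV] DERIV_isCont[OF th_DERIV])

end

section \<open>The weighted identity and its lower bound\<close>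

locale carleman_data = grushin_data \<gamma> Q K f q fd fdd qd + carleman_weight \<alpha> \<epsilon>
  for \<gamma> Q and K :: "('m::finite, 'k::finite) point set" and f q fd fdd qd \<alpha> \<epsilon> +
  assumes K1: "p \<in> K \<Longrightarrow> pgauge \<gamma> p \<le> 1"
begin

abbreviation wgt :: "('m, 'k) point \<Rightarrow> real" where
  "wgt p \<equiv> Om (\<rho> p) * \<psi> p"

definition cc :: real where
  "cc = (Q - 2) / 2"

text \<open>The function H divided by \<rho>^2 \<Omega>, for G = b \<rho>^2 \<Omega>: here ZG is
  -(2\<theta> + b^2) \<rho>^2 \<Omega>, and \<open>cc\<close> is the constant Q/2 - 1 of the Rellich
  relation.\<close>

definition hh :: "real \<Rightarrow> real" where
  "hh r = - th r - (bb r)\<^sup>2 / 2 + cc * bb r"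

definition yy :: "('m, 'k) point \<Rightarrow> real" where
  "yy p = bb (\<rho> p) * q p + hh (\<rho> p) * f p"

abbreviation squares :: "('m, 'k) point \<Rightarrow> real" where
  "squares p \<equiv> yy p * yy p + (th (\<rho> p) / 2 * ((bb (\<rho> p))\<^sup>2 - \<epsilon>\<^sup>2)) * (f p * f p)
    + (2 * th (\<rho> p)) * ((q p - (bb (\<rho> p) / 2 - cc) * f p) * (q p - (bb (\<rho> p) / 2 - cc) * f p))"

lemma hh_DERIV: "r > 0 \<Longrightarrow> (hh has_real_derivative (- \<epsilon> * th r + 2 * bb r * th r - 2 * cc * th r) / r) (at r)"
  unfolding hh_def[abs_def]
  by (auto intro!: derivative_eq_intros th_DERIV bb_DERIV simp: field_simps)

lemma hh_continuous: "continuous_on {0<..} hh"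
  by (auto intro!: continuous_at_imp_continuous_on DERIV_isCont[OF hh_DERIV])

lemmas cs_intros = cs_mult cont_supp_add cont_supp_diff cont_supp_mult2 supp continuous_intros
    continuous_pgauge[OF \<gamma>] continuous_angle[OF \<gamma>] continuous_radial[OF \<gamma>] weight_continuous hh_continuous

lemma supp_yy: "cont_supp K yy"
  unfolding yy_def[abs_def] by (intro cs_intros)

lemma radial_integrable:
  assumes "cont_supp K F" "cont_supp K G" "continuous_on {0<..} w"
  shows "integrable lebesgue (\<lambda>p. w (\<rho> p) * \<psi> p * (F p * G p))"
  by (intro cs_integrable cs_mult cont_supp_mult2 assms continuous_intros continuous_angle[OF \<gamma>]
      continuous_radial[OF \<gamma>])

lemma square_terms_integrable:
  "integrable lebesgue (\<lambda>p. wgt p *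
       (squares p))"
proof -
    let ?z = "\<lambda>p. q p - (bb (\<rho> p) / 2 - cc) * f p"
    have w: "continuous_on {0<..} (\<lambda>r. bb r / 2 - cc)"
        "continuous_on {0<..} (\<lambda>r. Om r * (th r / 2 * ((bb r)\<^sup>2 - \<epsilon>\<^sup>2)))" "continuous_on {0<..} (\<lambda>r. Om r * (2 * th r))"
      by (intro continuous_intros weight_continuous; simp)+
    have z: "cont_supp K ?z"
      by (intro cont_supp_diff supp cs_mult continuous_radial[OF \<gamma> w(1)])
    have "integrable lebesgue (\<lambda>p. wgt p * (yy p * yy p)
      + Om (\<rho> p) * (th (\<rho> p) / 2 * ((bb (\<rho> p))\<^sup>2 - \<epsilon>\<^sup>2)) * \<psi> p * (f p * f p)
      + Om (\<rho> p) * (2 * th (\<rho> p)) * \<psi> p * (?z p * ?z p))"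
      by (intro lint_integrable_add radial_integrable[OF supp_yy supp_yy weight_continuous(1)]
          radial_integrable[OF supp(1) supp(1) w(2)] radial_integrable[OF z z w(3)])
    moreover have "(\<lambda>p. wgt p * (yy p * yy p)
      + Om (\<rho> p) * (th (\<rho> p) / 2 * ((bb (\<rho> p))\<^sup>2 - \<epsilon>\<^sup>2)) * \<psi> p * (f p * f p)
      + Om (\<rho> p) * (2 * th (\<rho> p)) * \<psi> p * (?z p * ?z p)) = (\<lambda>p. wgt p *
       (yy p * yy p + (th (\<rho> p) / 2 * ((bb (\<rho> p))\<^sup>2 - \<epsilon>\<^sup>2)) * (f p * f p)
         + (2 * th (\<rho> p)) * (?z p * ?z p)))"
      by (simp only: distrib_left mult_ac)
    ultimately show ?thesis by (rule back_subst)
qed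

text \<open>\<open>rellich\<close> yields a quadratic form in q and f without an f^2 term.
  Completing the squares creates f^2 terms; integrating the leftover f q term by parts cancels all
  of them except the one with b^2 - \<epsilon>^2.\<close>

lemma carleman_identity:
  "(\<integral>p. Bf p * ((\<rho> p)\<^sup>2 * Om (\<rho> p) * yy p))
    = (\<integral>p. wgt p *
       ((yy p)\<^sup>2 + th (\<rho> p) / 2 * ((bb (\<rho> p))\<^sup>2 - \<epsilon>\<^sup>2) * (f p)\<^sup>2
         + 2 * th (\<rho> p) * (q p - (bb (\<rho> p) / 2 - cc) * f p)\<^sup>2))"
proof -
  \<comment> \<open>The functions \<open>zh\<close> and \<open>zk\<close> are r times the
    derivatives of \<open>hh\<close> and \<open>kk\<close>, from Zb = -2\<theta> and Z\<theta> =
    \<epsilon>\<theta>.\<close>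
  define g' where "g' r = (- 2 * th r - (bb r)\<^sup>2) * (r\<^sup>2 * Om r) / r" for r
  define zh where "zh r = - \<epsilon> * th r + 2 * bb r * th r - 2 * cc * th r" for r
  define h' where "h' r = (zh r - bb r * hh r) * (r\<^sup>2 * Om r) / r" for r
  \<comment> \<open>\<open>2 kk\<close> is the coefficient of \<open>f q\<close> that remains after completing the squares;
    \<open>radial_flow\<close> turns this term into one with \<open>f\<^sup>2\<close>.\<close>
  define kk where "kk r = bb r ^ 3 / 4 - cc * (bb r)\<^sup>2 / 2 + bb r * th r / 2 + \<epsilon> * th r / 2 - cc * th r" for r
  define zk where "zk r = - 3 / 2 * (bb r)\<^sup>2 * th r + 2 * cc * bb r * th r - (th r)\<^sup>2 + (bb r / 2 + \<epsilon> / 2 - cc) * (\<epsilon> * th r)" for r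
  have g: "((\<lambda>r. bb r * (r\<^sup>2 * Om r)) has_real_derivative g' r) (at r)" if "r > 0" for r
    unfolding g'_def using that
    by (auto intro!: derivative_eq_intros bb_DERIV Om_DERIV) (simp add: field_simps power2_eq_square)
  have h: "((\<lambda>r. hh r * (r\<^sup>2 * Om r)) has_real_derivative h' r) (at r)" if "r > 0" for r
    unfolding h'_def zh_def using that
    by (auto intro!: derivative_eq_intros hh_DERIV Om_DERIV) (simp add: field_simps power2_eq_square)
  have k: "((\<lambda>r. Om r * kk r) has_real_derivative Om r * (zk r - (bb r + 2) * kk r) / r) (at r)" if "r > 0" for r
    unfolding zk_def kk_def using that
    by (auto intro!: derivative_eq_intros bb_DERIV th_DERIV Om_DERIV)
       (simp add: field_simps power2_eq_square power3_eq_cube)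
  have cg': "continuous_on {0<..} g'" and ch': "continuous_on {0<..} h'"
    and ckk: "continuous_on {0<..} kk" and czk: "continuous_on {0<..} zk"
    unfolding g'_def[abs_def] h'_def[abs_def] zh_def[abs_def] kk_def[abs_def] zk_def[abs_def]
    by (intro cs_intros; simp)+
  have ck': "continuous_on {0<..} (\<lambda>r. Om r * (zk r - (bb r + 2) * kk r) / r)"
    by (intro cs_intros ckk czk) auto
  have "(\<integral>p. Bf p * ((\<rho> p)\<^sup>2 * Om (\<rho> p) * yy p))
      = (\<integral>p. Bf p * (bb (\<rho> p) * ((\<rho> p)\<^sup>2 * Om (\<rho> p)) * q p + hh (\<rho> p) * ((\<rho> p)\<^sup>2 * Om (\<rho> p)) * f p))"
    by (simp add: yy_def algebra_simps)
  also have "\<dots> = - (\<integral>p. gchi \<gamma> p * (\<rho> p * g' (\<rho> p) * (q p)\<^sup>2 + \<rho> p * h' (\<rho> p) * (f p * q p)))"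
    by (rule rellich[OF g cg' h ch']) (simp_all add: g'_def hh_def cc_def power2_eq_square field_simps)
  also have "\<dots> = (\<integral>p. wgt p * ((2 * th (\<rho> p) + (bb (\<rho> p))\<^sup>2) * (q p)\<^sup>2
      + (bb (\<rho> p) * hh (\<rho> p) - zh (\<rho> p)) * (f p * q p)))"
    unfolding integral_minus[symmetric]
  proof (rule lint_cong[OF refl])
    fix p
    show "- (gchi \<gamma> p * (\<rho> p * g' (\<rho> p) * (q p)\<^sup>2 + \<rho> p * h' (\<rho> p) * (f p * q p)))
      = wgt p * ((2 * th (\<rho> p) + (bb (\<rho> p))\<^sup>2) * (q p)\<^sup>2
      + (bb (\<rho> p) * hh (\<rho> p) - zh (\<rho> p)) * (f p * q p))"
    proof (cases "p \<in> K")
      case True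
      have r: "\<rho> p * g' (\<rho> p) = (- 2 * th (\<rho> p) - (bb (\<rho> p))\<^sup>2) * ((\<rho> p)\<^sup>2 * Om (\<rho> p))"
        "\<rho> p * h' (\<rho> p) = (zh (\<rho> p) - bb (\<rho> p) * hh (\<rho> p)) * ((\<rho> p)\<^sup>2 * Om (\<rho> p))"
        using pgauge_K[OF True] by (simp_all add: g'_def h'_def)
      show ?thesis
        unfolding r angle_fn_eq[OF \<gamma>] by (simp add: algebra_simps)
    qed (simp add: cont_suppD[OF supp(1)] cont_suppD[OF supp(2)])
  qed
  finally have 1: "(\<integral>p. Bf p * ((\<rho> p)\<^sup>2 * Om (\<rho> p) * yy p)) = \<dots>" .
  have "(\<integral>p. (Om (\<rho> p) * kk (\<rho> p)) * \<psi> p * (2 * f p * q p))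
    = - (\<integral>p. (\<rho> p * (Om (\<rho> p) * (zk (\<rho> p) - (bb (\<rho> p) + 2) * kk (\<rho> p)) / \<rho> p)
            + Q * (Om (\<rho> p) * kk (\<rho> p))) * \<psi> p * (f p)\<^sup>2)"
    by (rule radial_flow[OF k ck'])
  also have "\<dots> = (\<integral>p. (wgt p * ((bb (\<rho> p) - 2 * cc) * kk (\<rho> p) - zk (\<rho> p))) * (f p * f p))"
    unfolding integral_minus[symmetric]
  proof (rule lint_cong[OF refl])
    fix p
    show "- ((\<rho> p * (Om (\<rho> p) * (zk (\<rho> p) - (bb (\<rho> p) + 2) * kk (\<rho> p)) / \<rho> p)
            + Q * (Om (\<rho> p) * kk (\<rho> p))) * \<psi> p * (f p)\<^sup>2)
      = (wgt p * ((bb (\<rho> p) - 2 * cc) * kk (\<rho> p) - zk (\<rho> p))) * (f p * f p)"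
    proof (cases "p \<in> K")
      case True
      have r: "\<rho> p * (X * (Y / \<rho> p)) = X * Y" for X Y
        using pgauge_K[OF True] by simp
      show ?thesis
        unfolding times_divide_eq_right[symmetric] r by (simp add: cc_def power2_eq_square field_simps)
    qed (simp add: cont_suppD[OF supp(1)])
  qed
  finally have 2: "(\<integral>p. (2 * Om (\<rho> p) * kk (\<rho> p) * \<psi> p) * (f p * q p)) = \<dots>"
    by (simp add: mult_ac)
  have w1: "continuous_on {0<..} (\<lambda>r. 2 * Om r * kk r)"
    and w2: "continuous_on {0<..} (\<lambda>r. Om r * ((bb r - 2 * cc) * kk r - zk r))"
    by (intro continuous_intros weight_continuous ckk czk)+
  have i2: "integrable lebesgue (\<lambda>p. (wgt p *
        ((bb (\<rho> p) - 2 * cc) * kk (\<rho> p) - zk (\<rho> p))) * (f p * f p))"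
    using radial_integrable[OF supp(1) supp(1) w2] by (simp only: mult_ac)
  note i1 = radial_integrable[OF supp(1) supp(2) w1]
  note i3 = square_terms_integrable
  have "(\<integral>p. wgt p * ((2 * th (\<rho> p) + (bb (\<rho> p))\<^sup>2) * (q p)\<^sup>2
      + (bb (\<rho> p) * hh (\<rho> p) - zh (\<rho> p)) * (f p * q p)))
    = (\<integral>p. wgt p *
       (squares p)
      + ((2 * Om (\<rho> p) * kk (\<rho> p) * \<psi> p) * (f p * q p)
        - (wgt p * ((bb (\<rho> p) - 2 * cc) * kk (\<rho> p) - zk (\<rho> p))) * (f p * f p)))"
  proof (rule lint_cong[OF refl])
    fix p
    \<comment> \<open>What remains is a polynomial identity. Of the coefficient b^2 + 2\<theta> of
      q^2, the square of y takes b^2 and the last square takes 2\<theta>.\<close>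
    define O' where "O' = wgt p"
    have O2: "2 * Om (\<rho> p) * kk (\<rho> p) * \<psi> p = O' * (2 * kk (\<rho> p))"
      by (simp add: O'_def)
    define b t F G where "b = bb (\<rho> p)" "t = th (\<rho> p)" "F = f p" "G = q p"
    note gen = this
    show "wgt p * ((2 * th (\<rho> p) + (bb (\<rho> p))\<^sup>2) * (q p)\<^sup>2
      + (bb (\<rho> p) * hh (\<rho> p) - zh (\<rho> p)) * (f p * q p)) = wgt p *
       (squares p)
      + ((2 * Om (\<rho> p) * kk (\<rho> p) * \<psi> p) * (f p * q p)
        - (wgt p * ((bb (\<rho> p) - 2 * cc) * kk (\<rho> p) - zk (\<rho> p))) * (f p * f p))"
      unfolding O2 O'_def[symmetric]
      unfolding yy_def hh_def zh_def kk_def zk_def gen[symmetric]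
      by (simp add: field_simps power2_eq_square power3_eq_cube)
  qed
  also have "\<dots> = (\<integral>p. wgt p *
       (squares p))"
    using 2 unfolding lint_add[OF i3 Bochner_Integration.integrable_diff[OF i1 i2]]
      lint_diff[OF i1 i2]
    by linarith
  finally show ?thesis
    unfolding 1 by (simp add: power2_eq_square)
qed

text \<open>The form of h makes 2 \<Omega> f y a divergence: it equals Z(b \<Omega> f^2) + Q b
  \<Omega> f^2. Multiply by ln \<rho> - s, whose derivative along Z is 1, and integrate by
  parts.\<close>

lemma poincare_identity:
  "(\<integral>p. wgt p * (2 * (ln (\<rho> p) - s) * f p * yy p))
    = - (\<integral>p. wgt p * (bb (\<rho> p) * (f p)\<^sup>2))"
proof -
  define k' where "k' r = Om r * (bb r - 2 * th r * (ln r - s) - (bb r + 2) * (bb r * (ln r - s))) / r" for r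
  have k: "((\<lambda>r. Om r * (bb r * (ln r - s))) has_real_derivative k' r) (at r)" if "r > 0" for r
    unfolding k'_def using that
    by (auto intro!: derivative_eq_intros bb_DERIV Om_DERIV) (simp add: field_simps)
  have ln: "continuous_on {0<..} (\<lambda>r::real. ln r)"
    by (intro continuous_intros) auto
  have ck': "continuous_on {0<..} k'"
    unfolding k'_def[abs_def] by (intro cs_intros ln) auto
  have ck: "continuous_on {0<..} (\<lambda>r. ln r - s)"
    by (intro continuous_intros) auto
  have 1: "(\<integral>p. Om (\<rho> p) * (bb (\<rho> p) * (ln (\<rho> p) - s)) * \<psi> p * (2 * f p * q p))
    = - (\<integral>p. (\<rho> p * k' (\<rho> p) + Q * (Om (\<rho> p) * (bb (\<rho> p) * (ln (\<rho> p) - s)))) * \<psi> p * (f p)\<^sup>2)"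
    by (rule radial_flow[OF k ck'])
  have w1: "continuous_on {0<..} (\<lambda>r. 2 * Om r * (bb r * (ln r - s)))"
    and w2: "continuous_on {0<..} (\<lambda>r. r * k' r + Q * (Om r * (bb r * (ln r - s))))"
    and w3: "continuous_on {0<..} (\<lambda>r. Om r * bb r)"
    by (intro continuous_intros weight_continuous ck' ck)+
  note i1 = radial_integrable[OF supp(1) supp(2) w1] and i2 = radial_integrable[OF supp(1) supp(1) w2]
    and i3 = radial_integrable[OF supp(1) supp(1) w3]
  have "(\<integral>p. wgt p * (2 * (ln (\<rho> p) - s) * f p * yy p))
    = (\<integral>p. Om (\<rho> p) * (bb (\<rho> p) * (ln (\<rho> p) - s)) * \<psi> p * (2 * f p * q p)
       + ((\<rho> p * k' (\<rho> p) + Q * (Om (\<rho> p) * (bb (\<rho> p) * (ln (\<rho> p) - s)))) * \<psi> p * (f p)\<^sup>2)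
       - wgt p * (bb (\<rho> p) * (f p)\<^sup>2))"
  proof (rule lint_cong[OF refl])
    fix p
    show "wgt p * (2 * (ln (\<rho> p) - s) * f p * yy p)
     = Om (\<rho> p) * (bb (\<rho> p) * (ln (\<rho> p) - s)) * \<psi> p * (2 * f p * q p)
       + ((\<rho> p * k' (\<rho> p) + Q * (Om (\<rho> p) * (bb (\<rho> p) * (ln (\<rho> p) - s)))) * \<psi> p * (f p)\<^sup>2)
       - wgt p * (bb (\<rho> p) * (f p)\<^sup>2)"
    proof (cases "p \<in> K")
      case True
      show ?thesis
        using pgauge_K[OF True] by (simp add: k'_def yy_def hh_def cc_def power2_eq_square field_simps)
    qed (simp add: cont_suppD[OF supp(1)])
  qed
  also have "\<dots> = - (\<integral>p. wgt p * (bb (\<rho> p) * (f p)\<^sup>2))"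
  proof -
    have e1: "Om (\<rho> p) * (bb (\<rho> p) * (ln (\<rho> p) - s)) * \<psi> p * (2 * f p * q p)
        = 2 * Om (\<rho> p) * (bb (\<rho> p) * (ln (\<rho> p) - s)) * \<psi> p * (f p * q p)"
      and e2: "(\<rho> p * k' (\<rho> p) + Q * (Om (\<rho> p) * (bb (\<rho> p) * (ln (\<rho> p) - s)))) * \<psi> p * (f p)\<^sup>2
        = (\<rho> p * k' (\<rho> p) + Q * (Om (\<rho> p) * (bb (\<rho> p) * (ln (\<rho> p) - s)))) * \<psi> p * (f p * f p)"
      and e3: "wgt p * (bb (\<rho> p) * (f p)\<^sup>2)
        = Om (\<rho> p) * bb (\<rho> p) * \<psi> p * (f p * f p)" for p
      by (simp_all only: power2_eq_square mult_ac)
    show ?thesis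
      using 1 unfolding e1 e2 e3
        lint_diff[OF lint_integrable_add[OF i1 i2] i3]
        lint_add[OF i1 i2]
      by linarith
  qed
  finally show ?thesis .
qed

text \<open>One half of the integral of y^2 pays for the \<alpha>^2 term through
  \<open>poincare_identity\<close>; the other half is kept for the product with y in
  \<open>carleman_upper\<close>.\<close>

lemma carleman_lower:
  assumes r1: "r1 > 0" and L: "L > 0"
    and K_le: "\<And>p. p \<in> K \<Longrightarrow> r1 \<le> \<rho> p \<and> \<rho> p \<le> r1 * exp L"
  shows "1 / 2 * (\<integral>p. wgt p * (yy p)\<^sup>2)
    + (\<integral>p. wgt p * (((1 - \<epsilon>)\<^sup>2 / (2 * L\<^sup>2) * \<alpha>\<^sup>2
        + 2 * \<epsilon>\<^sup>2 * (1 - \<epsilon>)\<^sup>2 * \<alpha> ^ 3 * \<rho> p powr \<epsilon>) * (f p)\<^sup>2))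
    \<le> (\<integral>p. Bf p * ((\<rho> p)\<^sup>2 * Om (\<rho> p) * yy p))"
proof -
  \<comment> \<open>On the unit ball b is at least 2s. The chain below reads
    \<open>2 * s * D \<le> C \<le> s * D + L\<^sup>2 / s * Y\<close>, hence
    \<open>s\<^sup>2 * D \<le> L\<^sup>2 * Y\<close>; the logarithm in
    \<open>poincare_identity\<close> is at most L.\<close>
  define s where "s = (1 - \<epsilon>) * \<alpha>"
  have s: "s > 0"
    using \<alpha> \<epsilon> by (simp add: s_def)
  have w: "wgt p \<ge> 0" for p
    by (simp add: Om_nonneg angle_nonneg)
  have cpow: "continuous_on {0<..} (\<lambda>r::real. r powr \<epsilon>)"
    by (intro continuous_intros) auto
  note cs = cs_intros supp_yy cpow
  define D Y A C where "D = (\<integral>p. wgt p * (f p * f p))"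
    and "Y = (\<integral>p. wgt p * (yy p * yy p))"
    and "A = (\<integral>p. (wgt p * \<rho> p powr \<epsilon>) * (f p * f p))"
    and "C = (\<integral>p. (wgt p * bb (\<rho> p)) * (f p * f p))"
  have iD: "integrable lebesgue (\<lambda>p. wgt p * (f p * f p))"
    and iY: "integrable lebesgue (\<lambda>p. wgt p * (yy p * yy p))"
    and iA: "integrable lebesgue (\<lambda>p. (wgt p * \<rho> p powr \<epsilon>) * (f p * f p))"
    and iC: "integrable lebesgue (\<lambda>p. (wgt p * bb (\<rho> p)) * (f p * f p))"
  proof -
    have w1: "continuous_on {0<..} (\<lambda>r. Om r * r powr \<epsilon>)" and w2: "continuous_on {0<..} (\<lambda>r. Om r * bb r)"
      by (intro continuous_intros weight_continuous cpow)+
    show "integrable lebesgue (\<lambda>p. wgt p * (f p * f p))" "integrable lebesgue (\<lambda>p. wgt p * (yy p * yy p))"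
      by (intro radial_integrable supp supp_yy weight_continuous)+
    show "integrable lebesgue (\<lambda>p. (wgt p * \<rho> p powr \<epsilon>) * (f p * f p))"
      using radial_integrable[OF supp(1) supp(1) w1] by (simp only: mult_ac)
    show "integrable lebesgue (\<lambda>p. (wgt p * bb (\<rho> p)) * (f p * f p))"
      using radial_integrable[OF supp(1) supp(1) w2] by (simp only: mult_ac)
  qed
  have "2 * s * D \<le> C"
    unfolding D_def C_def integral_mult_right_zero[symmetric]
  proof (intro integral_mono iC integrable_mult_right iD)
    fix p
    show "2 * s * (wgt p * (f p * f p)) \<le> (wgt p * bb (\<rho> p)) * (f p * f p)"
    proof (cases "p \<in> K")
      case True
      have "2 * s \<le> bb (\<rho> p)"
        using bb_lower[of "\<rho> p"] K1[OF True] pgauge_nonneg[of \<gamma> p] unfolding s_def mult.assoc[symmetric] by linarith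
      then have "2 * s * (wgt p * (f p * f p)) \<le> bb (\<rho> p) * (wgt p * (f p * f p))"
        using w by (intro mult_right_mono) auto
      then show ?thesis by (simp add: mult_ac)
    qed (simp add: cont_suppD[OF supp(1)])
  qed
  also have "C \<le> s * D + L\<^sup>2 / s * Y"
  proof -
    have ck: "continuous_on {0<..} (\<lambda>r. ln r - ln r1)"
      by (intro continuous_intros) auto
    have "C = - (\<integral>p. wgt p * (2 * (ln (\<rho> p) - ln r1) * f p * yy p))"
      unfolding poincare_identity by (simp add: C_def power2_eq_square mult_ac)
    also have "\<dots> = (\<integral>p. (- 2 * (wgt p * (ln (\<rho> p) - ln r1))) * (f p * yy p))"
      unfolding integral_minus[symmetric] by (simp add: algebra_simps)
    also have "\<dots> \<le> (\<integral>p. s * (wgt p * (f p * f p)) + L\<^sup>2 / s * (wgt p * (yy p * yy p)))"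
    proof (intro integral_mono lint_integrable_add integrable_mult_right iD iY)
      show "integrable lebesgue (\<lambda>p. (- 2 * (wgt p * (ln (\<rho> p) - ln r1))) * (f p * yy p))"
      proof -
        have w: "continuous_on {0<..} (\<lambda>r. - 2 * (Om r * (ln r - ln r1)))"
          by (intro continuous_intros weight_continuous ck)
        show ?thesis
          using radial_integrable[OF supp(1) supp_yy w] by (simp only: mult_ac)
      qed
      fix p
      show "(- 2 * (wgt p * (ln (\<rho> p) - ln r1))) * (f p * yy p)
         \<le> s * (wgt p * (f p * f p)) + L\<^sup>2 / s * (wgt p * (yy p * yy p))"
      proof (cases "p \<in> K")
        case True
        define k where "k = ln (\<rho> p) - ln r1"
        have "ln r1 \<le> ln (\<rho> p)" "ln (\<rho> p) \<le> ln (r1 * exp L)"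
          using K_le[OF True] r1 by auto
        then have k: "0 \<le> k" "k \<le> L"
          using r1 by (auto simp: k_def ln_mult)
        have "0 \<le> (s * f p + k * yy p)\<^sup>2 / s"
          using s by simp
        also have "\<dots> = s * (f p * f p) + 2 * k * (f p * yy p) + k\<^sup>2 / s * (yy p * yy p)"
          using s by (simp add: power2_eq_square field_simps)
        finally have "- 2 * k * (f p * yy p) \<le> s * (f p * f p) + k\<^sup>2 / s * (yy p * yy p)"
          by simp
        also have "\<dots> \<le> s * (f p * f p) + L\<^sup>2 / s * (yy p * yy p)"
          using k s by (intro add_left_mono mult_right_mono divide_right_mono power_mono) auto
        finally have "wgt p * (- 2 * k * (f p * yy p)) \<le> wgt p * (s * (f p * f p) + L\<^sup>2 / s * (yy p * yy p))"
          using w by (rule mult_left_mono)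
        then show ?thesis
          by (simp add: k_def[symmetric] algebra_simps)
      qed (simp add: cont_suppD[OF supp(1)] cont_suppD[OF supp_yy])
    qed
    also have "\<dots> = s * D + L\<^sup>2 / s * Y"
      using iD iY by (simp add: D_def Y_def)
    finally show ?thesis .
  qed
  finally have "s * D \<le> L\<^sup>2 / s * Y"
    by (simp add: mult.commute)
  then have "s * (s * D) \<le> s * (L\<^sup>2 / s * Y)"
    using s by (intro mult_left_mono) auto
  then have "s\<^sup>2 * D \<le> L\<^sup>2 * Y"
    using s by (simp add: power2_eq_square mult.assoc)
  then have "(1 - \<epsilon>)\<^sup>2 * \<alpha>\<^sup>2 * D \<le> L\<^sup>2 * Y"
    by (simp only: s_def power_mult_distrib)
  then have 1: "(1 - \<epsilon>)\<^sup>2 / (2 * L\<^sup>2) * \<alpha>\<^sup>2 * D \<le> 1 / 2 * Y"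
    using L by (simp add: field_simps)
  let ?c3 = "2 * \<epsilon>\<^sup>2 * (1 - \<epsilon>)\<^sup>2 * \<alpha> ^ 3" and ?c2 = "(1 - \<epsilon>)\<^sup>2 / (2 * L\<^sup>2) * \<alpha>\<^sup>2"
  have 2: "Y + ?c3 * A \<le> (\<integral>p. Bf p * ((\<rho> p)\<^sup>2 * Om (\<rho> p) * yy p))"
  proof -
    have "Y + ?c3 * A = (\<integral>p. wgt p * (yy p * yy p) + ?c3 * ((wgt p * \<rho> p powr \<epsilon>) * (f p * f p)))"
      using iY iA by (simp add: A_def Y_def)
    also have "\<dots> \<le> (\<integral>p. wgt p * (squares p))"
    proof (intro integral_mono lint_integrable_add integrable_mult_right iY iA)
      show "integrable lebesgue (\<lambda>p. wgt p * (squares p))"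
        by (rule square_terms_integrable)
      fix p
      show "wgt p * (yy p * yy p) + ?c3 * ((wgt p * \<rho> p powr \<epsilon>) * (f p * f p)) \<le>
        wgt p * (squares p)"
      proof (cases "p \<in> K")
        case True
        have "?c3 * \<rho> p powr \<epsilon> * (f p * f p) \<le> (th (\<rho> p) / 2 * ((bb (\<rho> p))\<^sup>2 - \<epsilon>\<^sup>2)) * (f p * f p)"
          using th_bb_lower[of "\<rho> p"] K1[OF True] pgauge_nonneg[of \<gamma> p]
          by (intro mult_right_mono) auto
        moreover have "0 \<le> (2 * th (\<rho> p)) * ((q p - (bb (\<rho> p) / 2 - cc) * f p) * (q p - (bb (\<rho> p) / 2 - cc) * f p))"
          using th_nonneg[of "\<rho> p"] by simp
        ultimately have "wgt p * (yy p * yy p + ?c3 * \<rho> p powr \<epsilon> * (f p * f p))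
          \<le> wgt p * (squares p)"
          using w by (intro mult_left_mono) auto
        then show ?thesis
          by (simp add: distrib_left mult_ac)
      qed (simp add: cont_suppD[OF supp(1)] cont_suppD[OF supp_yy] cont_suppD[OF supp(2)])
    qed
    also have "\<dots> = (\<integral>p. Bf p * ((\<rho> p)\<^sup>2 * Om (\<rho> p) * yy p))"
      unfolding carleman_identity by (simp only: power2_eq_square)
    finally show ?thesis .
  qed
  have "(\<integral>p. wgt p * ((?c2 + ?c3 * \<rho> p powr \<epsilon>) * (f p)\<^sup>2))
      = (\<integral>p. ?c2 * (wgt p * (f p * f p)) + ?c3 * ((wgt p * \<rho> p powr \<epsilon>) * (f p * f p)))"
    by (rule lint_cong[OF refl]) (simp add: power2_eq_square algebra_simps)
  also have "\<dots> = ?c2 * D + ?c3 * A"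
    using iD iA by (simp add: D_def A_def)
  finally have 3: "(\<integral>p. wgt p * ((?c2 + ?c3 * \<rho> p powr \<epsilon>) * (f p)\<^sup>2)) = ?c2 * D + ?c3 * A" .
  have "(\<integral>p. wgt p * (yy p)\<^sup>2) = Y"
    by (simp add: Y_def power2_eq_square)
  with 1 2 3 show ?thesis
    by linarith
qed

end


section \<open>Averages along dilations\<close>

lemma DERIV_frechet_line:
  fixes \<phi> :: "'a::real_normed_vector \<Rightarrow> real"
  assumes "\<phi> differentiable (at p)"
  shows "((\<lambda>s. \<phi> (p + s *\<^sub>R v)) has_real_derivative frechet_derivative \<phi> (at p) v) (at 0)"
proof -
  have D: "(\<phi> has_derivative frechet_derivative \<phi> (at p)) (at (p + 0 *\<^sub>R v))"
    using assms by (simp add: frechet_derivative_works)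
  have "((\<lambda>s. p + s *\<^sub>R v) has_derivative (\<lambda>h. h *\<^sub>R v)) (at 0)"
    by (auto intro!: derivative_eq_intros)
  from has_derivative_compose[OF this D]
  have "((\<lambda>s. \<phi> (p + s *\<^sub>R v)) has_derivative (\<lambda>h. frechet_derivative \<phi> (at p) (h *\<^sub>R v))) (at 0)" .
  moreover have "(\<lambda>h. frechet_derivative \<phi> (at p) (h *\<^sub>R v)) = (*) (frechet_derivative \<phi> (at p) v)"
    using linear_frechet_derivative[OF assms] by (auto simp: linear_cmul fun_eq_iff)
  ultimately show ?thesis
    by (simp add: has_field_derivative_def)
qed

text \<open>The right-hand side is the generator Z of the dilations as a vector field at
  \<open>p\<close>.\<close>

lemma inner_cdir_sum:
  fixes p :: "('m::finite, 'k::finite) point"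
  shows "(\<Sum>l\<in>UNIV. (wt \<gamma> l * (p \<bullet> cdir l)) *\<^sub>R (cdir l :: ('m, 'k) point)) = (fst p, (\<gamma> + 1) *\<^sub>R snd p)"
proof -
  have z: "(\<Sum>i\<in>UNIV. (z $ i) *\<^sub>R axis i (1::real)) = z" for z :: "real^'n::finite"
    using basis_expansion[of z] by (simp add: scalar_mult_eq_scaleR)
  have "(\<Sum>l\<in>UNIV. (wt \<gamma> l * (p \<bullet> cdir l)) *\<^sub>R (cdir l :: ('m, 'k) point))
    = (\<Sum>i\<in>UNIV. ((fst p $ i) *\<^sub>R axis i 1, 0)) + (\<Sum>j\<in>UNIV. (0, ((\<gamma> + 1) * snd p $ j) *\<^sub>R axis j 1))"
    unfolding UNIV_Plus_UNIV[symmetric] by (subst sum.Plus) (auto simp: wt_def cdir_def inner_prod_def inner_axis)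
  also have "\<dots> = (\<Sum>i\<in>UNIV. (fst p $ i) *\<^sub>R axis i 1, (\<gamma> + 1) *\<^sub>R (\<Sum>j\<in>UNIV. (snd p $ j) *\<^sub>R axis j 1))"
    by (simp add: prod_eq_iff fst_sum snd_sum scaleR_sum_right)
  finally show ?thesis
    by (simp add: z)
qed

lemma DERIV_frechet_dil:
  fixes \<phi> :: "('m::finite, 'k::finite) point \<Rightarrow> real"
  assumes "\<phi> differentiable (at p)"
  shows "((\<lambda>s. \<phi> (dil \<gamma> s p)) has_real_derivative
    (\<Sum>l\<in>UNIV. wt \<gamma> l * (p \<bullet> cdir l) * frechet_derivative \<phi> (at p) (cdir l))) (at 0)"
proof -
  let ?D = "frechet_derivative \<phi> (at p)"
  have lin: "linear ?D"
    by (rule linear_frechet_derivative[OF assms])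
  have D: "(\<phi> has_derivative ?D) (at (dil \<gamma> 0 p))"
    using assms by (simp add: frechet_derivative_works)
  have "((\<lambda>s. dil \<gamma> s p) has_derivative (\<lambda>h. h *\<^sub>R (fst p, (\<gamma> + 1) *\<^sub>R snd p))) (at 0)"
    unfolding dil_def by (auto intro!: derivative_eq_intros simp: algebra_simps)
  from has_derivative_compose[OF this D]
  have "((\<lambda>s. \<phi> (dil \<gamma> s p)) has_derivative (\<lambda>h. ?D (h *\<^sub>R (fst p, (\<gamma> + 1) *\<^sub>R snd p)))) (at 0)" .
  moreover have "(\<lambda>h. ?D (h *\<^sub>R (fst p, (\<gamma> + 1) *\<^sub>R snd p)))
      = (*) (\<Sum>l\<in>UNIV. wt \<gamma> l * (p \<bullet> cdir l) * ?D (cdir l))"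
    unfolding inner_cdir_sum[symmetric] using lin
    by (auto simp: linear_cmul linear_sum fun_eq_iff sum_distrib_right mult_ac)
  ultimately show ?thesis
    by (simp add: has_field_derivative_def)
qed

lemma dil_add_cdir: "dil \<gamma> \<tau> (p + s *\<^sub>R cdir l) = dil \<gamma> \<tau> p + (exp (wt \<gamma> l * \<tau>) * s) *\<^sub>R cdir l"
  by (cases l) (auto simp: dil_def cdir_def wt_def scaleR_add_right)

lemma dil_inner_cdir: "dil \<gamma> \<tau> p \<bullet> cdir l = exp (wt \<gamma> l * \<tau>) * (p \<bullet> cdir l)"
  by (cases l) (auto simp: dil_def cdir_def wt_def inner_prod_def)

text \<open>The kernel is a parameter because derivatives of an average are averages of derivatives
  with an additional exponential factor.\<close>

definition dil_avg :: "real \<Rightarrow> real \<Rightarrow> (real \<Rightarrow> real) \<Rightarrow> (('m::finite, 'k::finite) point \<Rightarrow> real)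
    \<Rightarrow> ('m, 'k) point \<Rightarrow> real" where
  "dil_avg \<gamma> \<eta> \<kappa> \<phi> p = integral {0..\<eta>} (\<lambda>\<tau>. \<kappa> \<tau> * \<phi> (dil \<gamma> \<tau> p))"

lemma continuous_dil_compose:
  fixes \<phi> :: "('m::finite, 'k::finite) point \<Rightarrow> real"
  assumes "continuous_on UNIV \<phi>" "continuous_on UNIV a" "continuous_on UNIV b"
  shows "continuous_on UNIV (\<lambda>z. \<phi> (dil \<gamma> (a z) (b z)))"
proof -
  have "continuous_on UNIV (\<lambda>z. (\<lambda>(s, p). dil \<gamma> s p) (a z, b z))"
    by (rule continuous_on_compose2[OF continuous_dil]) (auto intro!: continuous_intros assms)
  then have "continuous_on UNIV (\<lambda>z. dil \<gamma> (a z) (b z))" by simp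
  then show ?thesis
    by (rule continuous_on_compose2[OF assms(1)]) auto
qed

lemma dil_integrand_integrable:
  fixes \<phi> :: "('m::finite, 'k::finite) point \<Rightarrow> real" and \<kappa> :: "real \<Rightarrow> real"
  assumes "continuous_on UNIV \<phi>" "continuous_on UNIV \<kappa>"
  shows "(\<lambda>\<tau>. \<kappa> \<tau> * \<phi> (dil \<gamma> \<tau> p)) integrable_on {0..\<eta>}"
proof (rule integrable_continuous_interval)
  have "continuous_on UNIV (\<lambda>\<tau>. \<kappa> \<tau> * \<phi> (dil \<gamma> \<tau> p))"
    by (intro continuous_intros assms(2) continuous_dil_compose[OF assms(1)])
  then show "continuous_on {0..\<eta>} (\<lambda>\<tau>. \<kappa> \<tau> * \<phi> (dil \<gamma> \<tau> p))"
    by (rule continuous_on_subset) auto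
qed

text \<open>For \<tau> at least 0 the support moves inwards, so the outer radius, and with it the
  bound \<rho> at most 1, is kept.\<close>

lemma cont_supp_compose_dil:
  fixes \<phi> :: "('m::finite, 'k::finite) point \<Rightarrow> real"
  assumes \<gamma>: "\<gamma> > 0" and "cont_supp (annulus \<gamma> r1 r2) \<phi>" and "0 < r1" and "0 \<le> \<tau>" "\<tau> \<le> \<eta>"
  shows "cont_supp (annulus \<gamma> (r1 * exp (- \<eta>)) r2) (\<lambda>p. \<phi> (dil \<gamma> \<tau> p))"
  unfolding cont_supp_def
proof (intro conjI allI impI)
  show "continuous_on UNIV (\<lambda>p. \<phi> (dil \<gamma> \<tau> p))"
    by (intro continuous_dil_compose[OF cont_supp_continuous[OF assms(2)]] continuous_intros)
  fix p :: "('m, 'k) point" assume p: "p \<notin> annulus \<gamma> (r1 * exp (- \<eta>)) r2"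
  have "dil \<gamma> \<tau> p \<notin> annulus \<gamma> r1 r2"
  proof
    assume "dil \<gamma> \<tau> p \<in> annulus \<gamma> r1 r2"
    then have r: "r1 \<le> exp \<tau> * pgauge \<gamma> p" "exp \<tau> * pgauge \<gamma> p \<le> r2"
      by (auto simp: annulus_def pgauge_dil[OF \<gamma>])
    have "pgauge \<gamma> p \<le> exp \<tau> * pgauge \<gamma> p"
      using assms(4) pgauge_nonneg[of \<gamma> p] by (simp add: mult_le_cancel_right1)
    moreover have "r1 * exp (- \<eta>) \<le> pgauge \<gamma> p"
    proof -
      have "r1 \<le> exp \<eta> * pgauge \<gamma> p"
        by (rule order_trans[OF r(1) mult_right_mono]) (use assms(5) pgauge_nonneg[of \<gamma> p] in auto)
      then show ?thesis
        by (simp add: exp_minus field_simps)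
    qed
    ultimately show False
      using p r by (auto simp: annulus_def)
  qed
  then show "\<phi> (dil \<gamma> \<tau> p) = 0"
    by (rule cont_suppD[OF assms(2)])
qed

lemma cont_supp_dil_avg:
  fixes \<phi> :: "('m::finite, 'k::finite) point \<Rightarrow> real"
  assumes \<gamma>: "\<gamma> > 0" and \<phi>: "cont_supp (annulus \<gamma> r1 r2) \<phi>" and "0 < r1" and \<kappa>: "continuous_on UNIV \<kappa>"
  shows "cont_supp (annulus \<gamma> (r1 * exp (- \<eta>)) r2) (dil_avg \<gamma> \<eta> \<kappa> \<phi>)"
  unfolding cont_supp_def
proof (intro conjI allI impI)
  have "continuous_on UNIV (\<lambda>z. \<kappa> (snd z) * \<phi> (dil \<gamma> (snd z) (fst z)))"
    by (intro continuous_intros continuous_dil_compose[OF cont_supp_continuous[OF \<phi>]] continuous_on_compose2[OF \<kappa>]) auto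
  then have "continuous_on (UNIV \<times> cbox 0 \<eta>) (\<lambda>(p, \<tau>). \<kappa> \<tau> * \<phi> (dil \<gamma> \<tau> p))"
    by (auto simp: case_prod_beta intro: continuous_on_subset)
  then have "continuous_on UNIV (\<lambda>p. integral (cbox 0 \<eta>) (\<lambda>\<tau>. \<kappa> \<tau> * \<phi> (dil \<gamma> \<tau> p)))"
    by (rule integral_continuous_on_param)
  then show "continuous_on UNIV (dil_avg \<gamma> \<eta> \<kappa> \<phi>)"
    by (simp add: dil_avg_def[abs_def])
  fix p :: "('m, 'k) point" assume "p \<notin> annulus \<gamma> (r1 * exp (- \<eta>)) r2"
  then have "\<kappa> \<tau> * \<phi> (dil \<gamma> \<tau> p) = 0" if "\<tau> \<in> {0..\<eta>}" for \<tau>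
    using cont_suppD[OF cont_supp_compose_dil[OF \<gamma> \<phi> assms(3), of \<tau> \<eta>], of p] that by auto
  then have "integral {0..\<eta>} (\<lambda>\<tau>. \<kappa> \<tau> * \<phi> (dil \<gamma> \<tau> p)) = integral {0..\<eta>} (\<lambda>_. 0)"
    by (intro integral_cong) auto
  then show "dil_avg \<gamma> \<eta> \<kappa> \<phi> p = 0"
    by (simp add: dil_avg_def)
qed

lemma DERIV_dil_avg_line:
  fixes \<phi> \<phi>' :: "('m::finite, 'k::finite) point \<Rightarrow> real"
  assumes \<kappa>: "continuous_on UNIV \<kappa>" and c: "continuous_on UNIV \<phi>" "continuous_on UNIV \<phi>'"
    and d: "\<And>p. ((\<lambda>s. \<phi> (p + s *\<^sub>R cdir l)) has_real_derivative \<phi>' p) (at 0)"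
  shows "((\<lambda>s. dil_avg \<gamma> \<eta> \<kappa> \<phi> (p + s *\<^sub>R cdir l)) has_real_derivative
    dil_avg \<gamma> \<eta> (\<lambda>\<tau>. \<kappa> \<tau> * exp (wt \<gamma> l * \<tau>)) \<phi>' p) (at 0)"
proof -
  note d' = DERIV_flow[of "\<lambda>s p. p + s *\<^sub>R cdir l" \<phi> \<phi>', OF _ d]
  let ?f = "\<lambda>s \<tau>. \<kappa> \<tau> * \<phi> (dil \<gamma> \<tau> (p + s *\<^sub>R cdir l))"
  let ?f' = "\<lambda>s \<tau>. \<kappa> \<tau> * exp (wt \<gamma> l * \<tau>) * \<phi>' (dil \<gamma> \<tau> (p + s *\<^sub>R cdir l))"
  have "((\<lambda>s. integral (cbox 0 \<eta>) (?f s)) has_field_derivative integral (cbox 0 \<eta>) (?f' 0)) (at 0 within UNIV)"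
  proof (rule leibniz_rule_field_derivative)
    show "((\<lambda>s. ?f s \<tau>) has_field_derivative ?f' s \<tau>) (at s within UNIV)" for s \<tau>
    proof -
      have "((\<lambda>s. \<phi> (dil \<gamma> \<tau> p + (exp (wt \<gamma> l * \<tau>) * s) *\<^sub>R cdir l)) has_real_derivative
        \<phi>' (dil \<gamma> \<tau> p + (exp (wt \<gamma> l * \<tau>) * s) *\<^sub>R cdir l) * (exp (wt \<gamma> l * \<tau>))) (at s)"
        by (rule DERIV_chain2[OF d']) (auto intro!: derivative_eq_intros simp: algebra_simps)
      from DERIV_cmult[OF this, of "\<kappa> \<tau>"] show ?thesis
        by (simp add: dil_add_cdir mult_ac)
    qed
    show "?f s integrable_on cbox 0 \<eta>" for s
      using dil_integrand_integrable[OF c(1) \<kappa>] by simp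
    have "continuous_on UNIV (\<lambda>z. \<kappa> (snd z) * exp (wt \<gamma> l * snd z) * \<phi>' (dil \<gamma> (snd z) (p + fst z *\<^sub>R cdir l)))"
      by (intro continuous_intros continuous_dil_compose[OF c(2)] continuous_on_compose2[OF \<kappa>]) auto
    then show "continuous_on (UNIV \<times> cbox 0 \<eta>) (\<lambda>(s, \<tau>). ?f' s \<tau>)"
      by (auto simp: case_prod_beta intro: continuous_on_subset)
  qed auto
  then show ?thesis
    by (simp add: dil_avg_def)
qed

text \<open>The derivative along the flow is also the derivative in \<tau> of the integrand, so the
  fundamental theorem of calculus replaces \<zeta> by boundary values of \<phi>. The price is the
  factor 1/\<eta>.\<close>

lemma dil_avg_flow:
  fixes \<phi> \<zeta> :: "('m::finite, 'k::finite) point \<Rightarrow> real"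
  assumes c: "continuous_on UNIV \<phi>" "continuous_on UNIV \<zeta>" and \<eta>: "\<eta> > 0"
    and d: "\<And>p. ((\<lambda>s. \<phi> (dil \<gamma> s p)) has_real_derivative \<zeta> p) (at 0)"
  shows "dil_avg \<gamma> \<eta> (\<lambda>\<tau>. exp (w * \<tau>) / \<eta>) \<zeta> p =
      (exp (w * \<eta>) * \<phi> (dil \<gamma> \<eta> p) - \<phi> p) / \<eta> - w * dil_avg \<gamma> \<eta> (\<lambda>\<tau>. exp (w * \<tau>) / \<eta>) \<phi> p" (is ?eq)
    and "((\<lambda>s. dil_avg \<gamma> \<eta> (\<lambda>\<tau>. exp (w * \<tau>) / \<eta>) \<phi> (dil \<gamma> s p)) has_real_derivative
      (exp (w * \<eta>) * \<phi> (dil \<gamma> \<eta> p) - \<phi> p) / \<eta> - w * dil_avg \<gamma> \<eta> (\<lambda>\<tau>. exp (w * \<tau>) / \<eta>) \<phi> p) (at 0)"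
proof -
  note d' = DERIV_flow[of "dil \<gamma>" \<phi> \<zeta>, OF dil_dil d]
  have \<kappa>: "continuous_on UNIV (\<lambda>\<tau>. exp (w * \<tau>) / \<eta>)"
    using \<eta> by (intro continuous_intros) auto
  show eq: ?eq
  proof -
    have "((\<lambda>\<tau>. w * (exp (w * \<tau>) / \<eta> * \<phi> (dil \<gamma> \<tau> p)) + exp (w * \<tau>) / \<eta> * \<zeta> (dil \<gamma> \<tau> p)) has_integral
        exp (w * \<eta>) / \<eta> * \<phi> (dil \<gamma> \<eta> p) - exp (w * 0) / \<eta> * \<phi> (dil \<gamma> 0 p)) {0..\<eta>}"
    proof (rule fundamental_theorem_of_calculus)
      fix \<tau>
      have "((\<lambda>\<tau>. exp (w * \<tau>) / \<eta> * \<phi> (dil \<gamma> \<tau> p)) has_real_derivative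
          w * (exp (w * \<tau>) / \<eta> * \<phi> (dil \<gamma> \<tau> p)) + exp (w * \<tau>) / \<eta> * \<zeta> (dil \<gamma> \<tau> p)) (at \<tau>)"
        using \<eta> by (auto intro!: derivative_eq_intros d' simp: field_simps)
      then show "((\<lambda>\<tau>. exp (w * \<tau>) / \<eta> * \<phi> (dil \<gamma> \<tau> p)) has_vector_derivative
          w * (exp (w * \<tau>) / \<eta> * \<phi> (dil \<gamma> \<tau> p)) + exp (w * \<tau>) / \<eta> * \<zeta> (dil \<gamma> \<tau> p)) (at \<tau> within {0..\<eta>})"
        by (simp add: has_real_derivative_iff_has_vector_derivative has_vector_derivative_at_within)
    qed (use \<eta> in simp)
    then have "integral {0..\<eta>} (\<lambda>\<tau>. w * (exp (w * \<tau>) / \<eta> * \<phi> (dil \<gamma> \<tau> p)) + exp (w * \<tau>) / \<eta> * \<zeta> (dil \<gamma> \<tau> p))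
        = exp (w * \<eta>) / \<eta> * \<phi> (dil \<gamma> \<eta> p) - exp (w * 0) / \<eta> * \<phi> (dil \<gamma> 0 p)"
      by (rule integral_unique)
    moreover have "integral {0..\<eta>} (\<lambda>\<tau>. w * (exp (w * \<tau>) / \<eta> * \<phi> (dil \<gamma> \<tau> p)) + exp (w * \<tau>) / \<eta> * \<zeta> (dil \<gamma> \<tau> p))
        = w * dil_avg \<gamma> \<eta> (\<lambda>\<tau>. exp (w * \<tau>) / \<eta>) \<phi> p + dil_avg \<gamma> \<eta> (\<lambda>\<tau>. exp (w * \<tau>) / \<eta>) \<zeta> p"
      unfolding dil_avg_def integral_mult_right[symmetric]
      by (rule integral_add[OF integrable_on_mult_right[OF
            dil_integrand_integrable[OF c(1) \<kappa>]] dil_integrand_integrable[OF c(2) \<kappa>]])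
    ultimately show ?thesis
      by (simp add: diff_divide_distrib)
  qed
  let ?\<kappa> = "\<lambda>\<tau>. exp (w * \<tau>) / \<eta>"
  have "((\<lambda>s. integral (cbox 0 \<eta>) (\<lambda>\<tau>. ?\<kappa> \<tau> * \<phi> (dil \<gamma> \<tau> (dil \<gamma> s p)))) has_field_derivative
      integral (cbox 0 \<eta>) (\<lambda>\<tau>. ?\<kappa> \<tau> * \<zeta> (dil \<gamma> \<tau> (dil \<gamma> 0 p)))) (at 0 within UNIV)"
  proof (rule leibniz_rule_field_derivative)
    show "((\<lambda>s. ?\<kappa> \<tau> * \<phi> (dil \<gamma> \<tau> (dil \<gamma> s p))) has_field_derivative ?\<kappa> \<tau> * \<zeta> (dil \<gamma> \<tau> (dil \<gamma> s p))) (at s within UNIV)" for s \<tau>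
      using DERIV_cmult[OF d'[of "dil \<gamma> \<tau> p" s], of "?\<kappa> \<tau>"] by (simp add: dil_dil add.commute)
    show "(\<lambda>\<tau>. ?\<kappa> \<tau> * \<phi> (dil \<gamma> \<tau> (dil \<gamma> s p))) integrable_on cbox 0 \<eta>" for s
      using dil_integrand_integrable[OF c(1) \<kappa>] by simp
    have "continuous_on UNIV (\<lambda>z. ?\<kappa> (snd z) * \<zeta> (dil \<gamma> (snd z + fst z) p))"
      using \<eta> by (intro continuous_intros continuous_dil_compose[OF c(2)]) auto
    then show "continuous_on (UNIV \<times> cbox 0 \<eta>) (\<lambda>(s, \<tau>). ?\<kappa> \<tau> * \<zeta> (dil \<gamma> \<tau> (dil \<gamma> s p)))"
      by (auto simp: case_prod_beta dil_dil intro: continuous_on_subset)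
  qed auto
  then have "((\<lambda>s. dil_avg \<gamma> \<eta> ?\<kappa> \<phi> (dil \<gamma> s p)) has_real_derivative dil_avg \<gamma> \<eta> ?\<kappa> \<zeta> p) (at 0)"
    by (simp add: dil_avg_def)
  then show "((\<lambda>s. dil_avg \<gamma> \<eta> (\<lambda>\<tau>. exp (w * \<tau>) / \<eta>) \<phi> (dil \<gamma> s p)) has_real_derivative
      (exp (w * \<eta>) * \<phi> (dil \<gamma> \<eta> p) - \<phi> p) / \<eta> - w * dil_avg \<gamma> \<eta> (\<lambda>\<tau>. exp (w * \<tau>) / \<eta>) \<phi> p) (at 0)"
    unfolding eq .
qed

text \<open>
  \<open>Z \<phi>\<close> is not controlled in \<open>L\<^sup>2\<close> by the norm of \<open>S\<^sup>2\<^sup>,\<^sup>2\<^sub>0\<close>, but the average of \<open>\<phi>\<close> over the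
  dilations by \<open>e\<^sup>\<tau>\<close>, \<open>0 \<le> \<tau> \<le> \<eta>\<close>, commutes with the operator up to the factor \<open>e\<^bsup>2\<tau>\<^esup>\<close>
  and has the derivative \<open>(\<phi> \<circ> dil \<eta> - \<phi>) / \<eta>\<close> along the flow.
\<close>

locale dilation_average =
  fixes \<gamma> \<eta> r1 r2 :: real and \<phi> :: "('m::finite, 'k::finite) point \<Rightarrow> real"
  assumes \<gamma>: "\<gamma> > 0" and \<eta>: "\<eta> > 0" and r1: "r1 > 0"
    and smooth: "C_k 2 \<phi>" and \<phi>0: "p \<notin> annulus \<gamma> r1 r2 \<Longrightarrow> \<phi> p = 0"
begin

definition \<phi>d :: "'m + 'k \<Rightarrow> ('m, 'k) point \<Rightarrow> real" where
  "\<phi>d l p = frechet_derivative \<phi> (at p) (cdir l)"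

definition \<phi>dd :: "'m + 'k \<Rightarrow> ('m, 'k) point \<Rightarrow> real" where
  "\<phi>dd l p = frechet_derivative (\<phi>d l) (at p) (cdir l)"

lemma differentiable: "\<phi> differentiable (at p)" "\<phi>d l differentiable (at p)"
  using smooth unfolding numeral_2_eq_2 C_k.simps \<phi>d_def[abs_def] by blast+

lemma continuous: "continuous_on UNIV \<phi>" "continuous_on UNIV (\<phi>d l)"
    "continuous_on UNIV (\<lambda>p. frechet_derivative (\<phi>d l) (at p) v)"
proof -
  show "continuous_on UNIV \<phi>" "continuous_on UNIV (\<phi>d l)"
    using differentiable by (auto intro!: continuous_at_imp_continuous_on differentiable_imp_continuous_within)
  show "continuous_on UNIV (\<lambda>p. frechet_derivative (\<phi>d l) (at p) v)"
    using smooth unfolding numeral_2_eq_2 C_k.simps \<phi>d_def[abs_def] by blast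
qed

lemma line_deriv:
  "((\<lambda>s. \<phi> (p + s *\<^sub>R cdir l)) has_real_derivative \<phi>d l p) (at 0)"
  "((\<lambda>s. \<phi>d l (p + s *\<^sub>R cdir l)) has_real_derivative \<phi>dd l p) (at 0)"
  unfolding \<phi>d_def \<phi>dd_def
  by (rule DERIV_frechet_line, rule differentiable)
     (rule DERIV_frechet_line, rule differentiable[unfolded \<phi>d_def[abs_def]])

lemma supp:
  "cont_supp (annulus \<gamma> r1 r2) \<phi>" "cont_supp (annulus \<gamma> r1 r2) (\<phi>d l)" "cont_supp (annulus \<gamma> r1 r2) (\<phi>dd l)"
proof -
  have K: "compact (annulus \<gamma> r1 r2 :: ('m, 'k) point set)"
    by (rule compact_annulus[OF \<gamma>])
  have c: "continuous_on UNIV (\<lambda>s. p + s *\<^sub>R cdir l)" for p :: "('m, 'k) point" and l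
    by (intro continuous_intros)
  show 1: "cont_supp (annulus \<gamma> r1 r2) \<phi>"
    using continuous \<phi>0 by (simp only: cont_supp_def) blast
  have "\<phi>d l p = 0" if "p \<notin> annulus \<gamma> r1 r2" for l p
    using DERIV_unique[OF line_deriv(1) DERIV_outside_support[OF K 1 _ c]] that by simp
  then show 2: "cont_supp (annulus \<gamma> r1 r2) (\<phi>d l)" for l
    using continuous by (simp only: cont_supp_def) blast
  have "\<phi>dd l p = 0" if "p \<notin> annulus \<gamma> r1 r2" for l p
    using DERIV_unique[OF line_deriv(2) DERIV_outside_support[OF K 2 _ c]] that by simp
  then show "cont_supp (annulus \<gamma> r1 r2) (\<phi>dd l)"
    using continuous(3) unfolding cont_supp_def \<phi>dd_def[abs_def] by blast
qed

lemma X_field_eq: "X_field \<gamma> l g p = xcoeff \<gamma> l p * deriv (\<lambda>s. g (p + s *\<^sub>R cdir l)) 0"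
  by (cases l) (simp_all add: X_field_def xcoeff_def partial_deriv_def cdir_def)

lemma grushin_eq: "grushin \<gamma> \<phi> p = (\<Sum>l\<in>UNIV. (xcoeff \<gamma> l p)\<^sup>2 * \<phi>dd l p)"
proof -
  have 1: "X_field \<gamma> l \<phi> = (\<lambda>p. xcoeff \<gamma> l p * \<phi>d l p)" for l
    by (rule ext) (simp only: X_field_eq DERIV_imp_deriv[OF line_deriv(1)])
  have "X_field \<gamma> l (\<lambda>p. xcoeff \<gamma> l p * \<phi>d l p) p = (xcoeff \<gamma> l p)\<^sup>2 * \<phi>dd l p" for l
  proof -
    have "X_field \<gamma> l (\<lambda>p. xcoeff \<gamma> l p * \<phi>d l p) p
        = xcoeff \<gamma> l p * deriv (\<lambda>s. xcoeff \<gamma> l (p + s *\<^sub>R cdir l) * \<phi>d l (p + s *\<^sub>R cdir l)) 0"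
      by (rule X_field_eq)
    also have "deriv (\<lambda>s. xcoeff \<gamma> l (p + s *\<^sub>R cdir l) * \<phi>d l (p + s *\<^sub>R cdir l)) 0 = xcoeff \<gamma> l p * \<phi>dd l p"
      unfolding xcoeff_cdir by (rule DERIV_imp_deriv[OF DERIV_cmult[OF line_deriv(2)]])
    finally show ?thesis
      by (simp add: power2_eq_square)
  qed
  then show ?thesis
    by (simp add: grushin_def 1)
qed

lemma supp_grushin: "cont_supp (annulus \<gamma> r1 r2) (grushin \<gamma> \<phi>)"
proof -
  have "cont_supp (annulus \<gamma> r1 r2) (\<lambda>p. \<Sum>l\<in>UNIV. (xcoeff \<gamma> l p)\<^sup>2 * \<phi>dd l p)"
    by (intro cont_supp_sum cont_supp_mult[OF supp(3), where U=UNIV] compact_annulus \<gamma> continuous_intros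
        continuous_xcoeff) auto
  then show ?thesis
    by (simp add: grushin_eq[abs_def])
qed

definition f :: "('m, 'k) point \<Rightarrow> real" where
  "f = dil_avg \<gamma> \<eta> (\<lambda>\<tau>. 1 / \<eta>) \<phi>"

definition fd :: "'m + 'k \<Rightarrow> ('m, 'k) point \<Rightarrow> real" where
  "fd l = dil_avg \<gamma> \<eta> (\<lambda>\<tau>. exp (wt \<gamma> l * \<tau>) / \<eta>) (\<phi>d l)"

definition fdd :: "'m + 'k \<Rightarrow> ('m, 'k) point \<Rightarrow> real" where
  "fdd l = dil_avg \<gamma> \<eta> (\<lambda>\<tau>. exp (2 * wt \<gamma> l * \<tau>) / \<eta>) (\<phi>dd l)"

text \<open>Zf in terms of boundary values: no derivative of \<phi> occurs, so its L^2 norm is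
  controlled by that of \<phi>.\<close>

definition q :: "('m, 'k) point \<Rightarrow> real" where
  "q p = (\<phi> (dil \<gamma> \<eta> p) - \<phi> p) / \<eta>"

definition qd :: "'m + 'k \<Rightarrow> ('m, 'k) point \<Rightarrow> real" where
  "qd l p = (exp (wt \<gamma> l * \<eta>) * \<phi>d l (dil \<gamma> \<eta> p) - \<phi>d l p) / \<eta>"

lemma flow_\<phi>:
  "((\<lambda>s. \<phi> (dil \<gamma> s p)) has_real_derivative (\<Sum>l\<in>UNIV. wt \<gamma> l * (p \<bullet> cdir l) * \<phi>d l p)) (at 0)"
  unfolding \<phi>d_def by (rule DERIV_frechet_dil[OF differentiable(1)])

lemma continuous_flow_\<phi>: "continuous_on UNIV (\<lambda>p. \<Sum>l\<in>UNIV. wt \<gamma> l * (p \<bullet> cdir l) * \<phi>d l p)"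
  by (intro continuous_intros continuous)

lemma q_eq: "q p = (\<Sum>l\<in>UNIV. wt \<gamma> l * (p \<bullet> cdir l) * fd l p)"
proof -
  have int: "(\<lambda>\<tau>. wt \<gamma> l * (p \<bullet> cdir l) * (exp (wt \<gamma> l * \<tau>) / \<eta> * \<phi>d l (dil \<gamma> \<tau> p))) integrable_on {0..\<eta>}" for l
    by (intro integrable_on_mult_right dil_integrand_integrable continuous continuous_intros) (use \<eta> in auto)
  have "q p = dil_avg \<gamma> \<eta> (\<lambda>\<tau>. exp (0 * \<tau>) / \<eta>) (\<lambda>p. \<Sum>l\<in>UNIV. wt \<gamma> l * (p \<bullet> cdir l) * \<phi>d l p) p"
    unfolding dil_avg_flow(1)[OF continuous(1) continuous_flow_\<phi> \<eta> flow_\<phi>] by (simp add: q_def)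
  also have "\<dots> = integral {0..\<eta>} (\<lambda>\<tau>. \<Sum>l\<in>UNIV. wt \<gamma> l * (p \<bullet> cdir l) * (exp (wt \<gamma> l * \<tau>) / \<eta> * \<phi>d l (dil \<gamma> \<tau> p)))"
    by (simp add: dil_avg_def dil_inner_cdir sum_distrib_left mult_ac)
  also have "\<dots> = (\<Sum>l\<in>UNIV. integral {0..\<eta>} (\<lambda>\<tau>. wt \<gamma> l * (p \<bullet> cdir l) * (exp (wt \<gamma> l * \<tau>) / \<eta> * \<phi>d l (dil \<gamma> \<tau> p))))"
    by (rule integral_sum[OF finite int])
  also have "\<dots> = (\<Sum>l\<in>UNIV. wt \<gamma> l * (p \<bullet> cdir l) * fd l p)"
    by (simp only: integral_mult_right fd_def dil_avg_def)
  finally show ?thesis .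
qed

lemma data: "grushin_data \<gamma> (hom_dim \<gamma> TYPE(('m, 'k) point)) (annulus \<gamma> (r1 * exp (- \<eta>)) r2) f q fd fdd qd"
proof
  let ?K = "annulus \<gamma> (r1 * exp (- \<eta>)) r2 :: ('m, 'k) point set"
  have c: "continuous_on UNIV (\<lambda>\<tau>. 1 / \<eta>)" "continuous_on UNIV (\<lambda>\<tau>. exp (w * \<tau>) / \<eta>)" for w
    using \<eta> by (auto intro!: continuous_intros)
  show "compact ?K"
    by (rule compact_annulus[OF \<gamma>])
  have "pgauge \<gamma> (0 :: ('m, 'k) point) = 0"
    by (simp add: pgauge_def)
  then show "0 \<notin> ?K"
    using r1 by (auto simp: annulus_def mult_le_0_iff not_le)
  have sub: "annulus \<gamma> r1 r2 \<subseteq> ?K"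
  proof -
    have "r1 * exp (- \<eta>) \<le> r1"
      using r1 \<eta> by simp
    then show ?thesis by (auto simp: annulus_def)
  qed
  have sd: "cont_supp ?K (\<lambda>p. \<psi> (dil \<gamma> \<eta> p))" if "cont_supp (annulus \<gamma> r1 r2) \<psi>" for \<psi>
    using cont_supp_compose_dil[OF \<gamma> that r1, of \<eta> \<eta>] \<eta> by simp
  show "cont_supp ?K f" "cont_supp ?K (fd l)" "cont_supp ?K (fdd l)" for l
    unfolding f_def fd_def fdd_def by (intro cont_supp_dil_avg \<gamma> supp r1 c)+
  have "cont_supp ?K (\<lambda>p. 1 / \<eta> * (\<phi> (dil \<gamma> \<eta> p) - \<phi> p))"
    by (intro cont_supp_cmult cont_supp_diff sd supp cont_supp_mono[OF supp(1) sub])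
  then show "cont_supp ?K q"
    by (simp add: q_def[abs_def])
  have "cont_supp ?K (\<lambda>p. 1 / \<eta> * (exp (wt \<gamma> l * \<eta>) * \<phi>d l (dil \<gamma> \<eta> p) - \<phi>d l p))" for l
    by (intro cont_supp_cmult cont_supp_diff sd supp cont_supp_mono[OF supp(2) sub])
  then show "cont_supp ?K (qd l)" for l
    by (simp add: qd_def[abs_def])
  show "((\<lambda>s. f (p + s *\<^sub>R cdir l)) has_real_derivative fd l p) (at 0)" for p l
    using DERIV_dil_avg_line[OF c(1) continuous(1) continuous(2) line_deriv(1), of \<gamma> \<eta> p]
    by (simp add: f_def fd_def)
  show "((\<lambda>s. fd l (p + s *\<^sub>R cdir l)) has_real_derivative fdd l p) (at 0)" for p l
    using DERIV_dil_avg_line[OF c(2) continuous(2) continuous(3)[of l "cdir l", folded \<phi>dd_def] line_deriv(2), of \<gamma> \<eta> "wt \<gamma> l" p]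
    by (simp add: fd_def fdd_def exp_double mult.assoc power2_eq_square)
  show "((\<lambda>s. q (p + s *\<^sub>R cdir l)) has_real_derivative qd l p) (at 0)" for p l
  proof -
    have "((\<lambda>s. \<phi> (dil \<gamma> \<eta> p + (exp (wt \<gamma> l * \<eta>) * s) *\<^sub>R cdir l)) has_real_derivative
        \<phi>d l (dil \<gamma> \<eta> p) * (exp (wt \<gamma> l * \<eta>))) (at 0)"
      by (rule DERIV_chain2[where f="\<lambda>s. \<phi> (dil \<gamma> \<eta> p + s *\<^sub>R cdir l)"])
         (auto intro!: derivative_eq_intros line_deriv)
    from DERIV_cdivide[OF DERIV_diff[OF this line_deriv(1)], where c=\<eta>] show ?thesis
      by (simp add: q_def qd_def dil_add_cdir mult.commute)
  qed
  show "((\<lambda>s. f (dil \<gamma> s p)) has_real_derivative q p) (at 0)" for p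
    using dil_avg_flow(2)[OF continuous(1) continuous_flow_\<phi> \<eta> flow_\<phi>, of 0 p]
    by (simp add: f_def q_def)
  \<comment> \<open>The commutator term is the last term of \<open>dil_avg_flow\<close> with
    \<open>w = wt \<gamma> l\<close>, the exponent of the kernel of \<open>fd\<close>.\<close>
  show "((\<lambda>s. fd l (dil \<gamma> s p)) has_real_derivative qd l p - wt \<gamma> l * fd l p) (at 0)" for p l
    unfolding fd_def qd_def
    by (rule dil_avg_flow(2)[OF continuous(2) _ \<eta> DERIV_frechet_dil[OF differentiable(2)]])
       (intro continuous_intros continuous)
  show "q p = (\<Sum>l\<in>UNIV. wt \<gamma> l * (p \<bullet> cdir l) * fd l p)" for p
    by (rule q_eq)
qed (rule \<gamma>, rule refl)

text \<open>The operator is homogeneous of degree two: the kernel exponent of \<open>fdd\<close> and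
  the scaling of the squared coefficient combine to \<open>exp (2 * \<tau>)\<close> for every
  l.\<close>

lemma Bf_eq: "grushin_data.Bf \<gamma> fdd p = dil_avg \<gamma> \<eta> (\<lambda>\<tau>. exp (2 * \<tau>) / \<eta>) (grushin \<gamma> \<phi>) p"
proof -
  have int: "(\<lambda>\<tau>. (xcoeff \<gamma> l p)\<^sup>2 * (exp (2 * wt \<gamma> l * \<tau>) / \<eta> * \<phi>dd l (dil \<gamma> \<tau> p))) integrable_on {0..\<eta>}" for l
    using continuous(3)[of l "cdir l", folded \<phi>dd_def]
    by (intro integrable_on_mult_right dil_integrand_integrable continuous_intros) (use \<eta> in auto)
  have e: "exp (2 * \<tau>) * (xcoeff \<gamma> l (dil \<gamma> \<tau> p))\<^sup>2 = (xcoeff \<gamma> l p)\<^sup>2 * exp (2 * wt \<gamma> l * \<tau>)" for l \<tau>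
    by (simp add: xcoeff_dil power_mult_distrib exp_double[symmetric] exp_add[symmetric] algebra_simps)
  have e': "exp (2 * \<tau>) / \<eta> * ((xcoeff \<gamma> l (dil \<gamma> \<tau> p))\<^sup>2 * X) = (xcoeff \<gamma> l p)\<^sup>2 * (exp (2 * wt \<gamma> l * \<tau>) / \<eta> * X)" for l \<tau> X
  proof -
    have "exp (2 * \<tau>) / \<eta> * ((xcoeff \<gamma> l (dil \<gamma> \<tau> p))\<^sup>2 * X) = (exp (2 * \<tau>) * (xcoeff \<gamma> l (dil \<gamma> \<tau> p))\<^sup>2) * (X / \<eta>)"
      by simp
    then show ?thesis
      unfolding e by simp
  qed
  have "grushin_data.Bf \<gamma> fdd p = (\<Sum>l\<in>UNIV. integral {0..\<eta>} (\<lambda>\<tau>. (xcoeff \<gamma> l p)\<^sup>2 * (exp (2 * wt \<gamma> l * \<tau>) / \<eta> * \<phi>dd l (dil \<gamma> \<tau> p))))"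
    unfolding grushin_data.Bf_def[OF data]
    by (simp only: integral_mult_right fdd_def dil_avg_def)
  also have "\<dots> = integral {0..\<eta>} (\<lambda>\<tau>. \<Sum>l\<in>UNIV. (xcoeff \<gamma> l p)\<^sup>2 * (exp (2 * wt \<gamma> l * \<tau>) / \<eta> * \<phi>dd l (dil \<gamma> \<tau> p)))"
    by (rule integral_sum[OF finite int, symmetric])
  also have "\<dots> = integral {0..\<eta>} (\<lambda>\<tau>. exp (2 * \<tau>) / \<eta> * grushin \<gamma> \<phi> (dil \<gamma> \<tau> p))"
    unfolding grushin_eq sum_distrib_left
    by (simp only: e')
  finally show ?thesis
    by (simp add: dil_avg_def)
qed

end


section \<open>Passage to the limit\<close>

lemma square_add_le: "(x + y)\<^sup>2 \<le> 2 * x\<^sup>2 + 2 * (y :: real)\<^sup>2"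
  using zero_le_power2[of "x - y"] by (simp add: power2_eq_square algebra_simps)

lemma integrable_square_diff:
  fixes f g :: "'a \<Rightarrow> real"
  assumes [measurable]: "f \<in> borel_measurable M" "g \<in> borel_measurable M"
    and "integrable M (\<lambda>p. (f p)\<^sup>2)" "integrable M (\<lambda>p. (g p)\<^sup>2)"
  shows "integrable M (\<lambda>p. (f p - g p)\<^sup>2)"
proof (rule lint_integrable_bound)
  show "integrable M (\<lambda>p. 2 * (f p)\<^sup>2 + 2 * (g p)\<^sup>2)"
    using assms(3,4) by simp
  show "AE p in M. norm ((f p - g p)\<^sup>2) \<le> norm (2 * (f p)\<^sup>2 + 2 * (g p)\<^sup>2)"
    using square_add_le[of "f p" "- g p" for p] by auto
qed measurable

lemma cont_supp_square_integrable:
  "compact K \<Longrightarrow> cont_supp K f \<Longrightarrow> integrable lebesgue (\<lambda>p. (f p)\<^sup>2)"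
  using cont_supp_integrable[OF _ cont_supp_mult2] by (simp add: power2_eq_square)

lemma cont_supp_measurable: "compact K \<Longrightarrow> cont_supp K f \<Longrightarrow> f \<in> borel_measurable lebesgue"
  by (rule borel_measurable_integrable[OF cont_supp_integrable])

text \<open>\<open>L2_lim\<close> does not state that the limit is square integrable. One index at
  finite distance, where \<open>f n\<close> is square integrable, gives this and makes the real
  integrals meaningful.\<close>

lemma L2_lim_cont_supp:
  fixes f :: "nat \<Rightarrow> 'a::euclidean_space \<Rightarrow> real"
  assumes K: "compact K" and f: "\<And>n. cont_supp K (f n)" and lim: "L2_lim f g"
  shows "g \<in> borel_measurable lebesgue"
    and "integrable lebesgue (\<lambda>p. (g p)\<^sup>2)"
    and "\<And>n. integrable lebesgue (\<lambda>p. (f n p - g p)\<^sup>2)"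
    and "(\<lambda>n. \<integral>p. (f n p - g p)\<^sup>2) \<longlonglongrightarrow> 0"
proof -
  show [measurable]: "g \<in> borel_measurable lebesgue"
    using lim by (simp add: L2_lim_def)
  have [measurable]: "f n \<in> borel_measurable lebesgue" for n
    by (rule cont_supp_measurable[OF K f])
  have L: "(\<lambda>n. \<integral>\<^sup>+ p. ennreal ((f n p - g p)\<^sup>2) \<partial>lebesgue) \<longlonglongrightarrow> 0"
    using lim by (simp add: L2_lim_def)
  then have "\<forall>\<^sub>F n in sequentially. (\<integral>\<^sup>+ p. ennreal ((f n p - g p)\<^sup>2) \<partial>lebesgue) < 1"
    by (rule order_tendstoD) simp
  then obtain n0 where n0: "(\<integral>\<^sup>+ p. ennreal ((f n0 p - g p)\<^sup>2) \<partial>lebesgue) < 1"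
    by (auto simp: eventually_sequentially)
  have i0: "integrable lebesgue (\<lambda>p. (f n0 p - g p)\<^sup>2)"
    using n0 by (intro integrableI_nonneg) (auto intro: less_trans)
  show g2: "integrable lebesgue (\<lambda>p. (g p)\<^sup>2)"
  proof (rule lint_integrable_bound)
    show "integrable lebesgue (\<lambda>p. 2 * (f n0 p)\<^sup>2 + 2 * (f n0 p - g p)\<^sup>2)"
      using i0 cont_supp_square_integrable[OF K f] by simp
    show "AE p in lebesgue. norm ((g p)\<^sup>2) \<le> norm (2 * (f n0 p)\<^sup>2 + 2 * (f n0 p - g p)\<^sup>2)"
    proof (intro always_eventually allI)
      fix p
      show "norm ((g p)\<^sup>2) \<le> norm (2 * (f n0 p)\<^sup>2 + 2 * (f n0 p - g p)\<^sup>2)"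
        using square_add_le[of "f n0 p" "- (f n0 p - g p)"] by (simp add: power2_commute)
    qed
  qed measurable
  show i: "integrable lebesgue (\<lambda>p. (f n p - g p)\<^sup>2)" for n
    by (rule integrable_square_diff) (auto intro: g2 cont_supp_square_integrable[OF K f])
  have e: "(\<integral>\<^sup>+ p. ennreal ((f n p - g p)\<^sup>2) \<partial>lebesgue) = ennreal (\<integral>p. (f n p - g p)\<^sup>2)" for n
    by (rule nn_integral_eq_integral[OF i]) simp
  show R: "(\<lambda>n. \<integral>p. (f n p - g p)\<^sup>2) \<longlonglongrightarrow> 0"
    using L unfolding e ennreal_0[symmetric] by (subst (asm) tendsto_ennreal_iff) auto
qed

lemma L2_lim_AE_zero:
  fixes f :: "nat \<Rightarrow> 'a::euclidean_space \<Rightarrow> real"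
  assumes S: "S \<in> sets lebesgue" and f: "\<And>n p. p \<notin> S \<Longrightarrow> f n p = 0"
    and f2: "\<And>n. integrable lebesgue (\<lambda>p. (f n p - g p)\<^sup>2)" and g2: "integrable lebesgue (\<lambda>p. (g p)\<^sup>2)"
    and R: "(\<lambda>n. \<integral>p. (f n p - g p)\<^sup>2) \<longlonglongrightarrow> 0"
  shows "AE p in lebesgue. p \<notin> S \<longrightarrow> g p = 0"
proof -
  have im: "integrable lebesgue (\<lambda>p. indicator (- S) p * (g p)\<^sup>2)"
    using integrable_mult_indicator[OF _ g2, of "- S"] S by (simp add: Compl_in_sets_lebesgue)
  have "(\<integral>p. indicator (- S) p * (g p)\<^sup>2) \<le> (\<integral>p. (f n p - g p)\<^sup>2)" for n
    by (intro integral_mono im f2) (use f in \<open>auto simp: indicator_def\<close>)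
  then have "(\<integral>p. indicator (- S) p * (g p)\<^sup>2) \<le> 0"
    using R by (intro LIMSEQ_le_const) auto
  then have "(\<integral>p. indicator (- S) p * (g p)\<^sup>2) = 0"
    by (intro antisym lint_nonneg) auto
  then have "AE p in lebesgue. indicator (- S) p * (g p)\<^sup>2 = 0"
    by (subst (asm) integral_nonneg_eq_0_iff_AE[OF im]) auto
  then show ?thesis
    by eventually_elim (auto simp: indicator_def)
qed

lemma integral_swap_interval:
  fixes H :: "real \<Rightarrow> 'a::euclidean_space \<Rightarrow> real"
  assumes K: "compact K" and H: "continuous_on UNIV (\<lambda>(\<tau>, p). H \<tau> p)"
    and z: "\<And>\<tau> p. \<tau> \<in> {0..\<eta>} \<Longrightarrow> p \<notin> K \<Longrightarrow> H \<tau> p = 0"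
  shows "(\<integral>p. integral {0..\<eta>} (\<lambda>\<tau>. H \<tau> p)) = integral {0..\<eta>} (\<lambda>\<tau>. \<integral>p. H \<tau> p)"
    and "(\<lambda>\<tau>. \<integral>p. H \<tau> p) integrable_on {0..\<eta>}"
    and "cont_supp K (\<lambda>p. integral {0..\<eta>} (\<lambda>\<tau>. H \<tau> p))"
proof -
  obtain a where a: "K \<subseteq> cbox (- a) a"
    using bounded_subset_cbox_symmetric[OF compact_imp_bounded[OF K]] by metis
  have Hp: "continuous_on UNIV (H \<tau>)" for \<tau>
    using continuous_on_compose2[OF H continuous_on_Pair[OF continuous_on_const[of UNIV \<tau>] continuous_on_id]] by simp
  have "continuous_on UNIV (\<lambda>z. (\<lambda>(\<tau>, p). H \<tau> p) (snd z, fst z))"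
    by (rule continuous_on_compose2[OF H]) (auto intro!: continuous_intros)
  then have H': "continuous_on S (\<lambda>(p, \<tau>). H \<tau> p)" for S
    by (auto simp: case_prod_beta intro: continuous_on_subset)
  have "continuous_on UNIV (\<lambda>p. integral (cbox 0 \<eta>) (\<lambda>\<tau>. H \<tau> p))"
    by (rule integral_continuous_on_param[OF H'])
  moreover have "integral {0..\<eta>} (\<lambda>\<tau>. H \<tau> p) = 0" if "p \<notin> K" for p
    using z[OF _ that] by (subst integral_cong[where g="\<lambda>_. 0"]) auto
  ultimately show 1: "cont_supp K (\<lambda>p. integral {0..\<eta>} (\<lambda>\<tau>. H \<tau> p))"
    by (simp add: cont_supp_def)
  have 2: "(\<integral>p. H \<tau> p) = integral (cbox (- a) a) (H \<tau>)" if "\<tau> \<in> {0..\<eta>}" for \<tau>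
    by (rule cont_supp_integral_cbox[OF _ K a, symmetric]) (use z[OF that] Hp in \<open>simp only: cont_supp_def, blast\<close>)
  have "(\<integral>p. integral {0..\<eta>} (\<lambda>\<tau>. H \<tau> p))
    = integral (cbox (- a) a) (\<lambda>p. integral (cbox 0 \<eta>) (\<lambda>\<tau>. H \<tau> p))"
    using cont_supp_integral_cbox[OF 1 K a] by simp
  also have "\<dots> = integral (cbox 0 \<eta>) (\<lambda>\<tau>. integral (cbox (- a) a) (\<lambda>p. H \<tau> p))"
    by (rule integral_swap_continuous[OF H'])
  also have "\<dots> = integral {0..\<eta>} (\<lambda>\<tau>. \<integral>p. H \<tau> p)"
    by (auto intro!: integral_cong simp: 2)
  finally show "(\<integral>p. integral {0..\<eta>} (\<lambda>\<tau>. H \<tau> p)) = integral {0..\<eta>} (\<lambda>\<tau>. \<integral>p. H \<tau> p)" .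
  have "continuous_on UNIV (\<lambda>\<tau>. integral (cbox (- a) a) (H \<tau>))"
    by (rule integral_continuous_on_param) (rule continuous_on_subset[OF H], simp)
  then have "continuous_on {0..\<eta>} (\<lambda>\<tau>. integral (cbox (- a) a) (H \<tau>))"
    by (rule continuous_on_subset) simp
  then have "(\<lambda>\<tau>. integral (cbox (- a) a) (H \<tau>)) integrable_on {0..\<eta>}"
    by (rule integrable_continuous_interval)
  then show "(\<lambda>\<tau>. \<integral>p. H \<tau> p) integrable_on {0..\<eta>}"
    by (rule integrable_eq) (simp add: 2)
qed

lemma hom_dim_nonneg: "\<gamma> > 0 \<Longrightarrow> hom_dim \<gamma> T \<ge> 0"
  by (simp add: hom_dim_def)

text \<open>For \<tau> at least 0 the Jacobian factor \<open>exp (- \<tau> * Q)\<close> is at most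
  1.\<close>

lemma integral_dil_le:
  fixes F :: "('m::finite, 'k::finite) point \<Rightarrow> real"
  assumes "\<gamma> > 0" "F \<in> borel_measurable lebesgue" "\<tau> \<ge> 0" "\<And>p. F p \<ge> 0"
  shows "(\<integral>p. F (dil \<gamma> \<tau> p)) \<le> (\<integral>p. F p)"
proof -
  have "0 \<le> (\<integral>p. F p)"
    using assms by (intro lint_nonneg) auto
  then show ?thesis
    unfolding integral_dil[OF assms(2)]
    by (intro mult_left_le_one_le) (auto intro!: mult_nonneg_nonneg hom_dim_nonneg assms)
qed

lemma integrable_dil:
  fixes F :: "('m::finite, 'k::finite) point \<Rightarrow> real"
  assumes "integrable lebesgue F"
  shows "integrable lebesgue (\<lambda>p. F (dil \<gamma> \<tau> p))"
proof -
  note [measurable] = lebesgue_dil(2) borel_measurable_integrable[OF assms]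
  have "(\<integral>\<^sup>+p. ennreal (norm (F (dil \<gamma> \<tau> p))) \<partial>lebesgue) < \<infinity>"
    using assms unfolding integrable_iff_bounded
    by (subst nn_integral_dil[of "\<lambda>p. ennreal (norm (F p))"]) (auto simp: ennreal_mult_less_top)
  then show ?thesis
    by (simp add: integrable_iff_bounded)
qed

text \<open>The variance of \<open>g\<close> about its mean \<open>c\<close> is nonnegative.\<close>

lemma interval_jensen:
  fixes g :: "real \<Rightarrow> real"
  assumes "\<eta> > 0" and g: "continuous_on {0..\<eta>} g"
  shows "(integral {0..\<eta>} (\<lambda>\<tau>. 1 / \<eta> * g \<tau>))\<^sup>2 \<le> integral {0..\<eta>} (\<lambda>\<tau>. 1 / \<eta> * (g \<tau>)\<^sup>2)"
proof -
  define c where "c = integral {0..\<eta>} (\<lambda>\<tau>. 1 / \<eta> * g \<tau>)"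
  have i1: "(\<lambda>\<tau>. 1 / \<eta> * (g \<tau>)\<^sup>2) integrable_on {0..\<eta>}"
    and i2: "(\<lambda>\<tau>. 2 * c * (1 / \<eta> * g \<tau>)) integrable_on {0..\<eta>}"
    by (intro integrable_continuous_interval continuous_intros g)+
  have "0 \<le> integral {0..\<eta>} (\<lambda>\<tau>. 1 / \<eta> * (g \<tau> - c)\<^sup>2)"
    using assms(1) by (intro integral_nonneg integrable_continuous_interval continuous_intros g) auto
  also have "(\<lambda>\<tau>. 1 / \<eta> * (g \<tau> - c)\<^sup>2) = (\<lambda>\<tau>. 1 / \<eta> * (g \<tau>)\<^sup>2 - 2 * c * (1 / \<eta> * g \<tau>) + c\<^sup>2 / \<eta>)"
    using assms(1) by (auto simp: power2_eq_square field_simps)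
  also have "integral {0..\<eta>} \<dots> = integral {0..\<eta>} (\<lambda>\<tau>. 1 / \<eta> * (g \<tau>)\<^sup>2) - 2 * c * c + c\<^sup>2"
    using assms(1) i1 i2
    by (simp only: integral_add integral_diff integrable_diff
        integrable_const_ivl integral_mult_right c_def[symmetric]) (simp add: c_def)
  finally show ?thesis
    unfolding c_def[symmetric] by (simp add: power2_eq_square)
qed

section \<open>Averages as contractions of L^2\<close>

context
  fixes \<gamma> \<eta> r1 r2 :: real
  assumes \<gamma>: "\<gamma> > 0" and \<eta>: "\<eta> > 0" and r1: "r1 > 0"
begin

text \<open>Jensen pointwise, then exchange of integrals. That the bound is free of \<eta> lets
  \<eta> be fixed before the test function is chosen.\<close>

lemma dil_avg_L2_bound:
  fixes \<phi> :: "('m::finite, 'k::finite) point \<Rightarrow> real"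
  assumes \<phi>: "cont_supp (annulus \<gamma> r1 r2) \<phi>"
  shows "(\<integral>p. (dil_avg \<gamma> \<eta> (\<lambda>\<tau>. 1 / \<eta>) \<phi> p)\<^sup>2) \<le> (\<integral>p. (\<phi> p)\<^sup>2)"
proof -
  let ?K = "annulus \<gamma> (r1 * exp (- \<eta>)) r2 :: ('m, 'k) point set"
  have K: "compact ?K"
    by (rule compact_annulus[OF \<gamma>])
  have c: "continuous_on UNIV \<phi>"
    by (rule cont_supp_continuous[OF \<phi>])
  have H: "continuous_on UNIV (\<lambda>(\<tau>, p). 1 / \<eta> * (\<phi> (dil \<gamma> \<tau> p))\<^sup>2)"
    unfolding case_prod_beta by (intro continuous_intros continuous_dil_compose[OF c])
  have z: "1 / \<eta> * (\<phi> (dil \<gamma> \<tau> p))\<^sup>2 = 0" if "\<tau> \<in> {0..\<eta>}" "p \<notin> ?K" for \<tau> p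
    using cont_suppD[OF cont_supp_compose_dil[OF \<gamma> \<phi> r1, of \<tau> \<eta>] that(2)] that(1) by simp
  note sw = integral_swap_interval[OF K H z]
  have av: "cont_supp ?K (dil_avg \<gamma> \<eta> (\<lambda>\<tau>. 1 / \<eta>) \<phi>)"
    by (intro cont_supp_dil_avg \<gamma> \<phi> r1 continuous_intros)
  have "(\<integral>p. (dil_avg \<gamma> \<eta> (\<lambda>\<tau>. 1 / \<eta>) \<phi> p)\<^sup>2)
      \<le> (\<integral>p. integral {0..\<eta>} (\<lambda>\<tau>. 1 / \<eta> * (\<phi> (dil \<gamma> \<tau> p))\<^sup>2))"
  proof (intro integral_mono cont_supp_square_integrable[OF K av] cont_supp_integrable[OF K sw(3)])
    fix p
    show "(dil_avg \<gamma> \<eta> (\<lambda>\<tau>. 1 / \<eta>) \<phi> p)\<^sup>2 \<le> integral {0..\<eta>} (\<lambda>\<tau>. 1 / \<eta> * (\<phi> (dil \<gamma> \<tau> p))\<^sup>2)"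
      unfolding dil_avg_def
      by (intro interval_jensen \<eta> continuous_on_subset[OF continuous_dil_compose[OF c continuous_on_id continuous_on_const]]) auto
  qed
  also have "\<dots> = integral {0..\<eta>} (\<lambda>\<tau>. \<integral>p. 1 / \<eta> * (\<phi> (dil \<gamma> \<tau> p))\<^sup>2)"
    by (rule sw(1))
  also have "\<dots> \<le> integral {0..\<eta>} (\<lambda>\<tau>. 1 / \<eta> * (\<integral>p. (\<phi> p)\<^sup>2))"
  proof (intro integral_le sw(2))
    fix \<tau> assume "\<tau> \<in> {0..\<eta>}"
    then have "(\<integral>p. (\<phi> (dil \<gamma> \<tau> p))\<^sup>2) \<le> (\<integral>p. (\<phi> p)\<^sup>2)"
      by (intro integral_dil_le[where F="\<lambda>p. (\<phi> p)\<^sup>2"] \<gamma> borel_measurable_integrable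
          cont_supp_square_integrable[OF compact_annulus[OF \<gamma>] \<phi>]) auto
    then show "(\<integral>p. 1 / \<eta> * (\<phi> (dil \<gamma> \<tau> p))\<^sup>2) \<le> 1 / \<eta> * (\<integral>p. (\<phi> p)\<^sup>2)"
      using \<eta> by (simp add: divide_right_mono)
  qed auto
  also have "\<dots> = (\<integral>p. (\<phi> p)\<^sup>2)"
    using \<eta> by simp
  finally show ?thesis .
qed

lemma dil_avg_diff:
  fixes \<phi> :: "('m::finite, 'k::finite) point \<Rightarrow> real"
  assumes "continuous_on UNIV \<phi>" "continuous_on UNIV \<phi>'"
  shows "dil_avg \<gamma> \<eta> (\<lambda>\<tau>. 1 / \<eta>) (\<lambda>p. \<phi> p - \<phi>' p) p
    = dil_avg \<gamma> \<eta> (\<lambda>\<tau>. 1 / \<eta>) \<phi> p - dil_avg \<gamma> \<eta> (\<lambda>\<tau>. 1 / \<eta>) \<phi>' p"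
  unfolding dil_avg_def right_diff_distrib
  by (rule integral_diff[OF dil_integrand_integrable dil_integrand_integrable])
     (intro assms continuous_intros)+

end


lemma borel_measurable_pgauge:
  "\<gamma> > 0 \<Longrightarrow> (pgauge \<gamma> :: ('m::finite, 'k::finite) point \<Rightarrow> real) \<in> borel_measurable lebesgue"
  by (intro measurable_completion) (simp add: borel_measurable_continuous_onI[OF continuous_pgauge])

lemma borel_measurable_angle:
  assumes "\<gamma> > 0"
  shows "(angle_fn \<gamma> :: ('m::finite, 'k::finite) point \<Rightarrow> real) \<in> borel_measurable lebesgue"
proof -
  have "(\<lambda>p::('m, 'k) point. norm (fst p)) \<in> borel_measurable borel"
    by (intro borel_measurable_continuous_onI continuous_intros)
  then have [measurable]: "(\<lambda>p::('m, 'k) point. norm (fst p)) \<in> borel_measurable lebesgue"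
    by (intro measurable_completion) simp
  note [measurable] = borel_measurable_pgauge[OF assms]
  show ?thesis
    unfolding angle_fn_def[abs_def] by measurable
qed

context dilation_average
begin

text \<open>Z\<phi> is bounded for a single test function, so \<phi> is Lipschitz along the flow.
  The constant depends on \<phi>, which dictates the order of choices in
  \<open>carleman_limit\<close>.\<close>

lemma L2_approx:
  shows "\<exists>C\<ge>0. \<forall>t. 0 < t \<longrightarrow> t \<le> ln 2 \<longrightarrow>
    (\<integral>p. (dil_avg \<gamma> t (\<lambda>\<tau>. 1 / t) \<phi> p - \<phi> p)\<^sup>2) \<le> C * t\<^sup>2"
proof -
  define \<zeta> where "\<zeta> p = (\<Sum>l\<in>UNIV. wt \<gamma> l * (p \<bullet> cdir l) * \<phi>d l p)" for p
  have cz: "continuous_on UNIV \<zeta>"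
    unfolding \<zeta>_def[abs_def] by (rule continuous_flow_\<phi>)
  let ?A = "annulus \<gamma> r1 r2 :: ('m, 'k) point set"
  have A: "compact ?A"
    by (rule compact_annulus[OF \<gamma>])
  have "bounded (\<zeta> ` ?A)"
    by (intro compact_imp_bounded compact_continuous_image A continuous_on_subset[OF cz]) auto
  then obtain M0 where M0: "\<And>p. p \<in> ?A \<Longrightarrow> \<bar>\<zeta> p\<bar> \<le> M0"
    unfolding bounded_iff by (auto simp del: split_paired_All)
  define M where "M = max M0 0"
  have M: "\<bar>\<zeta> p\<bar> \<le> M" for p
  proof (cases "p \<in> ?A")
    case True
    then show ?thesis using M0[OF True] by (simp add: M_def)
  next
    case False
    then show ?thesis using cont_suppD[OF supp(2) False] by (simp add: \<zeta>_def M_def)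
  qed
  have M': "M \<ge> 0" by (simp add: M_def)
  note d = DERIV_flow[of "dil \<gamma>" \<phi> \<zeta>, OF dil_dil flow_\<phi>[folded \<zeta>_def]]
  have lip: "\<bar>\<phi> (dil \<gamma> \<tau> p) - \<phi> p\<bar> \<le> M * \<tau>" if "\<tau> \<ge> 0" for \<tau> p
  proof (cases "\<tau> = 0")
    case False
    then have "0 < \<tau>" using that by simp
    then obtain z where "\<phi> (dil \<gamma> \<tau> p) - \<phi> (dil \<gamma> 0 p) = (\<tau> - 0) * \<zeta> (dil \<gamma> z p)"
      using MVT2[of 0 \<tau> "\<lambda>s. \<phi> (dil \<gamma> s p)" "\<lambda>s. \<zeta> (dil \<gamma> s p)", OF _ d] by auto
    then show ?thesis
      using mult_left_mono[OF M[of "dil \<gamma> z p"] that] that by (simp add: abs_mult mult.commute)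
  qed simp
  \<comment> \<open>With t at most ln 2 one has exp(-t) at least 1/2, so this compact set carries
    all the averages.\<close>
  let ?K = "annulus \<gamma> (r1 / 2) r2 :: ('m, 'k) point set"
  have K: "compact ?K"
    by (rule compact_annulus[OF \<gamma>])
  have sub: "?A \<subseteq> ?K"
    using r1 by (auto simp: annulus_def)
  have fin: "?K \<in> sets lebesgue" "emeasure lebesgue ?K < \<infinity>"
    using lmeasurable_compact[OF K] by (auto simp: fmeasurable_def)
  show ?thesis
  proof (intro exI[of _ "M\<^sup>2 * measure lebesgue ?K"] conjI allI impI)
    fix t :: real assume t: "0 < t" "t \<le> ln 2"
    let ?f = "dil_avg \<gamma> t (\<lambda>\<tau>. 1 / t) \<phi>"
    have unif: "\<bar>?f p - \<phi> p\<bar> \<le> M * t" for p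
    proof -
      have c1: "continuous_on UNIV (\<lambda>\<tau>::real. 1 / t)"
        using t by (intro continuous_intros) auto
      have i: "(\<lambda>\<tau>. 1 / t * \<phi> (dil \<gamma> \<tau> p)) integrable_on {0..t}"
        by (rule dil_integrand_integrable[OF continuous(1) c1])
      have i2: "(\<lambda>\<tau>. 1 / t * \<phi> p) integrable_on {0..t}"
        by (rule integrable_const_ivl)
      have "?f p - \<phi> p = integral {0..t} (\<lambda>\<tau>. 1 / t * \<phi> (dil \<gamma> \<tau> p)) - integral {0..t} (\<lambda>\<tau>. 1 / t * \<phi> p)"
        using t by (simp add: dil_avg_def)
      also have "\<dots> = integral {0..t} (\<lambda>\<tau>. 1 / t * \<phi> (dil \<gamma> \<tau> p) - 1 / t * \<phi> p)"
        by (rule integral_diff[OF i i2, symmetric])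
      also have "norm \<dots> \<le> integral {0..t} (\<lambda>\<tau>. 1 / t * (M * t))"
      proof (rule integral_norm_bound_integral)
        show "(\<lambda>\<tau>. 1 / t * \<phi> (dil \<gamma> \<tau> p) - 1 / t * \<phi> p) integrable_on {0..t}"
          by (rule integrable_diff[OF i i2])
        fix \<tau> assume \<tau>: "\<tau> \<in> {0..t}"
        have "norm (1 / t * \<phi> (dil \<gamma> \<tau> p) - 1 / t * \<phi> p) = 1 / t * \<bar>\<phi> (dil \<gamma> \<tau> p) - \<phi> p\<bar>"
          unfolding right_diff_distrib[symmetric] using t by (simp add: abs_mult)
        also have "\<dots> \<le> 1 / t * (M * \<tau>)"
          using \<tau> t lip by (intro mult_left_mono) auto
        also have "\<dots> \<le> 1 / t * (M * t)"
          using \<tau> t M' by (intro mult_left_mono) auto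
        finally show "norm (1 / t * \<phi> (dil \<gamma> \<tau> p) - 1 / t * \<phi> p) \<le> 1 / t * (M * t)" .
      qed (rule integrable_const_ivl)
      also have "\<dots> = M * t"
        using t by simp
      finally show ?thesis by simp
    qed
    have "r1 / 2 \<le> r1 * exp (- t)"
    proof -
      have "exp t \<le> exp (ln 2)" using t by (subst exp_le_cancel_iff)
      then show ?thesis
        using r1 by (simp add: exp_minus field_simps)
    qed
    then have "annulus \<gamma> (r1 * exp (- t)) r2 \<subseteq> ?K"
      by (auto simp: annulus_def)
    then have cf: "cont_supp ?K ?f"
      by (intro cont_supp_mono[OF cont_supp_dil_avg[OF \<gamma> supp(1) r1]] continuous_intros) (use t in auto)
    have cd: "cont_supp ?K (\<lambda>p. ?f p - \<phi> p)"
      by (intro cont_supp_diff cf cont_supp_mono[OF supp(1) sub])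
    have "(\<integral>p. (?f p - \<phi> p)\<^sup>2) \<le> (\<integral>p. (M * t)\<^sup>2 * indicator ?K p)"
    proof (intro integral_mono cont_supp_square_integrable[OF K cd] integrable_mult_right integrable_real_indicator fin)
      fix p
      show "(?f p - \<phi> p)\<^sup>2 \<le> (M * t)\<^sup>2 * indicator ?K p"
      proof (cases "p \<in> ?K")
        case True
        have "\<bar>?f p - \<phi> p\<bar>\<^sup>2 \<le> (M * t)\<^sup>2"
          by (rule power_mono[OF unif]) simp
        then show ?thesis using True by simp
      next
        case False
        then show ?thesis using cont_suppD[OF cd False] by simp
      qed
    qed
    also have "\<dots> = M\<^sup>2 * measure lebesgue ?K * t\<^sup>2"
      using fin by (simp add: power_mult_distrib)
    finally show "(\<integral>p. (?f p - \<phi> p)\<^sup>2) \<le> M\<^sup>2 * measure lebesgue ?K * t\<^sup>2" .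
  qed simp
qed

end

section \<open>Upper bound for the product with the multiplier\<close>

context carleman_weight
begin

text \<open>The weight \<rho>^4 \<Omega> of the right-hand side; it arises when Young's inequality
  separates \<rho>^2 times the operator from y.\<close>

definition Om4 :: "real \<Rightarrow> real" where
  "Om4 r = r powr (- 2 * \<alpha>) * exp (2 * \<alpha> * r powr \<epsilon>)"

lemma Om4_eq: "r > 0 \<Longrightarrow> Om4 r = r ^ 4 * Om r"
proof -
  assume r: "r > 0"
  have "r powr (- 2 * \<alpha>) = r powr 4 * r powr (- 2 * \<alpha> - 4)"
    by (simp add: powr_add[symmetric])
  then show ?thesis
    using r by (simp add: Om4_def Om_def powr_numeral)
qed

text \<open>The change of variables moves the weight by a dilation. The power costs
  \<open>exp (2 * \<alpha> * \<tau>)\<close>, close to 1 for small \<tau>; the exponential factor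
  only decreases.\<close>

lemma Om4_shrink:
  assumes "r \<ge> 0" "\<tau> \<ge> 0"
  shows "Om4 (exp (- \<tau>) * r) \<le> exp (2 * \<alpha> * \<tau>) * Om4 r"
proof -
  have "exp (- \<tau>) * r \<le> r"
    using assms by (simp add: mult_left_le_one_le)
  then have "(exp (- \<tau>) * r) powr \<epsilon> \<le> r powr \<epsilon>"
    using assms \<epsilon> by (intro powr_mono2) auto
  then have "exp (2 * \<alpha> * (exp (- \<tau>) * r) powr \<epsilon>) \<le> exp (2 * \<alpha> * r powr \<epsilon>)"
    using \<alpha> by simp
  moreover have "(exp (- \<tau>) * r) powr (- 2 * \<alpha>) = exp (2 * \<alpha> * \<tau>) * r powr (- 2 * \<alpha>)"
    using assms by (simp add: powr_mult exp_powr_real)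
  ultimately show ?thesis
    unfolding Om4_def by (simp add: mult_left_mono mult.assoc)
qed

lemma Om4_nonneg: "Om4 r \<ge> 0"
  by (simp add: Om4_def)

end

locale carleman_average = dilation_average \<gamma> \<eta> r1 r2 \<phi> + carleman_weight \<alpha> \<epsilon>
  for \<gamma> \<eta> r1 r2 and \<phi> :: "('m::finite, 'k::finite) point \<Rightarrow> real" and \<alpha> \<epsilon> +
  assumes r2: "r2 \<le> 1"

sublocale carleman_average \<subseteq> cd: carleman_data \<gamma> "hom_dim \<gamma> TYPE(('m, 'k) point)"
    "annulus \<gamma> (r1 * exp (- \<eta>)) r2" f q fd fdd qd \<alpha> \<epsilon>
  by (intro carleman_data.intro data carleman_data_axioms.intro carleman_weight_axioms)
     (use r2 in \<open>auto simp: annulus_def\<close>)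

context carleman_average
begin

definition Gf :: "('m, 'k) point \<Rightarrow> real" where
  "Gf p = (pgauge \<gamma> p)\<^sup>2 * Om (pgauge \<gamma> p) * cd.yy p"

lemma supp_Gf: "cont_supp (annulus \<gamma> (r1 * exp (- \<eta>)) r2) Gf"
  unfolding Gf_def[abs_def] by (intro cd.cs_mult cd.supp_yy continuous_intros continuous_pgauge \<gamma>
      continuous_radial weight_continuous)

text \<open>Only the L^2 norm of \<phi> and \<eta> enter. With \<eta> fixed, the multiplier can
  therefore be paired with an error that tends to 0 in L^2.\<close>

lemma Gf_L2:
  assumes B: "\<And>r. r1 * exp (- \<eta>) \<le> r \<Longrightarrow> r \<le> r2 \<Longrightarrow> \<bar>r\<^sup>2 * Om r * bb r\<bar> \<le> B \<and> \<bar>r\<^sup>2 * Om r * cd.hh r\<bar> \<le> B"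
  shows "(\<integral>p. (Gf p)\<^sup>2) \<le> (8 * B\<^sup>2 / \<eta>\<^sup>2 + 2 * B\<^sup>2) * (\<integral>p. (\<phi> p)\<^sup>2)"
proof -
  let ?K = "annulus \<gamma> (r1 * exp (- \<eta>)) r2 :: ('m, 'k) point set"
  have K: "compact ?K"
    by (rule compact_annulus[OF \<gamma>])
  have \<phi>2: "integrable lebesgue (\<lambda>p. (\<phi> p)\<^sup>2)"
    by (rule cont_supp_square_integrable[OF compact_annulus[OF \<gamma>] supp(1)])
  have \<phi>2d: "integrable lebesgue (\<lambda>p. (\<phi> (dil \<gamma> \<eta> p))\<^sup>2)"
    by (rule integrable_dil[OF \<phi>2])
  note q2 = cont_supp_square_integrable[OF K cd.supp(2)] and f2 = cont_supp_square_integrable[OF K cd.supp(1)]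
  have f: "(\<integral>p. (f p)\<^sup>2) \<le> (\<integral>p. (\<phi> p)\<^sup>2)"
    unfolding f_def by (rule dil_avg_L2_bound[OF \<gamma> \<eta> r1 supp(1)])
  have "(\<integral>p. (q p)\<^sup>2) \<le> (\<integral>p. 2 / \<eta>\<^sup>2 * ((\<phi> (dil \<gamma> \<eta> p))\<^sup>2 + (\<phi> p)\<^sup>2))"
  proof (intro integral_mono q2 integrable_mult_right lint_integrable_add \<phi>2 \<phi>2d)
    fix p
    have "(q p)\<^sup>2 = (\<phi> (dil \<gamma> \<eta> p) - \<phi> p)\<^sup>2 / \<eta>\<^sup>2"
      by (simp add: q_def power_divide)
    also have "\<dots> \<le> (2 * (\<phi> (dil \<gamma> \<eta> p))\<^sup>2 + 2 * (\<phi> p)\<^sup>2) / \<eta>\<^sup>2"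
      using square_add_le[of "\<phi> (dil \<gamma> \<eta> p)" "- \<phi> p"] by (intro divide_right_mono) auto
    finally show "(q p)\<^sup>2 \<le> 2 / \<eta>\<^sup>2 * ((\<phi> (dil \<gamma> \<eta> p))\<^sup>2 + (\<phi> p)\<^sup>2)"
      by (simp add: add_divide_distrib distrib_left)
  qed
  also have "\<dots> = 2 / \<eta>\<^sup>2 * ((\<integral>p. (\<phi> (dil \<gamma> \<eta> p))\<^sup>2) + (\<integral>p. (\<phi> p)\<^sup>2))"
    by (simp only: integral_mult_right_zero lint_add[OF \<phi>2d \<phi>2])
  also have "\<dots> \<le> 2 / \<eta>\<^sup>2 * ((\<integral>p. (\<phi> p)\<^sup>2) + (\<integral>p. (\<phi> p)\<^sup>2))"
    using \<eta> by (intro mult_left_mono add_right_mono integral_dil_le[where F="\<lambda>p. (\<phi> p)\<^sup>2"] \<gamma>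
        borel_measurable_integrable[OF \<phi>2]) auto
  finally have q: "(\<integral>p. (q p)\<^sup>2) \<le> 4 / \<eta>\<^sup>2 * (\<integral>p. (\<phi> p)\<^sup>2)"
    by simp
  have "(\<integral>p. (Gf p)\<^sup>2) \<le> (\<integral>p. 2 * B\<^sup>2 * (q p)\<^sup>2 + 2 * B\<^sup>2 * (f p)\<^sup>2)"
  proof (intro integral_mono cont_supp_square_integrable[OF K supp_Gf] integrable_mult_right
      lint_integrable_add f2 q2)
    fix p
    show "(Gf p)\<^sup>2 \<le> 2 * B\<^sup>2 * (q p)\<^sup>2 + 2 * B\<^sup>2 * (f p)\<^sup>2"
    proof (cases "p \<in> ?K")
      case True
      let ?r = "pgauge \<gamma> p"
      have b: "\<bar>?r\<^sup>2 * Om ?r * bb ?r\<bar> \<le> B" "\<bar>?r\<^sup>2 * Om ?r * cd.hh ?r\<bar> \<le> B"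
        using B[of ?r] True by (auto simp: annulus_def)
      have "(Gf p)\<^sup>2 = ((?r\<^sup>2 * Om ?r * bb ?r) * q p + (?r\<^sup>2 * Om ?r * cd.hh ?r) * f p)\<^sup>2"
        by (simp add: Gf_def cd.yy_def algebra_simps)
      also have "\<dots> \<le> 2 * ((?r\<^sup>2 * Om ?r * bb ?r) * q p)\<^sup>2 + 2 * ((?r\<^sup>2 * Om ?r * cd.hh ?r) * f p)\<^sup>2"
        by (rule square_add_le)
      also have "\<dots> = 2 * (\<bar>?r\<^sup>2 * Om ?r * bb ?r\<bar>\<^sup>2 * (q p)\<^sup>2) + 2 * (\<bar>?r\<^sup>2 * Om ?r * cd.hh ?r\<bar>\<^sup>2 * (f p)\<^sup>2)"
        by (simp add: power_mult_distrib)
      also have "\<dots> \<le> 2 * (B\<^sup>2 * (q p)\<^sup>2) + 2 * (B\<^sup>2 * (f p)\<^sup>2)"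
        using b by (intro add_mono mult_left_mono mult_right_mono power_mono) auto
      finally show ?thesis by simp
    next
      case False
      then show ?thesis using cont_suppD[OF supp_Gf False] by simp
    qed
  qed
  also have "\<dots> = 2 * B\<^sup>2 * (\<integral>p. (q p)\<^sup>2) + 2 * B\<^sup>2 * (\<integral>p. (f p)\<^sup>2)"
    using q2 f2 by simp
  also have "\<dots> \<le> 2 * B\<^sup>2 * (4 / \<eta>\<^sup>2 * (\<integral>p. (\<phi> p)\<^sup>2)) + 2 * B\<^sup>2 * (\<integral>p. (\<phi> p)\<^sup>2)"
    using q f by (intro add_mono mult_left_mono) auto
  finally show ?thesis
    by (simp add: algebra_simps)
qed

text \<open>For each \<tau>, the dilated \<open>grushin \<gamma> \<phi>\<close> is split into the
  dilated \<open>w\<close> and an error. The first part meets y by Young's inequality with weight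
  \<psi>; the error meets \<open>Gf\<close> with the free parameter \<open>s\<close>. Thus 1/\<psi>
  falls on \<open>w\<close> alone.\<close>

lemma carleman_upper:
  assumes w [measurable]: "w \<in> borel_measurable lebesgue"
    and gw: "integrable lebesgue (\<lambda>p. (grushin \<gamma> \<phi> p - w p)\<^sup>2)"
    and N: "integrable lebesgue (\<lambda>p. Om4 (pgauge \<gamma> p) * inverse (angle_fn \<gamma> p) * (w p)\<^sup>2)"
    and s: "s > 0"
  shows "(\<integral>p. cd.Bf p * ((pgauge \<gamma> p)\<^sup>2 * Om (pgauge \<gamma> p) * cd.yy p))
    \<le> exp (2 * \<eta>) * (exp (2 * \<alpha> * \<eta>) * (\<integral>p. Om4 (pgauge \<gamma> p) * inverse (angle_fn \<gamma> p) * (w p)\<^sup>2)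
      + 1 / 4 * (\<integral>p. cd.wgt p * (cd.yy p)\<^sup>2)
      + (1 / s * (\<integral>p. (grushin \<gamma> \<phi> p - w p)\<^sup>2) + s / 4 * (\<integral>p. (Gf p)\<^sup>2)))"
    (is "?X \<le> exp (2 * \<eta>) * ?M")
proof -
  let ?r = "pgauge \<gamma> :: ('m, 'k) point \<Rightarrow> real" and ?\<psi> = "angle_fn \<gamma> :: ('m, 'k) point \<Rightarrow> real" and ?g = "grushin \<gamma> \<phi>"
  let ?K = "annulus \<gamma> (r1 * exp (- \<eta>)) r2 :: ('m, 'k) point set"
  let ?F = "\<lambda>p. Om4 (?r p) * inverse (?\<psi> p) * (w p)\<^sup>2"
  have K: "compact ?K"
    by (rule compact_annulus[OF \<gamma>])
  have [measurable]: "(dil \<gamma> \<tau> :: ('m, 'k) point \<Rightarrow> _) \<in> lebesgue \<rightarrow>\<^sub>M lebesgue" for \<tau>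
    by (rule lebesgue_dil(2))
  note [measurable] = borel_measurable_pgauge[OF \<gamma>] borel_measurable_angle[OF \<gamma>]
  have Fnn: "?F p \<ge> 0" for p
    by (simp add: Om4_nonneg angle_nonneg)
  have M: "?M \<ge> 0"
    using s Fnn by (intro add_nonneg_nonneg mult_nonneg_nonneg lint_nonneg)
      (auto simp: Om_nonneg Om4_nonneg angle_nonneg)
  have I: "(\<integral>p. ?g (dil \<gamma> \<tau> p) * Gf p) \<le> ?M" if \<tau>: "\<tau> \<in> {0..\<eta>}" for \<tau>
  proof -
    let ?gd = "\<lambda>p. ?g (dil \<gamma> \<tau> p)" and ?wd = "\<lambda>p. w (dil \<gamma> \<tau> p)"
    \<comment> \<open>The weight is shrunk in advance: at \<open>dil \<gamma> \<tau> p\<close> the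
      function \<open>?F1\<close> has the weight belonging to \<open>p\<close> and the square of the
      dilated \<open>w\<close>.\<close>
    let ?F1 = "\<lambda>p. Om4 (exp (- \<tau>) * ?r p) * inverse (?\<psi> p) * (w p)\<^sup>2"
    have F1_le: "?F1 p \<le> exp (2 * \<alpha> * \<tau>) * ?F p" for p
    proof -
      have "?F1 p \<le> (exp (2 * \<alpha> * \<tau>) * Om4 (?r p)) * inverse (?\<psi> p) * (w p)\<^sup>2"
        using \<tau> by (intro mult_right_mono Om4_shrink pgauge_nonneg) (auto simp: angle_nonneg)
      then show ?thesis by (simp add: mult_ac)
    qed
    have F1nn: "?F1 p \<ge> 0" for p
      by (simp add: Om4_nonneg angle_nonneg)
    have F1i: "integrable lebesgue ?F1"
    proof (rule lint_integrable_bound[OF integrable_mult_right[OF N, of "exp (2 * \<alpha> * \<tau>)"]])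
      show "?F1 \<in> borel_measurable lebesgue"
        unfolding Om4_def by measurable
      show "AE p in lebesgue. norm (?F1 p) \<le> norm (exp (2 * \<alpha> * \<tau>) * ?F p)"
        using F1_le F1nn Fnn by (intro always_eventually allI) (simp add: abs_of_nonneg del: abs_mult)
    qed
    have "(\<integral>p. ?F1 (dil \<gamma> \<tau> p)) \<le> (\<integral>p. ?F1 p)"
      using \<tau> by (intro integral_dil_le[where F="?F1"] \<gamma> borel_measurable_integrable[OF F1i] F1nn) auto
    also have "\<dots> \<le> (\<integral>p. exp (2 * \<alpha> * \<tau>) * ?F p)"
      by (intro integral_mono F1i integrable_mult_right N F1_le)
    also have "\<dots> = exp (2 * \<alpha> * \<tau>) * (\<integral>p. ?F p)"
      by simp
    also have "\<dots> \<le> exp (2 * \<alpha> * \<eta>) * (\<integral>p. ?F p)"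
      using \<tau> \<alpha> Fnn by (intro mult_right_mono lint_nonneg) auto
    finally have 1: "(\<integral>p. ?F1 (dil \<gamma> \<tau> p)) \<le> exp (2 * \<alpha> * \<eta>) * (\<integral>p. ?F p)" .
    have 2: "(\<integral>p. (?gd p - ?wd p)\<^sup>2) \<le> (\<integral>p. (?g p - w p)\<^sup>2)"
      using \<tau> by (intro integral_dil_le[where F="\<lambda>p. (?g p - w p)\<^sup>2"] \<gamma> borel_measurable_integrable[OF gw]) auto
    note i1 = integrable_dil[OF F1i, of \<gamma> \<tau>] and i3 = integrable_dil[OF gw, of \<gamma> \<tau>]
    have i2: "integrable lebesgue (\<lambda>p. cd.wgt p * (cd.yy p)\<^sup>2)"
      using cd.radial_integrable[OF cd.supp_yy cd.supp_yy weight_continuous(1)] by (simp add: power2_eq_square)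
    have i4: "integrable lebesgue (\<lambda>p. (Gf p)\<^sup>2)"
      by (rule cont_supp_square_integrable[OF K supp_Gf])
    have cgd: "cont_supp ?K (\<lambda>p. ?gd p)"
      using \<tau> by (intro cont_supp_compose_dil[OF \<gamma> supp_grushin r1]) auto
    have "(\<integral>p. ?gd p * Gf p) \<le> (\<integral>p. (?F1 (dil \<gamma> \<tau> p)
        + 1 / 4 * (cd.wgt p * (cd.yy p)\<^sup>2))
        + (1 / s * (?gd p - ?wd p)\<^sup>2 + s / 4 * (Gf p)\<^sup>2))"
    proof (intro integral_mono_AE lint_integrable_add integrable_mult_right i1 i2 i3 i4)
      show "integrable lebesgue (\<lambda>p. ?gd p * Gf p)"
        by (rule cont_supp_integrable[OF K cont_supp_mult2[OF cgd supp_Gf]])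
      show "AE p in lebesgue. ?gd p * Gf p \<le> (?F1 (dil \<gamma> \<tau> p)
        + 1 / 4 * (cd.wgt p * (cd.yy p)\<^sup>2))
        + (1 / s * (?gd p - ?wd p)\<^sup>2 + s / 4 * (Gf p)\<^sup>2)"
        using AE_fst_nonzero
      proof eventually_elim
        case (elim p)
        define W y \<psi> where "W = ?wd p" and "y = cd.yy p" and "\<psi> = ?\<psi> p"
        have "p \<noteq> 0" using elim by auto
        then have r: "?r p > 0" using \<gamma> by (simp add: pgauge_pos_iff)
        have \<psi>: "\<psi> > 0" unfolding \<psi>_def by (rule angle_pos[OF \<gamma> elim])
        have young: "a * b \<le> a\<^sup>2 / t + t / 4 * b\<^sup>2" if "t > 0" for a b t :: real
        proof -
          have "0 \<le> (2 * a - t * b)\<^sup>2 / (4 * t)" using that by simp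
          also have "\<dots> = a\<^sup>2 / t - a * b + t / 4 * b\<^sup>2"
            using that by (simp add: power2_eq_square field_simps)
          finally show ?thesis by simp
        qed
        have "W * Gf p = Om (?r p) * (((?r p)\<^sup>2 * W) * y)"
          by (simp add: Gf_def y_def)
        \<comment> \<open>Young with t = \<psi>, which is positive off z = 0.\<close>
        also have "\<dots> \<le> Om (?r p) * (((?r p)\<^sup>2 * W)\<^sup>2 / \<psi> + \<psi> / 4 * y\<^sup>2)"
          by (intro mult_left_mono young \<psi> Om_nonneg)
        also have "\<dots> = (?r p ^ 4 * Om (?r p)) * inverse \<psi> * W\<^sup>2 + 1 / 4 * (Om (?r p) * \<psi> * y\<^sup>2)"
          by (simp add: field_simps power2_eq_square power4_eq_xxxx)
        also have "?r p ^ 4 * Om (?r p) = Om4 (exp (- \<tau>) * ?r (dil \<gamma> \<tau> p))"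
          using Om4_eq[OF r] by (simp add: pgauge_dil[OF \<gamma>] mult.assoc[symmetric] exp_add[symmetric])
        finally have 1: "W * Gf p \<le> ?F1 (dil \<gamma> \<tau> p) + 1 / 4 * (cd.wgt p * (cd.yy p)\<^sup>2)"
          by (simp add: angle_dil[OF \<gamma>] W_def y_def \<psi>_def)
        have 2: "(?gd p - W) * Gf p \<le> 1 / s * (?gd p - W)\<^sup>2 + s / 4 * (Gf p)\<^sup>2"
          using young[OF s, of "?gd p - W" "Gf p"] by simp
        have "?gd p * Gf p = W * Gf p + (?gd p - W) * Gf p"
          by (simp add: algebra_simps)
        also have "\<dots> \<le> (?F1 (dil \<gamma> \<tau> p) + 1 / 4 * (cd.wgt p * (cd.yy p)\<^sup>2))
            + (1 / s * (?gd p - W)\<^sup>2 + s / 4 * (Gf p)\<^sup>2)"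
          using 1 2 by (rule add_mono)
        finally show ?case
          unfolding W_def .
      qed
    qed
    also have "\<dots> = (\<integral>p. ?F1 (dil \<gamma> \<tau> p))
        + 1 / 4 * (\<integral>p. cd.wgt p * (cd.yy p)\<^sup>2)
        + (1 / s * (\<integral>p. (?gd p - ?wd p)\<^sup>2) + s / 4 * (\<integral>p. (Gf p)\<^sup>2))"
      by (simp only: lint_add integral_mult_right_zero i1 i2 i3 i4
          lint_integrable_add integrable_mult_right)
    also have "\<dots> \<le> ?M"
      using 1 2 s by (intro add_mono mult_left_mono order_refl) auto
    finally show ?thesis .
  qed
  \<comment> \<open>By \<open>Bf_eq\<close> the left-hand side is the integral of \<open>H\<close>
    in both variables. The kernel is at most \<open>exp (2 * \<eta>) / \<eta>\<close> and
    \<open>?M\<close> is nonnegative, so integration over an interval of length \<eta> gives the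
    factor \<open>exp (2 * \<eta>)\<close>.\<close>
  define H where "H \<tau> p = exp (2 * \<tau>) / \<eta> * ?g (dil \<gamma> \<tau> p) * Gf p" for \<tau> p
  have H: "continuous_on UNIV (\<lambda>(\<tau>, p). H \<tau> p)"
    unfolding H_def case_prod_beta using \<eta>
    by (intro continuous_intros continuous_dil_compose[OF cont_supp_continuous[OF supp_grushin]]
        continuous_on_compose2[OF cont_supp_continuous[OF supp_Gf, of UNIV]]) auto
  have Hz: "H \<tau> p = 0" if "p \<notin> ?K" for \<tau> p
    using cont_suppD[OF supp_Gf that] by (simp add: H_def)
  note sw = integral_swap_interval[OF K H Hz]
  have "?X = (\<integral>p. integral {0..\<eta>} (\<lambda>\<tau>. H \<tau> p))"
    unfolding Bf_eq dil_avg_def H_def Gf_def[symmetric] by simp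
  also have "\<dots> = integral {0..\<eta>} (\<lambda>\<tau>. \<integral>p. H \<tau> p)"
    by (rule sw(1))
  also have "\<dots> \<le> integral {0..\<eta>} (\<lambda>\<tau>. exp (2 * \<eta>) / \<eta> * ?M)"
  proof (intro integral_le sw(2) integrable_const_ivl)
    fix \<tau> assume \<tau>: "\<tau> \<in> {0..\<eta>}"
    have "(\<integral>p. H \<tau> p) = exp (2 * \<tau>) / \<eta> * (\<integral>p. ?g (dil \<gamma> \<tau> p) * Gf p)"
      unfolding H_def mult.assoc by (rule integral_mult_right_zero)
    also have "\<dots> \<le> exp (2 * \<tau>) / \<eta> * ?M"
      using \<eta> by (intro mult_left_mono I \<tau>) auto
    also have "\<dots> \<le> exp (2 * \<eta>) / \<eta> * ?M"
      using \<eta> \<tau> by (intro mult_right_mono M divide_right_mono) auto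
    finally show "(\<integral>p. H \<tau> p) \<le> exp (2 * \<eta>) / \<eta> * ?M" .
  qed auto
  also have "\<dots> = exp (2 * \<eta>) * ?M"
    using \<eta> by simp
  finally show ?thesis .
qed

end


section \<open>The limit along test functions\<close>

lemma bounded_on_positive_interval:
  fixes w :: "real \<Rightarrow> real"
  assumes "continuous_on {0<..} w" and "0 < r1"
  obtains M where "M \<ge> 0" "\<And>r. r1 \<le> r \<Longrightarrow> r \<le> r2 \<Longrightarrow> \<bar>w r\<bar> \<le> M"
proof -
  have "compact (w ` {r1..r2})"
    using assms by (intro compact_continuous_image continuous_on_subset[OF assms(1)]) auto
  then obtain M where M: "\<forall>x\<in>w ` {r1..r2}. norm x \<le> M"
    using compact_imp_bounded bounded_iff by metis
  show ?thesis
  proof (rule that[of "max M 0"])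
    fix r assume "r1 \<le> r" "r \<le> r2"
    then show "\<bar>w r\<bar> \<le> max M 0"
      using M by (auto simp: le_max_iff_disj)
  qed simp
qed

lemma annulus_weighted_integrable:
  fixes u :: "('m::finite, 'k::finite) point \<Rightarrow> real"
  assumes \<gamma>: "\<gamma> > 0" and r1: "r1 > 0"
    and w: "continuous_on {0<..} w" and [measurable]: "w \<in> borel_measurable borel"
    and [measurable]: "u \<in> borel_measurable lebesgue" and u2: "integrable lebesgue (\<lambda>p. (u p)\<^sup>2)"
    and u0: "AE p in lebesgue. p \<notin> annulus \<gamma> r1 r2 \<longrightarrow> u p = 0"
  shows "integrable lebesgue (\<lambda>p. w (pgauge \<gamma> p) * angle_fn \<gamma> p * (u p)\<^sup>2)"
proof -
  note [measurable] = borel_measurable_pgauge[OF \<gamma>] borel_measurable_angle[OF \<gamma>]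
  obtain M where M: "\<And>r. r1 \<le> r \<Longrightarrow> r \<le> r2 \<Longrightarrow> \<bar>w r\<bar> \<le> M"
    using bounded_on_positive_interval[OF w r1] by blast
  show ?thesis
  proof (rule lint_integrable_bound[OF integrable_mult_right[OF u2, of M]])
    show "AE p in lebesgue. norm (w (pgauge \<gamma> p) * angle_fn \<gamma> p * (u p)\<^sup>2) \<le> norm (M * (u p)\<^sup>2)"
      using u0
    proof eventually_elim
      case (elim p)
      show ?case
      proof (cases "p \<in> annulus \<gamma> r1 r2")
        case True
        then have "\<bar>w (pgauge \<gamma> p)\<bar> \<le> M"
          by (intro M) (auto simp: annulus_def)
        then have "\<bar>w (pgauge \<gamma> p)\<bar> * angle_fn \<gamma> p * (u p)\<^sup>2 \<le> M * 1 * (u p)\<^sup>2"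
          by (intro mult_right_mono mult_mono angle_le_1[OF \<gamma>] angle_nonneg) auto
        then have "\<bar>w (pgauge \<gamma> p) * angle_fn \<gamma> p * (u p)\<^sup>2\<bar> \<le> M * (u p)\<^sup>2"
          by (simp add: abs_mult angle_nonneg)
        then show ?thesis by simp
      qed (use elim in simp)
    qed
  qed measurable
qed

context carleman_weight
begin

lemma weight_measurable [measurable]:
  "Om \<in> borel_measurable borel" "Om4 \<in> borel_measurable borel" "(\<lambda>r::real. r powr \<epsilon>) \<in> borel_measurable borel"
proof -
  show "Om \<in> borel_measurable borel"
    unfolding Om_def[abs_def] by measurable
  show "Om4 \<in> borel_measurable borel"
    unfolding Om4_def[abs_def] by measurable
qed measurable

text \<open>The order of choices is \<delta>, \<open>m\<close>, \<eta>, \<open>B\<close>,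
  \<open>s\<close>, \<open>n\<close>. An average is known to be close to its function only for a
  fixed test function, so the average of \<phi>_n is compared with u through that of \<phi>_m:
  averaging is a contraction for the difference \<phi>_n - \<phi>_m, and \<open>L2_approx\<close>
  treats \<phi>_m.\<close>

lemma carleman_limit:
  fixes \<phi> :: "nat \<Rightarrow> ('m::finite, 'k::finite) point \<Rightarrow> real"
  assumes \<gamma>: "\<gamma> > 0" and r: "0 < r1" "r1 \<le> r2" "r2 \<le> 1"
    and smooth: "\<And>n. C_k 2 (\<phi> n)" and zero: "\<And>n p. p \<notin> annulus \<gamma> r1 r2 \<Longrightarrow> \<phi> n p = 0"
    and lim: "L2_lim \<phi> u" "L2_lim (\<lambda>n. grushin \<gamma> (\<phi> n)) w"
    and N: "integrable lebesgue (\<lambda>p. Om4 (pgauge \<gamma> p) * inverse (angle_fn \<gamma> p) * (w p)\<^sup>2)"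
  shows "(\<integral>p. Om (pgauge \<gamma> p) * ((1 - \<epsilon>)\<^sup>2 / (2 * (ln (2 * r2 / r1))\<^sup>2) * \<alpha>\<^sup>2
        + 2 * \<epsilon>\<^sup>2 * (1 - \<epsilon>)\<^sup>2 * \<alpha> ^ 3 * pgauge \<gamma> p powr \<epsilon>) * angle_fn \<gamma> p * (u p)\<^sup>2)
    \<le> 8 * (\<integral>p. Om4 (pgauge \<gamma> p) * inverse (angle_fn \<gamma> p) * (w p)\<^sup>2)"
proof -
  let ?r = "pgauge \<gamma> :: ('m, 'k) point \<Rightarrow> real" and ?\<psi> = "angle_fn \<gamma> :: ('m, 'k) point \<Rightarrow> real"
  let ?K = "annulus \<gamma> r1 r2 :: ('m, 'k) point set" and ?K' = "annulus \<gamma> (r1 / 2) r2 :: ('m, 'k) point set"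
  let ?d = "\<lambda>n. \<integral>p. (\<phi> n p - u p)\<^sup>2" and ?e = "\<lambda>n. \<integral>p. (grushin \<gamma> (\<phi> n) p - w p)\<^sup>2"
  \<comment> \<open>Averaging may lower the inner radius to r1/2; L is the resulting logarithmic
    width.\<close>
  define L where "L = ln (2 * r2 / r1)"
  have eL: "exp L = 2 * r2 / r1"
    using r by (simp add: L_def)
  have L: "L > 0"
    using r by (simp add: L_def field_simps)
  have K: "compact ?K" and K': "compact ?K'"
    by (rule compact_annulus[OF \<gamma>])+
  have sub: "?K \<subseteq> ?K'"
    using r by (auto simp: annulus_def)
  have da: "dilation_average \<gamma> t r1 r2 (\<phi> n)" if "t > 0" for t n
    by unfold_locales (use \<gamma> r smooth zero that in auto)
  have s\<phi>: "cont_supp ?K (\<phi> n)" and sg: "cont_supp ?K (grushin \<gamma> (\<phi> n))" for n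
    using dilation_average.supp(1)[OF da[of 1 n]] dilation_average.supp_grushin[OF da[of 1 n]] by simp_all
  note U = L2_lim_cont_supp[OF K s\<phi> lim(1)] and W = L2_lim_cont_supp[OF K sg lim(2)]
  have Ksets: "?K \<in> sets lebesgue"
    using K by (simp add: compact_imp_closed borel_closed)
  have u0: "AE p in lebesgue. p \<notin> ?K \<longrightarrow> u p = 0"
    by (rule L2_lim_AE_zero[OF Ksets cont_suppD[OF s\<phi>] U(3,2,4)])
  define \<omega> where "\<omega> r = Om r * ((1 - \<epsilon>)\<^sup>2 / (2 * L\<^sup>2) * \<alpha>\<^sup>2 + 2 * \<epsilon>\<^sup>2 * (1 - \<epsilon>)\<^sup>2 * \<alpha> ^ 3 * r powr \<epsilon>)" for r
  have \<omega>nn: "\<omega> r \<ge> 0" for r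
    using \<alpha> by (simp add: \<omega>_def Om_nonneg)
  have \<omega>c: "continuous_on {0<..} \<omega>"
    unfolding \<omega>_def[abs_def] by (intro continuous_intros weight_continuous) auto
  have \<omega>m: "\<omega> \<in> borel_measurable borel"
    unfolding \<omega>_def[abs_def] by measurable
  obtain M where M: "M \<ge> 0" and M0: "\<And>r. r1 / 2 \<le> r \<Longrightarrow> r \<le> r2 \<Longrightarrow> \<bar>\<omega> r\<bar> \<le> M"
    using bounded_on_positive_interval[OF \<omega>c, of "r1 / 2"] r(1) by (metis half_gt_zero)
  have M1: "\<omega> (?r p) * ?\<psi> p \<le> M" if "p \<in> ?K'" for p
  proof -
    have "\<omega> (?r p) \<le> M"
      using M0[of "?r p"] that by (auto simp: annulus_def)
    then have "\<omega> (?r p) * ?\<psi> p \<le> M * 1"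
      using M by (intro mult_mono angle_le_1[OF \<gamma>] angle_nonneg)
    then show ?thesis by simp
  qed
  define E where "E v = (\<integral>p. \<omega> (?r p) * ?\<psi> p * (v p)\<^sup>2)" for v :: "('m, 'k) point \<Rightarrow> real"
  define NN where "NN = (\<integral>p. Om4 (?r p) * inverse (?\<psi> p) * (w p)\<^sup>2)"
  have NN: "NN \<ge> 0"
    unfolding NN_def by (intro lint_nonneg) (simp add: Om4_nonneg angle_nonneg)
  have iu: "integrable lebesgue (\<lambda>p. \<omega> (?r p) * ?\<psi> p * (u p)\<^sup>2)"
    by (rule annulus_weighted_integrable[OF \<gamma> r(1) \<omega>c \<omega>m U(1,2) u0])
  have key: "E u \<le> 8 * NN + (8 + 36 * M) * \<delta>" if \<delta>: "\<delta> > 0" for \<delta>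
  proof -
    have "\<forall>\<^sub>F n in sequentially. ?d n < \<delta>"
      using U(4) \<delta> by (rule order_tendstoD)
    then obtain m where m: "?d m < \<delta>"
      by (auto simp: eventually_sequentially)
    obtain C where C: "C \<ge> 0" "\<And>t. 0 < t \<Longrightarrow> t \<le> ln 2 \<Longrightarrow>
        (\<integral>p. (dil_avg \<gamma> t (\<lambda>\<tau>. 1 / t) (\<phi> m) p - \<phi> m p)\<^sup>2) \<le> C * t\<^sup>2"
      using dilation_average.L2_approx[OF da[of 1 m]] by auto
    \<comment> \<open>In order, the entries give \<open>exp (2 * \<eta>) \<le> 2\<close>,
      \<open>exp (2 * \<alpha> * \<eta>) \<le> 2\<close>, and, for the last two together,
      \<open>C * \<eta>\<^sup>2 \<le> \<delta>\<close>.\<close>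
    define \<eta> where "\<eta> = min (min (ln 2 / 2) (ln 2 / (2 * \<alpha>))) (min 1 (\<delta> / (C + 1)))"
    have \<eta>: "\<eta> > 0"
      using \<alpha> \<delta> C(1) by (auto simp: \<eta>_def)
    have \<eta>1: "\<eta> \<le> ln 2 / 2"
      unfolding \<eta>_def by (rule min.coboundedI1, rule min.cobounded1)
    have \<eta>2: "\<eta> \<le> ln 2 / (2 * \<alpha>)"
      unfolding \<eta>_def by (rule min.coboundedI1, rule min.cobounded2)
    have \<eta>3: "\<eta> \<le> 1"
      unfolding \<eta>_def by (rule min.coboundedI2, rule min.cobounded1)
    have \<eta>4: "\<eta> \<le> \<delta> / (C + 1)"
      unfolding \<eta>_def by (rule min.coboundedI2, rule min.cobounded2)
    have ln2: "ln 2 > (0::real)" by simp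
    have \<eta>5: "\<eta> \<le> ln 2"
      using \<eta>1 ln2 by linarith
    have e1: "exp (2 * \<eta>) \<le> 2"
    proof -
      have "exp (2 * \<eta>) \<le> exp (ln 2)" using \<eta>1 by (subst exp_le_cancel_iff) simp
      then show ?thesis by simp
    qed
    have e2: "exp (2 * \<alpha> * \<eta>) \<le> 2"
    proof -
      have "exp (2 * \<alpha> * \<eta>) \<le> exp (ln 2)"
        using \<eta>2 \<alpha> by (subst exp_le_cancel_iff) (simp add: field_simps)
      then show ?thesis by simp
    qed
    have e3: "1 / 2 \<le> exp (- \<eta>)"
    proof -
      have "exp \<eta> \<le> exp (ln 2)" using \<eta>5 by (subst exp_le_cancel_iff)
      then show ?thesis by (simp add: exp_minus field_simps)
    qed
    have C\<eta>: "C * \<eta>\<^sup>2 \<le> \<delta>"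
    proof -
      have "C * \<eta>\<^sup>2 \<le> C * \<eta>"
        using C(1) \<eta> \<eta>3 by (intro mult_left_mono) (auto simp: power2_eq_square mult_left_le)
      also have "\<dots> \<le> (C + 1) * \<eta>"
        using \<eta> by simp
      also have "\<dots> \<le> \<delta>"
        using \<eta>4 C(1) by (simp add: field_simps)
      finally show ?thesis .
    qed
    have ca: "carleman_average \<gamma> \<eta> r1 r2 (\<phi> n) \<alpha> \<epsilon>" for n
      by (intro carleman_average.intro da \<eta> carleman_weight_axioms carleman_average_axioms.intro r)
    interpret A0: carleman_average \<gamma> \<eta> r1 r2 "\<phi> 0" \<alpha> \<epsilon>
      by (rule ca)
    \<comment> \<open>This function does not depend on the test function, so \<open>B\<close> can be
      fixed before the index \<open>n\<close>.\<close>
    define hh where "hh = A0.cd.hh"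
    obtain B where B: "\<And>r. r1 * exp (- \<eta>) \<le> r \<Longrightarrow> r \<le> r2 \<Longrightarrow> \<bar>r\<^sup>2 * Om r * bb r\<bar> \<le> B \<and> \<bar>r\<^sup>2 * Om r * hh r\<bar> \<le> B"
    proof -
      have r1': "0 < r1 * exp (- \<eta>)" using r(1) by simp
      have c: "continuous_on {0<..} (\<lambda>r. r\<^sup>2 * Om r * bb r)" "continuous_on {0<..} (\<lambda>r. r\<^sup>2 * Om r * hh r)"
        unfolding hh_def by (intro continuous_intros weight_continuous A0.cd.hh_continuous)+
      obtain B1 where "\<And>r. r1 * exp (- \<eta>) \<le> r \<Longrightarrow> r \<le> r2 \<Longrightarrow> \<bar>r\<^sup>2 * Om r * bb r\<bar> \<le> B1"
        using bounded_on_positive_interval[OF c(1) r1'] by blast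
      moreover obtain B2 where "\<And>r. r1 * exp (- \<eta>) \<le> r \<Longrightarrow> r \<le> r2 \<Longrightarrow> \<bar>r\<^sup>2 * Om r * hh r\<bar> \<le> B2"
        using bounded_on_positive_interval[OF c(2) r1'] by blast
      ultimately show ?thesis
        by (intro that[of "max B1 B2"]) (auto simp: le_max_iff_disj)
    qed
    define G where "G = 8 * B\<^sup>2 / \<eta>\<^sup>2 + 2 * B\<^sup>2"
    define C2 where "C2 = G * (2 + 2 * (\<integral>p. (u p)\<^sup>2))"
    have G: "G \<ge> 0" by (simp add: G_def)
    have C2: "C2 \<ge> 0"
      using G by (auto simp: C2_def intro!: mult_nonneg_nonneg add_nonneg_nonneg lint_nonneg)
    \<comment> \<open>\<open>C2\<close> will bound the squared L^2 norm of the multiplier, hence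
      \<open>s / 4 * C2 \<le> \<delta>\<close>; afterwards \<open>n\<close> makes the squared error
      less than \<open>s * \<delta>\<close>.\<close>
    define s where "s = \<delta> / (C2 + 1)"
    have s: "s > 0" using C2 \<delta> by (simp add: s_def)
    have sC: "s / 4 * C2 \<le> \<delta>"
    proof -
      have "s / 4 * C2 \<le> s * (C2 + 1)" using s C2 by (simp add: field_simps)
      then show ?thesis using C2 by (simp add: s_def)
    qed
    have "\<forall>\<^sub>F n in sequentially. ?d n < min \<delta> 1"
      using U(4) \<delta> by (intro order_tendstoD(2)) auto
    moreover have "\<forall>\<^sub>F n in sequentially. ?e n < s * \<delta>"
      using W(4) s \<delta> by (intro order_tendstoD(2)) auto
    ultimately have "\<forall>\<^sub>F n in sequentially. ?d n < min \<delta> 1 \<and>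
        ?e n < s * \<delta>"
      by (rule eventually_conj)
    then obtain n where n: "?d n < \<delta>" "?d n < 1"
        "?e n < s * \<delta>"
      by (auto simp: eventually_sequentially)
    interpret A: carleman_average \<gamma> \<eta> r1 r2 "\<phi> n" \<alpha> \<epsilon>
      by (rule ca)
    let ?f = "A.f" and ?fm = "dil_avg \<gamma> \<eta> (\<lambda>\<tau>. 1 / \<eta>) (\<phi> m)"
    define Y where "Y = (\<integral>p. Om (?r p) * ?\<psi> p * (A.cd.yy p)\<^sup>2)"
    have Y: "Y \<ge> 0"
      unfolding Y_def by (intro lint_nonneg) (simp add: Om_nonneg angle_nonneg)
    have Gf: "(\<integral>p. (A.Gf p)\<^sup>2) \<le> C2"
    proof -
      have "(\<integral>p. (A.Gf p)\<^sup>2) \<le> G * (\<integral>p. (\<phi> n p)\<^sup>2)"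
        unfolding G_def by (rule A.Gf_L2) (use B in \<open>simp add: hh_def\<close>)
      also have "(\<integral>p. (\<phi> n p)\<^sup>2) \<le> (\<integral>p. 2 * (\<phi> n p - u p)\<^sup>2 + 2 * (u p)\<^sup>2)"
      proof (intro integral_mono cont_supp_square_integrable[OF K s\<phi>] lint_integrable_add integrable_mult_right U)
        show "(\<phi> n p)\<^sup>2 \<le> 2 * (\<phi> n p - u p)\<^sup>2 + 2 * (u p)\<^sup>2" for p
          using square_add_le[of "\<phi> n p - u p" "u p"] by simp
      qed
      also have "\<dots> = 2 * ?d n + 2 * (\<integral>p. (u p)\<^sup>2)"
        using U(2) U(3)[of n] by simp
      also have "\<dots> \<le> 2 + 2 * (\<integral>p. (u p)\<^sup>2)"
        using n(2) by simp
      finally show ?thesis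
        using G by (simp add: C2_def mult_left_mono)
    qed
    \<comment> \<open>Doubling \<open>1 / 4 * Y\<close> gives exactly the \<open>1 / 2 * Y\<close>
      on the left of \<open>carleman_lower\<close>, so y cancels.\<close>
    have Ef: "E ?f \<le> 4 * NN + 4 * \<delta>"
    proof -
      have r2e: "r2 \<le> r1 * exp (- \<eta>) * exp L"
      proof -
        have "r2 = r1 * (1 / 2) * exp L"
          unfolding eL using r by simp
        also have "\<dots> \<le> r1 * exp (- \<eta>) * exp L"
          using r e3 by (intro mult_right_mono mult_left_mono) auto
        finally show ?thesis .
      qed
      have "1 / 2 * Y + E ?f \<le> (\<integral>p. A.cd.Bf p * ((?r p)\<^sup>2 * Om (?r p) * A.cd.yy p))"
      proof -
        have "E ?f = (\<integral>p. Om (?r p) * ?\<psi> p * (((1 - \<epsilon>)\<^sup>2 / (2 * L\<^sup>2) * \<alpha>\<^sup>2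
          + 2 * \<epsilon>\<^sup>2 * (1 - \<epsilon>)\<^sup>2 * \<alpha> ^ 3 * ?r p powr \<epsilon>) * (?f p)\<^sup>2))"
          unfolding E_def \<omega>_def by (rule lint_cong[OF refl]) (simp only: mult_ac)
        then show ?thesis
          using A.cd.carleman_lower[of "r1 * exp (- \<eta>)" L] r(1) L r2e unfolding Y_def
          by (auto simp: annulus_def)
      qed
      also have "\<dots> \<le> exp (2 * \<eta>) * (exp (2 * \<alpha> * \<eta>) * NN + 1 / 4 * Y
          + (1 / s * ?e n + s / 4 * (\<integral>p. (A.Gf p)\<^sup>2)))"
        unfolding NN_def Y_def by (rule A.carleman_upper[OF W(1) W(3) N s])
      also have "\<dots> \<le> exp (2 * \<eta>) * (2 * NN + 1 / 4 * Y + (\<delta> + \<delta>))"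
      proof -
        have a1: "exp (2 * \<alpha> * \<eta>) * NN \<le> 2 * NN"
          using e2 NN by (intro mult_right_mono)
        have a2: "1 / s * ?e n \<le> \<delta>"
          using n(3) s by (simp add: field_simps)
        have a3: "s / 4 * (\<integral>p. (A.Gf p)\<^sup>2) \<le> \<delta>"
          using mult_left_mono[OF Gf, of "s / 4"] s sC by linarith
        show ?thesis
          using a1 a2 a3 by (intro mult_left_mono) auto
      qed
      also have "\<dots> \<le> 2 * (2 * NN + 1 / 4 * Y + (\<delta> + \<delta>))"
        using e1 NN Y \<delta> by (intro mult_right_mono) auto
      finally show ?thesis by simp
    qed
    have sd: "annulus \<gamma> (r1 * exp (- \<eta>)) r2 \<subseteq> ?K'"
    proof -
      have "r1 / 2 \<le> r1 * exp (- \<eta>)"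
        using r(1) mult_left_mono[OF e3, of r1] by simp
      then show ?thesis by (auto simp: annulus_def)
    qed
    have sfm: "cont_supp ?K' ?fm"
      by (intro cont_supp_mono[OF cont_supp_dil_avg[OF \<gamma> s\<phi> r(1)] sd] continuous_intros) (use \<eta> in auto)
    have sf: "cont_supp ?K' ?f"
      by (rule cont_supp_mono[OF A.cd.supp(1) sd])
    have sm: "cont_supp ?K' (\<phi> m)"
      by (rule cont_supp_mono[OF s\<phi> sub])
    have d1: "(\<integral>p. (?f p - ?fm p)\<^sup>2) \<le> 4 * \<delta>"
    proof -
      have "(\<integral>p. (?f p - ?fm p)\<^sup>2) = (\<integral>p. (dil_avg \<gamma> \<eta> (\<lambda>\<tau>. 1 / \<eta>) (\<lambda>p. \<phi> n p - \<phi> m p) p)\<^sup>2)"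
        unfolding A.f_def dil_avg_diff[OF \<gamma> \<eta> r(1) cont_supp_continuous[OF s\<phi>] cont_supp_continuous[OF s\<phi>]] ..
      also have "\<dots> \<le> (\<integral>p. (\<phi> n p - \<phi> m p)\<^sup>2)"
        by (rule dil_avg_L2_bound[OF \<gamma> \<eta> r(1) cont_supp_diff[OF s\<phi> s\<phi>]])
      also have "\<dots> \<le> (\<integral>p. 2 * (\<phi> n p - u p)\<^sup>2 + 2 * (\<phi> m p - u p)\<^sup>2)"
      proof (intro integral_mono cont_supp_square_integrable[OF K cont_supp_diff[OF s\<phi> s\<phi>]]
          lint_integrable_add integrable_mult_right U)
        show "(\<phi> n p - \<phi> m p)\<^sup>2 \<le> 2 * (\<phi> n p - u p)\<^sup>2 + 2 * (\<phi> m p - u p)\<^sup>2" for p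
          using square_add_le[of "\<phi> n p - u p" "- (\<phi> m p - u p)"] by (simp only: power2_minus) simp
      qed
      also have "\<dots> = 2 * ?d n + 2 * ?d m"
        using U(3)[of n] U(3)[of m] by simp
      finally show ?thesis using m n(1) by linarith
    qed
    have d2: "(\<integral>p. (?fm p - \<phi> m p)\<^sup>2) \<le> \<delta>"
      using C(2)[OF \<eta> \<eta>5] C\<eta> by linarith
    have i1: "integrable lebesgue (\<lambda>p. (?f p - ?fm p)\<^sup>2)" and i2: "integrable lebesgue (\<lambda>p. (?fm p - \<phi> m p)\<^sup>2)"
      by (intro cont_supp_square_integrable[OF K'] cont_supp_diff sf sfm sm)+
    have iE: "integrable lebesgue (\<lambda>p. \<omega> (?r p) * ?\<psi> p * (?f p)\<^sup>2)"
      using A.cd.radial_integrable[OF A.cd.supp(1) A.cd.supp(1) \<omega>c] by (simp only: power2_eq_square)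
    \<comment> \<open>The factor 6 is 2 times 3: one split off from \<open>?f\<close>, and a sum of
      three squares. \<open>M\<close> bounds the weight where the difference lives.\<close>
    have "E u \<le> (\<integral>p. 2 * (\<omega> (?r p) * ?\<psi> p * (?f p)\<^sup>2)
        + 6 * M * ((?f p - ?fm p)\<^sup>2 + (?fm p - \<phi> m p)\<^sup>2 + (\<phi> m p - u p)\<^sup>2))"
      unfolding E_def
    proof (intro integral_mono_AE iu lint_integrable_add integrable_mult_right iE i1 i2 U)
      show "AE p in lebesgue. \<omega> (?r p) * ?\<psi> p * (u p)\<^sup>2 \<le> 2 * (\<omega> (?r p) * ?\<psi> p * (?f p)\<^sup>2)
        + 6 * M * ((?f p - ?fm p)\<^sup>2 + (?fm p - \<phi> m p)\<^sup>2 + (\<phi> m p - u p)\<^sup>2)"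
        using u0
      proof eventually_elim
        case (elim p)
        let ?o = "\<omega> (?r p) * ?\<psi> p"
        have onn: "?o \<ge> 0" by (simp add: \<omega>nn angle_nonneg)
        let ?a = "?f p - ?fm p" and ?b = "?fm p - \<phi> m p" and ?c = "\<phi> m p - u p"
        show ?case
        proof (cases "p \<in> ?K'")
          case True
          have "(?f p - u p)\<^sup>2 = (?a + ?b + ?c)\<^sup>2" by simp
          also have "\<dots> \<le> 3 * (?a\<^sup>2 + ?b\<^sup>2 + ?c\<^sup>2)"
          proof -
            have "0 \<le> (x - y)\<^sup>2 + (y - z)\<^sup>2 + (x - z)\<^sup>2" for x y z :: real by simp
            then have "(x + y + z)\<^sup>2 \<le> 3 * (x\<^sup>2 + y\<^sup>2 + z\<^sup>2)" for x y z :: real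
              by (simp add: power2_eq_square algebra_simps)
            then show ?thesis .
          qed
          finally have "(u p)\<^sup>2 \<le> 2 * (?f p)\<^sup>2 + 2 * (3 * (?a\<^sup>2 + ?b\<^sup>2 + ?c\<^sup>2))"
            using square_add_le[of "?f p" "- (?f p - u p)"] by (simp only: power2_minus) simp
          then have "?o * (u p)\<^sup>2 \<le> ?o * (2 * (?f p)\<^sup>2 + 2 * (3 * (?a\<^sup>2 + ?b\<^sup>2 + ?c\<^sup>2)))"
            using onn by (rule mult_left_mono)
          also have "\<dots> = 2 * (?o * (?f p)\<^sup>2) + ?o * (6 * (?a\<^sup>2 + ?b\<^sup>2 + ?c\<^sup>2))"
            by (simp add: distrib_left)
          also have "\<dots> \<le> 2 * (?o * (?f p)\<^sup>2) + M * (6 * (?a\<^sup>2 + ?b\<^sup>2 + ?c\<^sup>2))"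
            using M1[OF True] by (intro add_left_mono mult_right_mono) auto
          finally show ?thesis by (simp add: mult_ac)
        next
          case False
          then have "u p = 0" using elim sub by auto
          then show ?thesis using onn M by auto
        qed
      qed
    qed
    also have "\<dots> = 2 * E ?f + 6 * M * ((\<integral>p. (?f p - ?fm p)\<^sup>2)
        + (\<integral>p. (?fm p - \<phi> m p)\<^sup>2) + ?d m)"
      unfolding E_def by (simp only: lint_add integral_mult_right_zero
          lint_integrable_add integrable_mult_right iE i1 i2 U(3))
    also have "\<dots> \<le> 2 * (4 * NN + 4 * \<delta>) + 6 * M * (4 * \<delta> + \<delta> + \<delta>)"
      using Ef d1 d2 m M by (intro add_mono mult_left_mono) auto
    finally show ?thesis by (simp add: algebra_simps)
  qed
  have "E u \<le> 8 * NN"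
  proof (rule field_le_epsilon)
    fix e :: real assume e: "e > 0"
    have pos: "8 + 36 * M > 0" using M by simp
    have "E u \<le> 8 * NN + (8 + 36 * M) * (e / (8 + 36 * M))"
      using e pos by (intro key) simp
    then show "E u \<le> 8 * NN + e"
      using pos by simp
  qed
  then show ?thesis
    unfolding E_def \<omega>_def NN_def L_def .
qed

end

section \<open>Absorption of the potential and choice of the constants\<close>

lemma C0_infinity_annulus:
  fixes \<phi> :: "('m::finite, 'k::finite) point \<Rightarrow> real"
  assumes \<gamma>: "\<gamma> > 0" and \<phi>: "\<phi> \<in> C0_infinity (pball \<gamma> R - pball \<gamma> r1)"
  obtains r2 where "r2 < R" "\<And>p. p \<notin> annulus \<gamma> r1 r2 \<Longrightarrow> \<phi> p = 0"
proof -
  let ?S = "closure {p. \<phi> p \<noteq> 0}"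
  have S: "compact ?S" "?S \<subseteq> pball \<gamma> R - pball \<gamma> r1"
    using \<phi> by (auto simp: C0_infinity_def)
  have in_S: "p \<in> ?S" if "\<phi> p \<noteq> 0" for p
    using closure_subset[of "{p. \<phi> p \<noteq> 0}"] that by blast
  show ?thesis
  proof (cases "?S = {}")
    case True
    then have "\<phi> p = 0" for p
      using in_S[of p] by blast
    then show ?thesis
      by (intro that[of "R - 1"]) auto
  next
    case False
    \<comment> \<open>The gauge attains its maximum on the compact support, which lies in the open
      ball; hence a radius strictly below R.\<close>
    obtain p0 where p0: "p0 \<in> ?S" "\<And>p. p \<in> ?S \<Longrightarrow> pgauge \<gamma> p \<le> pgauge \<gamma> p0"
      using continuous_attains_sup[OF S(1) False continuous_pgauge[OF \<gamma>]] by blast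
    show ?thesis
    proof (rule that[of "pgauge \<gamma> p0"])
      show "pgauge \<gamma> p0 < R"
        using S(2) p0(1) by (auto simp: pball_def)
      fix p :: "('m, 'k) point" assume p: "p \<notin> annulus \<gamma> r1 (pgauge \<gamma> p0)"
      show "\<phi> p = 0"
      proof (rule ccontr)
        assume "\<phi> p \<noteq> 0"
        then have "p \<in> ?S" by (rule in_S)
        then have "r1 \<le> pgauge \<gamma> p" "pgauge \<gamma> p \<le> pgauge \<gamma> p0"
          using S(2) p0(2) by (auto simp: pball_def not_less)
        with p show False by (simp add: annulus_def)
      qed
    qed
  qed
qed

lemma C0_infinity_grushin_zero:
  fixes \<phi> :: "('m::finite, 'k::finite) point \<Rightarrow> real"
  assumes \<gamma>: "\<gamma> > 0" and r1: "r1 > 0" and \<phi>: "\<phi> \<in> C0_infinity (pball \<gamma> R - pball \<gamma> r1)"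
    and p: "p \<notin> pball \<gamma> R - pball \<gamma> r1"
  shows "\<phi> p = 0" "grushin \<gamma> \<phi> p = 0"
proof -
  obtain r2 where r2: "r2 < R" "\<And>p. p \<notin> annulus \<gamma> r1 r2 \<Longrightarrow> \<phi> p = 0"
    using C0_infinity_annulus[OF \<gamma> \<phi>] by blast
  have pA: "p \<notin> annulus \<gamma> r1 r2"
    using p r2(1) by (auto simp: annulus_def pball_def)
  interpret dilation_average \<gamma> 1 r1 r2 \<phi>
    by unfold_locales (use \<gamma> r1 \<phi> r2(2) in \<open>auto simp: C0_infinity_def simp del: C_k.simps\<close>)
  show "\<phi> p = 0" "grushin \<gamma> \<phi> p = 0"
    using cont_suppD[OF supp(1) pA] cont_suppD[OF supp_grushin pA] by auto
qed

text \<open>\<open>carleman_limit\<close> bounds the left-hand side by the norm of \<open>w\<close>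
  alone. Writing \<open>w\<close> as the full expression minus V u leaves K^2 \<psi> u^2, since
  V^2/\<psi> is at most K^2 \<psi>; under \<open>large\<close> half of the \<alpha>^3 term absorbs
  it.\<close>

lemma (in carleman_weight) carleman_estimate:
  fixes u w V :: "('m::finite, 'k::finite) point \<Rightarrow> real"
  assumes \<gamma>: "\<gamma> > 0" and R: "0 < R" "R \<le> 1" and a: "0 < a" "a < 1" and Kn: "0 \<le> Kc"
    and gr: "has_grushin \<gamma> (pball \<gamma> R - pball \<gamma> (a * R)) u w"
    and V: "set_borel_measurable lebesgue (pball \<gamma> R) V"
      "AE p in lebesgue. p \<in> pball \<gamma> R \<longrightarrow> \<bar>V p\<bar> \<le> Kc * angle_fn \<gamma> p"
    and large: "16 * Kc\<^sup>2 \<le> \<epsilon>\<^sup>2 * (1 - \<epsilon>)\<^sup>2 * \<alpha> ^ 3"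
  defines "\<kappa> \<equiv> min (\<epsilon>\<^sup>2 * (1 - \<epsilon>)\<^sup>2) ((1 - \<epsilon>)\<^sup>2 / (2 * (ln (2 / a))\<^sup>2))"
  shows "ennreal (\<alpha> ^ 3) *
      (\<integral>\<^sup>+ p\<in>pball \<gamma> R. ennreal (pgauge \<gamma> p powr (- 2 * \<alpha> - 4 + \<epsilon>) * (u p)\<^sup>2
         * exp (2 * \<alpha> * pgauge \<gamma> p powr \<epsilon>) * angle_fn \<gamma> p) \<partial>lebesgue)
    + ennreal (\<alpha>\<^sup>2) *
      (\<integral>\<^sup>+ p\<in>pball \<gamma> R. ennreal (pgauge \<gamma> p powr (- 2 * \<alpha> - 4) * (u p)\<^sup>2
         * exp (2 * \<alpha> * pgauge \<gamma> p powr \<epsilon>) * angle_fn \<gamma> p) \<partial>lebesgue)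
    \<le> ennreal (16 / \<kappa>) *
      (\<integral>\<^sup>+ p\<in>pball \<gamma> R. ennreal (pgauge \<gamma> p powr (- 2 * \<alpha>)
         * exp (2 * \<alpha> * pgauge \<gamma> p powr \<epsilon>) * (w p + V p * u p)\<^sup>2
         * inverse (angle_fn \<gamma> p)) \<partial>lebesgue)"
    (is "_ * ?L3 + _ * ?L2 \<le> _ * ?N")
proof -
  let ?r = "pgauge \<gamma> :: ('m, 'k) point \<Rightarrow> real" and ?\<psi> = "angle_fn \<gamma> :: ('m, 'k) point \<Rightarrow> real"
  let ?S = "pball \<gamma> R - pball \<gamma> (a * R) :: ('m, 'k) point set"
  define r1 where "r1 = a * R"
  have r1: "0 < r1" "r1 \<le> R"
    using R a by (auto simp: r1_def mult_left_le_one_le)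
  have ln_a: "ln (2 / a) > 0"
    using a by (simp add: ln_gt_zero)
  have \<kappa>: "\<kappa> > 0"
    using \<epsilon> ln_a by (simp add: \<kappa>_def)
  obtain \<phi> where \<phi>: "S22_approx \<gamma> ?S \<phi> u" "L2_lim (\<lambda>n. grushin \<gamma> (\<phi> n)) w"
    using gr by (auto simp: has_grushin_def)
  have C0: "\<phi> n \<in> C0_infinity (pball \<gamma> R - pball \<gamma> r1)" for n
    using \<phi>(1) by (auto simp: S22_approx_def S22_test_def r1_def)
  have lim: "L2_lim \<phi> u"
    using \<phi>(1) by (simp add: S22_approx_def)
  have smooth: "C_k 2 (\<phi> n)" for n
    using C0[of n] by (simp add: C0_infinity_def del: C_k.simps)
  note zero = C0_infinity_grushin_zero[OF \<gamma> r1(1) C0, folded r1_def]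
  let ?K = "annulus \<gamma> r1 R :: ('m, 'k) point set"
  have SK: "pball \<gamma> R - pball \<gamma> r1 \<subseteq> ?K"
    by (auto simp: annulus_def pball_def)
  have zeroK: "\<phi> n p = 0" if "p \<notin> ?K" for n p
    using zero(1)[of p n] SK that by blast
  have K: "compact ?K"
    by (rule compact_annulus[OF \<gamma>])
  have da: "dilation_average \<gamma> 1 r1 R (\<phi> n)" for n
    by unfold_locales (use \<gamma> r1 smooth zeroK in auto)
  have s\<phi>: "cont_supp ?K (\<phi> n)" and sg: "cont_supp ?K (grushin \<gamma> (\<phi> n))" for n
    using dilation_average.supp(1)[OF da] dilation_average.supp_grushin[OF da] by auto
  note U = L2_lim_cont_supp[OF K s\<phi> lim] and W = L2_lim_cont_supp[OF K sg \<phi>(2)]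
  note [measurable] = borel_measurable_pgauge[OF \<gamma>] borel_measurable_angle[OF \<gamma>] U(1) W(1)
  have [measurable]: "pball \<gamma> r \<in> sets (lebesgue :: ('m, 'k) point measure)" for r
  proof -
    have "open (pball \<gamma> r :: ('m, 'k) point set)"
      unfolding pball_def by (intro open_Collect_less continuous_pgauge[OF \<gamma>] continuous_intros)
    then show ?thesis
      by (simp add: borel_open)
  qed
  let ?S' = "pball \<gamma> R - pball \<gamma> r1 :: ('m, 'k) point set"
  have S': "?S' \<in> sets lebesgue"
    by measurable
  have u0: "AE p in lebesgue. p \<notin> ?S' \<longrightarrow> u p = 0"
    by (rule L2_lim_AE_zero[OF S' zero(1) U(3,2,4)])
  have w0: "AE p in lebesgue. p \<notin> ?S' \<longrightarrow> w p = 0"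
    by (rule L2_lim_AE_zero[OF S' zero(2) W(3,2,4)])
  have u0K: "AE p in lebesgue. p \<notin> ?K \<longrightarrow> u p = 0"
    using u0 by eventually_elim (use SK in auto)
  let ?f3 = "\<lambda>p. Om (?r p) * ?r p powr \<epsilon> * ?\<psi> p * (u p)\<^sup>2"
    and ?f2 = "\<lambda>p. Om (?r p) * ?\<psi> p * (u p)\<^sup>2"
  define A3 where "A3 = (\<integral>p. ?f3 p)"
  define A2 where "A2 = (\<integral>p. ?f2 p)"
  have c3: "continuous_on {0<..} (\<lambda>r. Om r * r powr \<epsilon>)"
    by (intro continuous_intros weight_continuous) auto
  have m3: "(\<lambda>r. Om r * r powr \<epsilon>) \<in> borel_measurable borel"
    by measurable
  have i3: "integrable lebesgue (\<lambda>p. ?f3 p)"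
    using annulus_weighted_integrable[OF \<gamma> r1(1) c3 m3 U(1,2) u0K] .
  have i2: "integrable lebesgue (\<lambda>p. ?f2 p)"
    by (rule annulus_weighted_integrable[OF \<gamma> r1(1) weight_continuous(1) weight_measurable(1) U(1,2) u0K])
  have A: "A3 \<ge> 0" "A2 \<ge> 0"
    unfolding A3_def A2_def
    by (intro lint_nonneg; simp add: Om_nonneg angle_nonneg)+
  have L3: "?L3 \<le> ennreal A3"
  proof -
    have "?L3 \<le> (\<integral>\<^sup>+ p. ennreal (?f3 p) \<partial>lebesgue)"
      by (intro nn_integral_mono) (auto simp: indicator_def Om_def powr_add mult_ac intro!: ennreal_leI)
    also have "\<dots> = ennreal A3"
      unfolding A3_def by (intro nn_integral_eq_integral i3) (simp add: Om_nonneg angle_nonneg)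
    finally show ?thesis .
  qed
  have L2: "?L2 \<le> ennreal A2"
  proof -
    have "?L2 \<le> (\<integral>\<^sup>+ p. ennreal (?f2 p) \<partial>lebesgue)"
      by (intro nn_integral_mono) (auto simp: indicator_def Om_def mult_ac intro!: ennreal_leI)
    also have "\<dots> = ennreal A2"
      unfolding A2_def by (intro nn_integral_eq_integral i2) (simp add: Om_nonneg angle_nonneg)
    finally show ?thesis .
  qed
  show ?thesis
  proof (cases "?N = \<infinity>")
    case True
    then show ?thesis
      using \<kappa> by (simp add: ennreal_mult_top)
  next
    case False
    \<comment> \<open>\<open>V\<close> is measurable on the ball only, so it is extended by
      zero.\<close>
    define V' where "V' p = indicator (pball \<gamma> R) p * V p" for p
    have [measurable]: "V' \<in> borel_measurable lebesgue"
      using V(1) by (simp add: set_borel_measurable_def V'_def[abs_def])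
    define h where "h p = indicator (pball \<gamma> R) p * (w p + V' p * u p)" for p
    let ?FV = "\<lambda>p. Om4 (?r p) * inverse (?\<psi> p) * (h p)\<^sup>2"
    let ?F = "\<lambda>p. Om4 (?r p) * inverse (?\<psi> p) * (w p)\<^sup>2"
    have [measurable]: "h \<in> borel_measurable lebesgue"
      unfolding h_def[abs_def] by measurable
    have FVnn: "?FV p \<ge> 0" and Fnn: "?F p \<ge> 0" for p
      by (simp_all add: Om4_nonneg angle_nonneg)
    have N_eq: "?N = (\<integral>\<^sup>+ p. ennreal (?FV p) \<partial>lebesgue)"
      by (intro nn_integral_cong) (auto simp: indicator_def h_def V'_def Om4_def mult_ac)
    have FVi: "integrable lebesgue ?FV"
      using False unfolding N_eq by (intro integrableI_nonneg) (auto simp: FVnn less_top)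
    define NV where "NV = (\<integral>p. ?FV p)"
    have NV: "?N = ennreal NV" "NV \<ge> 0"
      unfolding N_eq NV_def
      by (intro nn_integral_eq_integral FVi) (auto simp: FVnn intro!: lint_nonneg)
    have bound: "AE p in lebesgue. ?F p \<le> 2 * ?FV p + 2 * Kc\<^sup>2 * ?f3 p"
      using AE_fst_nonzero w0 V(2)
    proof eventually_elim
      case (elim p)
      define \<psi> where "\<psi> = ?\<psi> p"
      show ?case
      proof (cases "p \<in> ?S'")
        case False
        then have "w p = 0" using elim by simp
        then show ?thesis
          using FVnn[of p] by (simp add: Om_nonneg angle_nonneg)
      next
        case True
        have "p \<noteq> 0" using elim by auto
        then have r: "?r p > 0" using \<gamma> by (simp add: pgauge_pos_iff)
        have rR: "?r p \<le> 1" using True R by (auto simp: pball_def)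
        have \<psi>: "\<psi> > 0" unfolding \<psi>_def by (rule angle_pos[OF \<gamma> elim(1)])
        have pR: "p \<in> pball \<gamma> R" using True by simp
        have h: "h p = w p + V p * u p" using pR by (simp add: h_def V'_def)
        have V2: "(V p)\<^sup>2 \<le> Kc\<^sup>2 * \<psi>\<^sup>2"
          using power_mono[of "\<bar>V p\<bar>" "Kc * \<psi>" 2] elim(3) pR by (simp add: \<psi>_def power_mult_distrib)
        \<comment> \<open>For \<rho> at most 1 the factor \<rho>^4 is below \<rho> to the power
          \<epsilon>, the weight of the \<alpha>^3 term.\<close>
        have O4: "Om4 (?r p) \<le> Om (?r p) * ?r p powr \<epsilon>"
        proof -
          have "?r p ^ 4 = ?r p powr 4" using r by (simp add: powr_numeral)
          also have "\<dots> \<le> ?r p powr \<epsilon>"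
            using r rR \<epsilon> by (intro powr_mono') auto
          finally have "?r p ^ 4 * Om (?r p) \<le> ?r p powr \<epsilon> * Om (?r p)"
            using Om_nonneg by (rule mult_right_mono)
          then show ?thesis
            by (simp add: Om4_eq[OF r] mult.commute)
        qed
        have "(w p)\<^sup>2 \<le> 2 * (h p)\<^sup>2 + 2 * ((V p)\<^sup>2 * (u p)\<^sup>2)"
          using square_add_le[of "h p" "- (V p * u p)"] by (simp add: h power_mult_distrib)
        also have "\<dots> \<le> 2 * (h p)\<^sup>2 + 2 * (Kc\<^sup>2 * \<psi>\<^sup>2 * (u p)\<^sup>2)"
          using V2 by (intro add_left_mono mult_left_mono mult_right_mono) auto
        finally have "?F p \<le> Om4 (?r p) * inverse \<psi> * (2 * (h p)\<^sup>2 + 2 * (Kc\<^sup>2 * \<psi>\<^sup>2 * (u p)\<^sup>2))"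
          unfolding \<psi>_def[symmetric] using \<psi> by (intro mult_left_mono) (auto simp: Om4_nonneg)
        also have "\<dots> = 2 * ?FV p + 2 * Kc\<^sup>2 * (Om4 (?r p) * (\<psi> * (u p)\<^sup>2))"
          unfolding \<psi>_def[symmetric] using \<psi> by (simp add: field_simps power2_eq_square)
        also have "\<dots> \<le> 2 * ?FV p + 2 * Kc\<^sup>2 * ((Om (?r p) * ?r p powr \<epsilon>) * (\<psi> * (u p)\<^sup>2))"
          using O4 \<psi> by (intro add_left_mono mult_left_mono mult_right_mono) auto
        finally show ?thesis
          by (simp add: \<psi>_def mult.assoc)
      qed
    qed
    have iB: "integrable lebesgue (\<lambda>p. 2 * ?FV p + 2 * Kc\<^sup>2 * ?f3 p)"
      by (intro lint_integrable_add integrable_mult_right FVi i3)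
    have Fi: "integrable lebesgue ?F"
    proof (rule lint_integrable_bound[OF iB])
      show "?F \<in> borel_measurable lebesgue"
        by measurable
      show "AE p in lebesgue. norm (?F p) \<le> norm (2 * ?FV p + 2 * Kc\<^sup>2 * ?f3 p)"
        using bound by eventually_elim (use Fnn in \<open>simp add: abs_of_nonneg order_trans[OF Fnn] del: abs_mult\<close>)
    qed
    have "(\<integral>p. ?F p) \<le> (\<integral>p. 2 * ?FV p + 2 * Kc\<^sup>2 * ?f3 p)"
      by (intro integral_mono_AE Fi iB bound)
    also have "\<dots> = 2 * NV + 2 * Kc\<^sup>2 * A3"
      unfolding NV_def A3_def by (simp only: lint_add integral_mult_right_zero
          integrable_mult_right FVi i3)
    finally have NF: "(\<integral>p. ?F p) \<le> 2 * NV + 2 * Kc\<^sup>2 * A3" .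
    let ?c2 = "(1 - \<epsilon>)\<^sup>2 / (2 * (ln (2 / a))\<^sup>2)" and ?c3 = "\<epsilon>\<^sup>2 * (1 - \<epsilon>)\<^sup>2"
    \<comment> \<open>The logarithmic width depends on a alone, so the constant is uniform in
      R.\<close>
    have ra: "2 * R / r1 = 2 / a"
      using R by (simp add: r1_def)
    have "?c2 * \<alpha>\<^sup>2 * A2 + 2 * ?c3 * \<alpha> ^ 3 * A3
      = (\<integral>p. ?c2 * \<alpha>\<^sup>2 * ?f2 p
          + 2 * ?c3 * \<alpha> ^ 3 * ?f3 p)"
      unfolding A2_def A3_def by (simp only: lint_add integral_mult_right_zero
          integrable_mult_right i2 i3)
    also have "\<dots> = (\<integral>p. Om (?r p) * (?c2 * \<alpha>\<^sup>2 + 2 * \<epsilon>\<^sup>2 * (1 - \<epsilon>)\<^sup>2 * \<alpha> ^ 3 * ?r p powr \<epsilon>)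
          * ?\<psi> p * (u p)\<^sup>2)"
      by (rule lint_cong[OF refl]) (simp only: distrib_left distrib_right mult_ac)
    also have "\<dots> \<le> 8 * (\<integral>p. ?F p)"
      using carleman_limit[OF \<gamma> r1 R(2) smooth zeroK lim \<phi>(2) Fi] unfolding ra .
    also have "\<dots> \<le> 16 * NV + 16 * Kc\<^sup>2 * A3"
      using NF by linarith
    \<comment> \<open>Here \<open>16 * Kc\<^sup>2\<close> is at most one half of the coefficient
      \<open>2 * ?c3 * \<alpha> ^ 3\<close> on the left; the other half survives.\<close>
    also have "\<dots> \<le> 16 * NV + ?c3 * \<alpha> ^ 3 * A3"
      using large A by (intro add_left_mono mult_right_mono)
    finally have main: "?c2 * (\<alpha>\<^sup>2 * A2) + ?c3 * (\<alpha> ^ 3 * A3) \<le> 16 * NV"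
      by (simp add: algebra_simps)
    have "\<kappa> * (\<alpha> ^ 3 * A3 + \<alpha>\<^sup>2 * A2) = \<kappa> * (\<alpha>\<^sup>2 * A2) + \<kappa> * (\<alpha> ^ 3 * A3)"
      by (simp add: algebra_simps)
    also have "\<dots> \<le> ?c2 * (\<alpha>\<^sup>2 * A2) + ?c3 * (\<alpha> ^ 3 * A3)"
      using A \<alpha> by (intro add_mono mult_right_mono) (auto simp: \<kappa>_def)
    finally have "\<kappa> * (\<alpha> ^ 3 * A3 + \<alpha>\<^sup>2 * A2) \<le> 16 * NV"
      using main by linarith
    then have fin: "\<alpha> ^ 3 * A3 + \<alpha>\<^sup>2 * A2 \<le> 16 / \<kappa> * NV"
      using \<kappa> by (simp add: field_simps)
    have "ennreal (\<alpha> ^ 3) * ?L3 + ennreal (\<alpha>\<^sup>2) * ?L2 \<le> ennreal (\<alpha> ^ 3) * ennreal A3 + ennreal (\<alpha>\<^sup>2) * ennreal A2"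
      using L3 L2 by (intro add_mono mult_left_mono) auto
    also have "\<dots> = ennreal (\<alpha> ^ 3 * A3 + \<alpha>\<^sup>2 * A2)"
      using A \<alpha> by (simp add: ennreal_mult ennreal_plus)
    also have "\<dots> \<le> ennreal (16 / \<kappa> * NV)"
      by (rule ennreal_leI[OF fin])
    also have "\<dots> = ennreal (16 / \<kappa>) * ?N"
      unfolding NV(1) using \<kappa> NV(2) by (subst ennreal_mult[symmetric]) auto
    finally show ?thesis .
  qed
qed

text \<open>The cube of K to the power 2/3 is K^2, which matches the \<alpha>^3 available for
  absorption. The constant 1 + 16/c is at least 1 and, multiplied by c, at least 16.\<close>

lemma large_parameter:
  fixes K c \<alpha> :: real
  assumes c: "0 < c" and K: "0 \<le> K" and \<alpha>: "(1 + 16 / c) * (K powr (2 / 3) + 1) \<le> \<alpha>"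
  shows "0 < \<alpha>" "16 * K\<^sup>2 \<le> c * \<alpha> ^ 3"
proof -
  define C where "C = 1 + 16 / c"
  have C: "C \<ge> 1" "16 \<le> c * C"
    using c by (auto simp: C_def field_simps)
  show "0 < \<alpha>"
    using C by (intro less_le_trans[OF _ \<alpha>[folded C_def]]) (auto intro!: mult_pos_pos add_nonneg_pos)
  have "K\<^sup>2 = (K powr (2 / 3)) ^ 3"
    using K by (cases "K = 0") (auto simp: powr_realpow[symmetric] powr_powr simp flip: powr_numeral)
  also have "\<dots> \<le> (K powr (2 / 3) + 1) ^ 3"
    by (intro power_mono) auto
  finally have "16 * K\<^sup>2 \<le> (c * C) * (K powr (2 / 3) + 1) ^ 3"
    using C by (intro mult_mono) auto
  also have "\<dots> \<le> (c * C ^ 3) * (K powr (2 / 3) + 1) ^ 3"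
    using c C self_le_power[of C 3] by (intro mult_right_mono mult_left_mono) auto
  also have "\<dots> = c * (C * (K powr (2 / 3) + 1)) ^ 3"
    by (simp add: power_mult_distrib)
  also have "\<dots> \<le> c * \<alpha> ^ 3"
    using \<alpha> c C unfolding C_def[symmetric]
    by (intro mult_left_mono power_mono) (auto intro!: mult_nonneg_nonneg add_nonneg_nonneg)
  finally show "16 * K\<^sup>2 \<le> c * \<alpha> ^ 3" .
qed

theorem theorem1p2:
  fixes \<gamma> \<epsilon> :: real
  assumes "\<gamma> > 0" and "0 < \<epsilon>" and "\<epsilon> < 1"
  shows "\<exists>R0>0. \<forall>a. 0 < a \<and> a < 1 \<longrightarrow>
    (\<exists>C>0. \<exists>C1>0. \<forall>R K \<alpha> :: real.
      \<forall>u Bu V :: ('m::finite, 'k::finite) point \<Rightarrow> real.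
        0 < R \<longrightarrow> R \<le> R0 \<longrightarrow> 0 \<le> K \<longrightarrow>
        u \<in> S22_0 \<gamma> (pball \<gamma> R - pball \<gamma> (a * R)) \<longrightarrow>
        has_grushin \<gamma> (pball \<gamma> R - pball \<gamma> (a * R)) u Bu \<longrightarrow>
        set_borel_measurable lebesgue (pball \<gamma> R) V \<longrightarrow>
        (AE p in lebesgue. p \<in> pball \<gamma> R \<longrightarrow> \<bar>V p\<bar> \<le> K * angle_fn \<gamma> p) \<longrightarrow>
        (hom_dim \<gamma> TYPE(('m, 'k) point) - 4) / 2 < \<alpha> \<longrightarrow>
        C1 * (K powr (2 / 3) + 1) \<le> \<alpha> \<longrightarrow>
        ennreal (\<alpha> ^ 3) *
          (\<integral>\<^sup>+ p\<in>pball \<gamma> R. ennreal (pgauge \<gamma> p powr (- 2 * \<alpha> - 4 + \<epsilon>) * (u p)\<^sup>2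
             * exp (2 * \<alpha> * pgauge \<gamma> p powr \<epsilon>) * angle_fn \<gamma> p) \<partial>lebesgue)
        + ennreal (\<alpha>\<^sup>2) *
          (\<integral>\<^sup>+ p\<in>pball \<gamma> R. ennreal (pgauge \<gamma> p powr (- 2 * \<alpha> - 4) * (u p)\<^sup>2
             * exp (2 * \<alpha> * pgauge \<gamma> p powr \<epsilon>) * angle_fn \<gamma> p) \<partial>lebesgue)
        \<le> ennreal C *
          (\<integral>\<^sup>+ p\<in>pball \<gamma> R. ennreal (pgauge \<gamma> p powr (- 2 * \<alpha>)
             * exp (2 * \<alpha> * pgauge \<gamma> p powr \<epsilon>) * (Bu p + V p * u p)\<^sup>2
             * inverse (angle_fn \<gamma> p)) \<partial>lebesgue))"
proof (rule exI[of _ 1], rule conjI[OF zero_less_one], intro allI impI, elim conjE, goal_cases)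
  case (1 a)
  note a = 1
  \<comment> \<open>\<open>c\<close> is half the coefficient from \<open>th_bb_lower\<close>, and
    the second entry of \<open>\<kappa>\<close> comes from the width ln(2/a). Hence
    \<open>C1 = 1 + 16 / c\<close> depends on \<epsilon> only and \<open>C = 16 / \<kappa>\<close>
    on \<epsilon> and a.\<close>
  define c where "c = \<epsilon>\<^sup>2 * (1 - \<epsilon>)\<^sup>2"
  define \<kappa> where "\<kappa> = min c ((1 - \<epsilon>)\<^sup>2 / (2 * (ln (2 / a))\<^sup>2))"
  have c: "c > 0"
    using assms by (simp add: c_def)
  have "ln (2 / a) > 0"
    using a by (simp add: ln_gt_zero)
  then have \<kappa>: "16 / \<kappa> > 0"
    using assms c by (simp add: \<kappa>_def)
  have C1: "1 + 16 / c > 0"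
    using c by (simp add: add_pos_pos)
  show ?case
  proof (rule exI[of _ "16 / \<kappa>"], rule conjI[OF \<kappa>], rule exI[of _ "1 + 16 / c"], rule conjI[OF C1],
      intro allI impI, goal_cases)
    case (1 R K \<alpha> u Bu V)
    note large = large_parameter[OF c 1(3) 1(9)]
    interpret carleman_weight \<alpha> \<epsilon>
      by unfold_locales (use large assms in auto)
    show ?case
      unfolding \<kappa>_def c_def
      by (rule carleman_estimate[OF assms(1) 1(1,2) a 1(3,5,6,7) large(2)[unfolded c_def]])
  qed
qed

end
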